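(* Let $\mathbf{U}=\bigvee_{p\in\mathbb{P}}\mathbf{Ab}(p)*\mathbf{Ab}(p-1)$. The following conditions are equivalent for any finite group $G$: (i) $G\in\mathbf{U}$; (ii) $G\in\mathbf{Su}\cap\mathrm{Der}(\mathbf{E})\cap\mathrm{Syl}(\mathbf{Ab})$; (iii) $G$ embeds into $(C_{p_1}\rtimes C_{p_1-1})\times\cdots\times(C_{p_s}\rtimes C_{p_s-1})$ for some (finite, possibly empty, list of) primes $p_1,\dots,p_s$, not necessarily distinct; (iv) $G$ embeds into $(C_{p_1}\rtimes C_{p_1-1})\times\cdots\times(C_{p_s}\rtimes C_{p_s-1})\times C_{|G|}^m$ for some (finite, possibly empty, list of) prime divisors $p_1,\dots,p_s$ of $|G|$, not necessarily distinct, and some $m\in\mathbb{N}$.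
   Context: A pseudovariety is a class of finite groups closed under taking subgroups, homomorphic images and finitary direct products; $\bigvee$ denotes join (smallest pseudovariety containing all the given ones). $\mathbb{P}$ is the set of all primes. $\mathbf{Ab}$ is the pseudovariety of finite abelian groups and $\mathbf{Ab}(n)$ the pseudovariety of finite abelian groups of exponent dividing $n$. For pseudovarieties $\mathbf{V},\mathbf{W}$, $\mathbf{V}*\mathbf{W}$ is the pseudovariety of all finite groups $G$ having a normal subgroup $N\in\mathbf{V}$ with $G/N\in\mathbf{W}$ (equivalently, all subgroups of semidirect products $V\rtimes W$ with $V\in\mathbf{V}$, $W\in\mathbf{W}$). $\mathbf{Su}$ is the pseudovariety of finite supersolvable groups (all chief factors cyclic). $\mathbf{E}$ is the pseudovariety generated by all groups of prime order (equivalently, by all finite elementary abelian groups). $\mathrm{Der}(\mathbf{V})$ is the class of finite groups $G$ with $[G,G]\in\mathbf{V}$; $\mathrm{Syl}(\mathbf{V})$ is the class of finite groups all of whose Sylow subgroups belong to $\mathbf{V}$. $C_m$ is the cyclic group of order $m$, and $C_m^k$ the direct product of $k$ copies of it. For a prime $p$, $C_p\rtimes C_{p-1}$ denotes the group $G_p=\langle x,y\mid x^p=1,\ y^{p-1}=1,\ yxy^{-1}=x^{q_p}\rangle$, where $q_p$ is a primitive root modulo $p$ (so $C_{p-1}$ acts faithfully on $C_p$). *)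

theory Defs
  imports
    "HOL-Algebra.Algebra"
    "HOL-Number_Theory.Residue_Primitive_Roots"
begin

text \<open>
  Every finite group is isomorphic to one whose elements are natural numbers. A class of finite
  groups is therefore represented by a set of groups of type \<^typ>\<open>nat monoid\<close>, and a finite group
  over any other type belongs to the class if it is isomorphic to one of its members.
\<close>

definition finite_group :: "('a, 'b) monoid_scheme \<Rightarrow> bool" where
  "finite_group G \<longleftrightarrow> group G \<and> finite (carrier G)"

definition in_class :: "('a, 'b) monoid_scheme \<Rightarrow> nat monoid set \<Rightarrow> bool" where
  "in_class G V \<longleftrightarrow> (\<exists>H\<in>V. group G \<and> G \<cong> H)"

text \<open>
  The case \<open>n = 0\<close> of closure under products says that a pseudovariety contains the trivial groups.
  The requirement that \<open>H\<close> be a group is needed because \<^const>\<open>hom\<close> and \<open>\<cong>\<close> only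
  speak about multiplication on the carriers. Closure under isomorphism is the special case of an
  injective epimorphism.
\<close>

definition pseudovariety :: "nat monoid set \<Rightarrow> bool" where
  "pseudovariety V \<longleftrightarrow>
     (\<forall>G\<in>V. finite_group G) \<and>
     (\<forall>G\<in>V. \<forall>H. subgroup H G \<longrightarrow> G\<lparr>carrier := H\<rparr> \<in> V) \<and>
     (\<forall>G\<in>V. \<forall>H. group H \<and> epi G H \<noteq> {} \<longrightarrow> H \<in> V) \<and>
     (\<forall>(n::nat) F. (\<forall>i<n. F i \<in> V) \<longrightarrow>
        (\<forall>H. group H \<and> H \<cong> product_group {..<n} F \<longrightarrow> H \<in> V))"

definition pv_generated :: "nat monoid set \<Rightarrow> nat monoid set" where
  "pv_generated S = \<Inter>{V. pseudovariety V \<and> S \<subseteq> V}"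

definition pv_join :: "nat monoid set set \<Rightarrow> nat monoid set" where
  "pv_join \<V> = \<Inter>{V. pseudovariety V \<and> (\<forall>W\<in>\<V>. W \<subseteq> V)}"

definition pv_prod :: "nat monoid set \<Rightarrow> nat monoid set \<Rightarrow> nat monoid set" (infixl \<open>\<star>\<close> 70) where
  "V \<star> W = {G. finite_group G \<and>
              (\<exists>N. N \<lhd> G \<and> G\<lparr>carrier := N\<rparr> \<in> V \<and> in_class (G Mod N) W)}"

definition Ab :: "nat monoid set" where
  "Ab = {G. finite_group G \<and> comm_group G}"

definition Ab_exp :: "nat \<Rightarrow> nat monoid set" where
  "Ab_exp n = {G \<in> Ab. \<forall>x\<in>carrier G. x [^]\<^bsub>G\<^esub> n = \<one>\<^bsub>G\<^esub>}"

definition \<U> :: "nat monoid set" where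
  "\<U> = pv_join {Ab_exp p \<star> Ab_exp (p - 1) | p. Factorial_Ring.prime p}"

text \<open>The chief factor is the quotient of \<open>H\<close> by \<open>K\<close>.\<close>

definition chief_factor :: "('a, 'b) monoid_scheme \<Rightarrow> 'a set \<Rightarrow> 'a set \<Rightarrow> bool" where
  "chief_factor G H K \<longleftrightarrow> H \<lhd> G \<and> K \<lhd> G \<and> K \<subset> H \<and>
     (\<forall>L. L \<lhd> G \<and> K \<subseteq> L \<and> L \<subseteq> H \<longrightarrow> L = K \<or> L = H)"

definition Su :: "nat monoid set" where
  "Su = {G. finite_group G \<and>
            (\<forall>H K. chief_factor G H K \<longrightarrow> cyclic_group ((G\<lparr>carrier := H\<rparr>) Mod K))}"

definition E :: "nat monoid set" where
  "E = pv_generated {G. group G \<and> Factorial_Ring.prime (order G)}"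

definition Der :: "nat monoid set \<Rightarrow> nat monoid set" where
  "Der V = {G. finite_group G \<and> G\<lparr>carrier := derived G (carrier G)\<rparr> \<in> V}"

definition sylow_subgroup :: "nat \<Rightarrow> 'a set \<Rightarrow> ('a, 'b) monoid_scheme \<Rightarrow> bool" where
  "sylow_subgroup p P G \<longleftrightarrow> subgroup P G \<and> card P = p ^ multiplicity p (order G)"

definition Syl :: "nat monoid set \<Rightarrow> nat monoid set" where
  "Syl V = {G. finite_group G \<and>
     (\<forall>p P. Factorial_Ring.prime p \<and> sylow_subgroup p P G \<longrightarrow> G\<lparr>carrier := P\<rparr> \<in> V)}"

text \<open>
  Groups given by generators and relations: the generators are all elements of type \<open>'g\<close>, the letter
  \<open>(a, True)\<close> stands for \<open>a\<close> and \<open>(a, False)\<close> for its formal inverse, and a pair \<open>(u, v)\<close> in \<open>R\<close>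
  stands for the relation \<open>u = v\<close>.
\<close>

type_synonym 'g word = "('g \<times> bool) list"

inductive pres_eq :: "('g word \<times> 'g word) set \<Rightarrow> 'g word \<Rightarrow> 'g word \<Rightarrow> bool" for R where
  relator: "(u, v) \<in> R \<Longrightarrow> pres_eq R u v"
| cancel: "pres_eq R [(a, b), (a, \<not> b)] []"
| refl: "pres_eq R u u"
| sym: "pres_eq R u v \<Longrightarrow> pres_eq R v u"
| trans: "pres_eq R u v \<Longrightarrow> pres_eq R v w \<Longrightarrow> pres_eq R u w"
| append: "pres_eq R u v \<Longrightarrow> pres_eq R u' v' \<Longrightarrow> pres_eq R (u @ u') (v @ v')"

definition presented_group :: "('g word \<times> 'g word) set \<Rightarrow> 'g word set monoid" where
  "presented_group R =
     \<lparr>carrier = range (\<lambda>u. Collect (pres_eq R u)),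
      monoid.mult = (\<lambda>A B. {w. \<exists>u\<in>A. \<exists>v\<in>B. pres_eq R (u @ v) w}),
      one = Collect (pres_eq R [])\<rparr>"

datatype generator = Gen_x | Gen_y

definition metacyclic :: "nat \<Rightarrow> nat \<Rightarrow> generator word set monoid" where
  "metacyclic p q =
     (let x = (Gen_x, True); y = (Gen_y, True); y' = (Gen_y, False)
      in presented_group {(replicate p x, []), (replicate (p - 1) y, []), ([y, x, y'], replicate q x)})"

end

theory Submission
  imports Defs
begin

text \<open>
  All four conditions are compared with a fifth one. For every prime \<open>p\<close> there is an \<open>s\<close> prime to \<open>p\<close>
  such that, for all elements of the group,

    \<open>[[x, y], [z, w]] = 1\<close>, \<open>[x, y]^(s p) = 1\<close>, \<open>[z^(p - 1), [x, y]^s] = 1\<close>, \<open>[x^s, y^s]^s = 1\<close>.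

  In a finite group a suitable power \<open>s\<close> prime to \<open>p\<close> removes the part of an element that is prime
  to \<open>p\<close>. So the laws say that the derived subgroup \<open>A\<close> is abelian of squarefree exponent, that
  \<open>(p - 1)\<close>-st powers centralize its \<open>p\<close>-part, and that commutators of \<open>p\<close>-elements have no \<open>p\<close>-part.

  From \<open>\<U>\<close> and the embeddings to the laws. The laws are identities, and they survive the passage
  from \<open>s\<close> to a multiple. Hence the finite groups that obey them form a pseudovariety
  (\<open>pseudovariety_obeys_laws\<close>). It contains every member of \<open>Ab(p) * Ab(p - 1)\<close>: take \<open>s = p - 1\<close>
  for the prime \<open>p\<close> itself and \<open>s = p\<close> for all other primes.

  From the laws to the embeddings. A pair \<open>(f, \<chi>)\<close> with \<open>\<chi>\<close> multiplicative and
  \<open>f(u v) = f(u) + \<chi>(u) f(v)\<close> modulo \<open>p\<close> is the same as a homomorphism to the affine group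
  of the line over the field with \<open>p\<close> elements, and that group is \<open>C\<^sub>p \<rtimes> C\<^sub>p\<^sub>-\<^sub>1\<close>. It suffices to find
  for every \<open>g \<noteq> 1\<close> such a pair which is nontrivial at \<open>g\<close>.
  If \<open>g \<in> A\<close>, there is a homomorphism \<open>\<lambda>\<close> from \<open>A\<close> to the integers modulo some \<open>p\<close> with
  \<open>\<lambda>(g) \<noteq> 0\<close>. The conjugations act on these homomorphisms, they commute with each other since \<open>A\<close>
  is abelian, and by the third law their \<open>(p - 1)\<close>-st powers are trivial. So they can be
  diagonalized over the field with \<open>p\<close> elements, and \<open>\<lambda>\<close> may be chosen with
  \<open>\<lambda>(u a u^(-1)) = \<chi>(u) \<lambda>(a)\<close> (\<open>equivariant_character\<close>). If \<open>\<chi>\<close> were trivial,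
  then \<open>(x, y) \<mapsto> \<lambda>([x, y])\<close> would be additive in both arguments and the last law would make it
  zero. Hence \<open>\<chi>(u) \<noteq> 1\<close> for some \<open>u\<close>. Now \<open>f(v) = \<lambda>([u, v])\<close> is defined on the whole group,
  satisfies the cocycle equation, and \<open>f(g) = (\<chi>(u) - 1) \<lambda>(g) \<noteq> 0\<close>. If \<open>g \<notin> A\<close>, a character of the abelian quotient by \<open>A\<close> separates \<open>g\<close>; its values lie in a
  cyclic group whose order is that of the group, and, after restriction to one prime
  power \<open>p^k\<close>, in the multiplicative group modulo a prime \<open>r\<close> with \<open>r \<equiv> 1\<close> modulo \<open>p^k\<close>.

  The structural description. The equivariant homomorphisms \<open>\<lambda>\<close> also show that the laws make all
  chief factors cyclic, and that \<open>A\<close> is a subgroup of a product of groups of prime order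
  (\<open>law_group_structure\<close>). Conversely, assume the structural conditions, let \<open>P\<close> be a Sylow \<open>p\<close>-subgroup
  of index \<open>m\<close> and \<open>B\<close> the \<open>p\<close>-part of \<open>A\<close>. Then \<open>B \<subseteq> P\<close>, so \<open>A P\<close> centralizes \<open>B\<close>, and all
  \<open>m\<close>-th powers lie in \<open>A P\<close>; this gives the last law. If \<open>v = u^(p - 1)\<close> did not
  centralize \<open>B\<close>, then \<open>[v, B]\<close> would contain a minimal normal subgroup of order \<open>p\<close>; there \<open>v\<close> is
  trivial by Fermat's theorem, which contradicts that \<open>v\<close> acts on \<open>B\<close> with order
  prime to \<open>p\<close> (\<open>power_centralizes_elementary_abelian\<close>).
\<close>

section \<open>Commutators and the derived subgroup\<close>

definition gcomm :: "('a, 'b) monoid_scheme \<Rightarrow> 'a \<Rightarrow> 'a \<Rightarrow> 'a" where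
  "gcomm G x y = x \<otimes>\<^bsub>G\<^esub> y \<otimes>\<^bsub>G\<^esub> inv\<^bsub>G\<^esub> x \<otimes>\<^bsub>G\<^esub> inv\<^bsub>G\<^esub> y"

context group
begin

abbreviation conj :: "'a \<Rightarrow> 'a \<Rightarrow> 'a" where
  "conj u a \<equiv> u \<otimes> a \<otimes> inv u"

lemma cancel_inv_left: "x \<in> carrier G \<Longrightarrow> y \<in> carrier G \<Longrightarrow> inv x \<otimes> (x \<otimes> y) = y"
  by (simp flip: m_assoc)

lemma cancel_left_inv: "x \<in> carrier G \<Longrightarrow> y \<in> carrier G \<Longrightarrow> x \<otimes> (inv x \<otimes> y) = y"
  by (simp flip: m_assoc)

text \<open>Rewriting with these equations decides which words are equal in every group.\<close>

lemmas group_word = m_assoc inv_mult_group cancel_inv_left cancel_left_inv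

lemma gcomm_closed [simp, intro]:
  "x \<in> carrier G \<Longrightarrow> y \<in> carrier G \<Longrightarrow> gcomm G x y \<in> carrier G"
  by (simp add: gcomm_def)

lemma gcomm_eq_one_iff:
  assumes "x \<in> carrier G" "y \<in> carrier G"
  shows "gcomm G x y = \<one> \<longleftrightarrow> x \<otimes> y = y \<otimes> x"
  by (smt (verit, best) assms gcomm_def inv_closed inv_equality inv_inv inv_mult_group m_assoc m_closed r_inv)

lemma mult_eq_gcomm:
  "x \<in> carrier G \<Longrightarrow> y \<in> carrier G \<Longrightarrow> x \<otimes> y = gcomm G x y \<otimes> (y \<otimes> x)"
  by (simp add: gcomm_def group_word)

lemma gcomm_mult_right:
  assumes "u \<in> carrier G" "v \<in> carrier G" "w \<in> carrier G"
  shows "gcomm G u (v \<otimes> w) = gcomm G u v \<otimes> conj v (gcomm G u w)"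
  using assms by (simp add: gcomm_def group_word)

lemma gcomm_mult_left:
  assumes "u \<in> carrier G" "v \<in> carrier G" "w \<in> carrier G"
  shows "gcomm G (v \<otimes> w) u = conj v (gcomm G w u) \<otimes> gcomm G v u"
  using assms by (simp add: gcomm_def group_word)

lemma conj_mult:
  assumes "u \<in> carrier G" "a \<in> carrier G" "b \<in> carrier G"
  shows "conj u (a \<otimes> b) = conj u a \<otimes> conj u b"
  using assms by (simp add: group_word)

lemma conj_conj:
  assumes "u \<in> carrier G" "v \<in> carrier G" "a \<in> carrier G"
  shows "conj (u \<otimes> v) a = conj u (conj v a)"
  using assms by (simp add: group_word)

lemma conj_pow:
  assumes "u \<in> carrier G" "a \<in> carrier G"
  shows "conj u (a [^] (n::nat)) = conj u a [^] n"
proof (induction n)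
  case (Suc n)
  have "conj u (a [^] Suc n) = conj u (a [^] n) \<otimes> conj u a"
    using assms by (simp add: group_word)
  then show ?case
    using Suc by simp
qed (use assms in simp)

lemma conj_eq_self_iff:
  assumes "u \<in> carrier G" "a \<in> carrier G"
  shows "conj u a = a \<longleftrightarrow> u \<otimes> a = a \<otimes> u"
  by (metis assms inv_closed inv_solve_right m_closed)

abbreviation derived_subgroup :: "'a set" where
  "derived_subgroup \<equiv> derived G (carrier G)"

lemma gcomm_in_derived:
  "x \<in> carrier G \<Longrightarrow> y \<in> carrier G \<Longrightarrow> gcomm G x y \<in> derived_subgroup"
  unfolding derived_def gcomm_def by (rule generate.incl) auto

lemma derived_subgroup_least:
  assumes "subgroup K G" and "\<And>x y. x \<in> carrier G \<Longrightarrow> y \<in> carrier G \<Longrightarrow> gcomm G x y \<in> K"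
  shows "derived_subgroup \<subseteq> K"
  unfolding derived_def
  by (rule generate_subgroup_incl) (use assms in \<open>auto simp: gcomm_def\<close>)

lemma derived_normal: "derived_subgroup \<lhd> G"
  unfolding normal_inv_iff
proof (intro conjI ballI)
  show "subgroup derived_subgroup G"
    by (simp add: derived_is_subgroup)
next
  fix x h assume "x \<in> carrier G" "h \<in> derived_subgroup"
  moreover from this have "h \<in> carrier G" "gcomm G x h \<in> derived_subgroup"
    using derived_in_carrier by (blast intro: gcomm_in_derived)+
  moreover have "conj x h = gcomm G x h \<otimes> h"
    using calculation by (simp add: gcomm_def group_word)
  ultimately show "conj x h \<in> derived_subgroup"
    using derived_is_subgroup[of "carrier G"] by (simp add: subgroup.m_closed)
qed

lemma derived_conj_closed:
  "u \<in> carrier G \<Longrightarrow> a \<in> derived_subgroup \<Longrightarrow> conj u a \<in> derived_subgroup"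
  using derived_normal by (simp add: normal_inv_iff)

lemma derived_carrier: "a \<in> derived_subgroup \<Longrightarrow> a \<in> carrier G"
  using derived_in_carrier by blast

end

section \<open>The laws\<close>

text \<open>
  The four words are kept together as a set of values, because all closure properties of the
  laws follow from the way in which homomorphisms move these values.
\<close>

definition law_values :: "nat \<Rightarrow> nat \<Rightarrow> ('a, 'b) monoid_scheme \<Rightarrow> 'a \<Rightarrow> 'a \<Rightarrow> 'a \<Rightarrow> 'a \<Rightarrow> 'a set" where
  "law_values p s G x y z w =
     {gcomm G (gcomm G x y) (gcomm G z w),
      gcomm G x y [^]\<^bsub>G\<^esub> (s * p),
      gcomm G (z [^]\<^bsub>G\<^esub> (p - 1)) (gcomm G x y [^]\<^bsub>G\<^esub> s),
      gcomm G (x [^]\<^bsub>G\<^esub> s) (y [^]\<^bsub>G\<^esub> s) [^]\<^bsub>G\<^esub> s}"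

definition laws :: "nat \<Rightarrow> nat \<Rightarrow> ('a, 'b) monoid_scheme \<Rightarrow> 'a set" where
  "laws p s G = (\<Union>x\<in>carrier G. \<Union>y\<in>carrier G. \<Union>z\<in>carrier G. \<Union>w\<in>carrier G. law_values p s G x y z w)"

definition obeys_laws :: "('a, 'b) monoid_scheme \<Rightarrow> bool" where
  "obeys_laws G \<longleftrightarrow>
     (\<forall>p. Factorial_Ring.prime p \<longrightarrow> (\<exists>s. coprime s p \<and> laws p s G \<subseteq> {\<one>\<^bsub>G\<^esub>}))"

lemma (in group) laws_trivial_iff:
  "laws p s G \<subseteq> {\<one>} \<longleftrightarrow>
     (\<forall>x\<in>carrier G. \<forall>y\<in>carrier G. \<forall>z\<in>carrier G. \<forall>w\<in>carrier G.
        gcomm G x y \<otimes> gcomm G z w = gcomm G z w \<otimes> gcomm G x y \<and>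
        gcomm G x y [^] (s * p) = \<one> \<and>
        z [^] (p - 1) \<otimes> gcomm G x y [^] s = gcomm G x y [^] s \<otimes> z [^] (p - 1) \<and>
        gcomm G (x [^] s) (y [^] s) [^] s = \<one>)"
proof -
  have "laws p s G \<subseteq> {\<one>} \<longleftrightarrow>
     (\<forall>x\<in>carrier G. \<forall>y\<in>carrier G. \<forall>z\<in>carrier G. \<forall>w\<in>carrier G. law_values p s G x y z w \<subseteq> {\<one>})"
    by (simp only: laws_def UN_subset_iff)
  also have "\<dots> \<longleftrightarrow> (\<forall>x\<in>carrier G. \<forall>y\<in>carrier G. \<forall>z\<in>carrier G. \<forall>w\<in>carrier G.
        gcomm G x y \<otimes> gcomm G z w = gcomm G z w \<otimes> gcomm G x y \<and>
        gcomm G x y [^] (s * p) = \<one> \<and>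
        z [^] (p - 1) \<otimes> gcomm G x y [^] s = gcomm G x y [^] s \<otimes> z [^] (p - 1) \<and>
        gcomm G (x [^] s) (y [^] s) [^] s = \<one>)"
    by (intro ball_cong) (simp_all add: law_values_def gcomm_eq_one_iff)
  finally show ?thesis .
qed

lemma (in group) law_values_closed:
  "x \<in> carrier G \<Longrightarrow> y \<in> carrier G \<Longrightarrow> z \<in> carrier G \<Longrightarrow> w \<in> carrier G \<Longrightarrow>
    law_values p s G x y z w \<subseteq> carrier G"
  by (simp add: law_values_def)

lemma (in group) laws_subset_carrier: "laws p s G \<subseteq> carrier G"
  unfolding laws_def by (intro UN_least law_values_closed)

lemma law_values_subset_laws:
  assumes "x \<in> carrier G" "y \<in> carrier G" "z \<in> carrier G" "w \<in> carrier G"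
  shows "law_values p s G x y z w \<subseteq> laws p s G"
  unfolding laws_def
  by (intro subsetI UN_I[OF assms(1)] UN_I[OF assms(2)] UN_I[OF assms(3)] UN_I[OF assms(4)])

lemma (in group_hom) hom_gcomm:
  "x \<in> carrier G \<Longrightarrow> y \<in> carrier G \<Longrightarrow> h (gcomm G x y) = gcomm H (h x) (h y)"
  by (simp add: gcomm_def)

lemma (in group_hom) hom_law_values:
  "x \<in> carrier G \<Longrightarrow> y \<in> carrier G \<Longrightarrow> z \<in> carrier G \<Longrightarrow> w \<in> carrier G \<Longrightarrow>
    h ` law_values p s G x y z w = law_values p s H (h x) (h y) (h z) (h w)"
  by (simp add: law_values_def hom_gcomm hom_nat_pow)

lemma (in group_hom) hom_laws_eq:
  "h ` laws p s G = (\<Union>x\<in>carrier G. \<Union>y\<in>carrier G. \<Union>z\<in>carrier G. \<Union>w\<in>carrier G.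
     law_values p s H (h x) (h y) (h z) (h w))"
  unfolding laws_def image_UN by (simp add: hom_law_values)

lemma (in group_hom) hom_laws: "h ` laws p s G \<subseteq> laws p s H"
  unfolding hom_laws_eq by (intro UN_least law_values_subset_laws hom_closed)

lemma (in group_hom) laws_epi:
  assumes "h ` carrier G = carrier H"
  shows "laws p s H \<subseteq> h ` laws p s G"
  unfolding hom_laws_eq unfolding laws_def assms[symmetric] by simp

text \<open>
  Replacing \<open>s\<close> by a multiple is what allows one exponent to serve several groups at once.
  In the last law the inner powers are absorbed since \<open>x\<close> and \<open>y\<close> range over the whole group.
\<close>

lemma (in group) laws_mono:
  assumes "laws p s G \<subseteq> {\<one>}" and "s dvd s'"
  shows "laws p s' G \<subseteq> {\<one>}"
proof -
  obtain k where s': "s' = s * k"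
    using assms(2) by blast
  note laws = assms(1)[unfolded laws_trivial_iff, rule_format]
  show ?thesis
    unfolding laws_trivial_iff
  proof (intro ballI conjI)
    fix x y z w assume xy: "x \<in> carrier G" "y \<in> carrier G" and z: "z \<in> carrier G" and w: "w \<in> carrier G"
    have "gcomm G x y [^] (s' * p) = (gcomm G x y [^] (s * p)) [^] k"
      using xy by (simp add: nat_pow_pow s' ac_simps)
    then show "gcomm G x y [^] (s' * p) = \<one>"
      using laws xy by simp
    show "gcomm G (x [^] s') (y [^] s') [^] s' = \<one>"
    proof -
      have "gcomm G (x [^] s') (y [^] s') [^] s'
          = (gcomm G ((x [^] k) [^] s) ((y [^] k) [^] s) [^] s) [^] k"
        using xy by (simp add: nat_pow_pow s' ac_simps)
      then show ?thesis
        using laws[of "x [^] k" "y [^] k"] xy by simp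
    qed
    have "gcomm G x y [^] s \<otimes> z [^] (p - 1) = z [^] (p - 1) \<otimes> gcomm G x y [^] s"
      using laws xy z by simp
    from group_commutes_pow[OF this] show
      "z [^] (p - 1) \<otimes> gcomm G x y [^] s' = gcomm G x y [^] s' \<otimes> z [^] (p - 1)"
      using xy z by (simp add: nat_pow_pow s')
    show "gcomm G x y \<otimes> gcomm G z w = gcomm G z w \<otimes> gcomm G x y"
      using laws xy z w by simp
  qed
qed

lemma obeys_laws_embedding:
  assumes "group G" "group H" "h \<in> mon G H" "obeys_laws H"
  shows "obeys_laws G"
proof -
  interpret group_hom G H h
    using assms by (simp add: group_hom_def group_hom_axioms_def mon_def)
  have "t = \<one>\<^bsub>G\<^esub>" if "t \<in> laws p s G" "laws p s H \<subseteq> {\<one>\<^bsub>H\<^esub>}" for t p s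
  proof -
    have "h t = h \<one>\<^bsub>G\<^esub>"
      using that hom_laws[of p s] by auto
    then show ?thesis
      using assms(3) subsetD[OF G.laws_subset_carrier that(1)] inj_onD[of h "carrier G" t "\<one>\<^bsub>G\<^esub>"]
      by (simp add: mon_def)
  qed
  then have *: "laws p s G \<subseteq> {\<one>\<^bsub>G\<^esub>}" if "laws p s H \<subseteq> {\<one>\<^bsub>H\<^esub>}" for p s
    using that by (intro subsetI singletonI) simp
  show ?thesis
    unfolding obeys_laws_def
  proof (intro allI impI)
    fix p :: nat assume "Factorial_Ring.prime p"
    then obtain s where "coprime s p" "laws p s H \<subseteq> {\<one>\<^bsub>H\<^esub>}"
      using assms(4) by (auto simp: obeys_laws_def)
    then show "\<exists>s. coprime s p \<and> laws p s G \<subseteq> {\<one>\<^bsub>G\<^esub>}"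
      using * by (intro exI[of _ s]) simp
  qed
qed

text \<open>
  The product of the individual exponents is still prime to \<open>p\<close>.
\<close>

lemma common_exponent:
  fixes Q :: "'i \<Rightarrow> nat \<Rightarrow> bool"
  assumes "finite I" and "\<And>i. i \<in> I \<Longrightarrow> \<exists>s. coprime s (p::nat) \<and> Q i s"
    and mono: "\<And>i s s'. i \<in> I \<Longrightarrow> Q i s \<Longrightarrow> s dvd s' \<Longrightarrow> Q i s'"
  shows "\<exists>s. coprime s p \<and> (\<forall>i\<in>I. Q i s)"
proof -
  define e where "e i = (SOME s. coprime s p \<and> Q i s)" for i
  have e: "coprime (e i) p \<and> Q i (e i)" if "i \<in> I" for i
    unfolding e_def using someI_ex[OF assms(2)[OF that]] .
  have "coprime (prod e I) p"
    using e by (simp add: prod_coprime_left)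
  moreover have "Q i (prod e I)" if "i \<in> I" for i
    by (rule mono[OF that]) (use e that \<open>finite I\<close> in auto)
  ultimately show ?thesis
    by (intro exI[of _ "prod e I"]) simp
qed

text \<open>
  The projections carry law values to law values, and an element of the product whose
  projections are all trivial is trivial.
\<close>

lemma obeys_laws_product:
  assumes "finite I" "\<And>i. i \<in> I \<Longrightarrow> group (F i)" "\<And>i. i \<in> I \<Longrightarrow> obeys_laws (F i)"
  shows "obeys_laws (product_group I F)"
  unfolding obeys_laws_def
proof (intro allI impI)
  fix p :: nat assume "Factorial_Ring.prime p"
  then obtain s where s: "coprime s p" "\<forall>i\<in>I. laws p s (F i) \<subseteq> {\<one>\<^bsub>F i\<^esub>}"
    using common_exponent[of I p "\<lambda>i s. laws p s (F i) \<subseteq> {\<one>\<^bsub>F i\<^esub>}"] assms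
      group.laws_mono[OF assms(2)] unfolding obeys_laws_def by metis
  interpret P: group "product_group I F"
    by (simp add: assms(2))
  have "t = \<one>\<^bsub>product_group I F\<^esub>" if t: "t \<in> laws p s (product_group I F)" for t
  proof
    fix i
    have tc: "t \<in> carrier (product_group I F)"
      using P.laws_subset_carrier t by blast
    show "t i = \<one>\<^bsub>product_group I F\<^esub> i"
    proof (cases "i \<in> I")
      case True
      interpret group_hom "product_group I F" "F i" "\<lambda>f. f i"
        using True assms(2)
        by (auto simp: group_hom_def group_hom_axioms_def hom_def PiE_iff)
      show ?thesis
        using hom_laws[of p s] t s(2) True by auto
    next
      case False
      then show ?thesis
        using PiE_arb[of t I "\<lambda>i. carrier (F i)" i] tc by simp
    qed
  qed
  then show "\<exists>s. coprime s p \<and> laws p s (product_group I F) \<subseteq> {\<one>\<^bsub>product_group I F\<^esub>}"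
    using s(1) by blast
qed

lemma obeys_laws_DirProd:
  assumes "group G" "group H" "obeys_laws G" "obeys_laws H"
  shows "obeys_laws (G \<times>\<times> H)"
  unfolding obeys_laws_def
proof (intro allI impI)
  fix p :: nat assume "Factorial_Ring.prime p"
  then obtain s s' where s: "coprime s p" "laws p s G \<subseteq> {\<one>\<^bsub>G\<^esub>}"
      "coprime s' p" "laws p s' H \<subseteq> {\<one>\<^bsub>H\<^esub>}"
    using assms(3,4) unfolding obeys_laws_def by metis
  have GH: "laws p (s * s') G \<subseteq> {\<one>\<^bsub>G\<^esub>}" "laws p (s * s') H \<subseteq> {\<one>\<^bsub>H\<^esub>}"
    using group.laws_mono[OF assms(1) s(2)] group.laws_mono[OF assms(2) s(4)] by auto
  interpret f: group_hom "G \<times>\<times> H" G fst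
    using assms by (auto simp: group_hom_def group_hom_axioms_def DirProd_group hom_def)
  interpret g: group_hom "G \<times>\<times> H" H snd
    using assms by (auto simp: group_hom_def group_hom_axioms_def DirProd_group hom_def)
  have "t = \<one>\<^bsub>G \<times>\<times> H\<^esub>" if "t \<in> laws p (s * s') (G \<times>\<times> H)" for t
  proof -
    have "fst t \<in> {\<one>\<^bsub>G\<^esub>}" "snd t \<in> {\<one>\<^bsub>H\<^esub>}"
      using that GH f.hom_laws[of p "s * s'"] g.hom_laws[of p "s * s'"] by blast+
    then show ?thesis
      by (simp add: prod_eq_iff)
  qed
  then have "laws p (s * s') (G \<times>\<times> H) \<subseteq> {\<one>\<^bsub>G \<times>\<times> H\<^esub>}"
    by blast
  moreover have "coprime (s * s') p"
    using s by simp
  ultimately show "\<exists>s. coprime s p \<and> laws p s (G \<times>\<times> H) \<subseteq> {\<one>\<^bsub>G \<times>\<times> H\<^esub>}"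
    by blast
qed

lemma obeys_laws_comm_group:
  assumes "comm_group G" shows "obeys_laws G"
proof -
  interpret comm_group G by fact
  have "gcomm G x y = \<one>\<^bsub>G\<^esub>" if "x \<in> carrier G" "y \<in> carrier G" for x y
    using that by (simp add: gcomm_eq_one_iff m_comm)
  then have "laws p 1 G \<subseteq> {\<one>\<^bsub>G\<^esub>}" for p
    unfolding laws_trivial_iff by simp
  then show ?thesis
    unfolding obeys_laws_def by (meson coprime_1_left)
qed

section \<open>Pseudovarieties defined by laws\<close>

text \<open>
  Any family of law values that is compatible with homomorphisms defines a pseudovariety, provided
  that enlarging \<open>s\<close> preserves the laws; this last condition deals with finite products. It is applied
  to the laws above and to the laws of elementary abelian groups.
\<close>

lemma pseudovariety_of_laws:
  fixes L :: "nat \<Rightarrow> nat \<Rightarrow> nat monoid \<Rightarrow> nat set"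
  assumes closed: "\<And>p s G. group G \<Longrightarrow> L p s G \<subseteq> carrier G"
    and hom: "\<And>p s G H h. group_hom G H h \<Longrightarrow> h ` L p s G \<subseteq> L p s H"
    and epi: "\<And>p s G H h. group_hom G H h \<Longrightarrow> h ` carrier G = carrier H \<Longrightarrow> L p s H \<subseteq> h ` L p s G"
    and mono: "\<And>p s s' G. group G \<Longrightarrow> L p s G \<subseteq> {\<one>\<^bsub>G\<^esub>} \<Longrightarrow> s dvd s' \<Longrightarrow> L p s' G \<subseteq> {\<one>\<^bsub>G\<^esub>}"
  shows "pseudovariety {G. finite_group G \<and>
     (\<forall>p. Factorial_Ring.prime p \<longrightarrow> (\<exists>s. coprime s p \<and> L p s G \<subseteq> {\<one>\<^bsub>G\<^esub>}))}"
    (is "pseudovariety ?V")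
proof -
  have VI: "G \<in> ?V" if "group G" "finite (carrier G)"
    "\<And>p. Factorial_Ring.prime p \<Longrightarrow> \<exists>s. coprime s p \<and> L p s G \<subseteq> {\<one>\<^bsub>G\<^esub>}" for G
    using that by (simp add: finite_group_def)
  have VD: "group G" "finite (carrier G)"
    "\<And>p. Factorial_Ring.prime p \<Longrightarrow> \<exists>s. coprime s p \<and> L p s G \<subseteq> {\<one>\<^bsub>G\<^esub>}" if "G \<in> ?V" for G
    using that by (simp_all add: finite_group_def)
  show ?thesis
    unfolding pseudovariety_def
  proof (intro conjI ballI allI impI)
    fix G assume "G \<in> ?V"
    then show "finite_group G" by simp
  next
    fix G H assume G: "G \<in> ?V" and H: "subgroup H G"
    interpret group_hom "G\<lparr>carrier := H\<rparr>" G id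
      using G H group.canonical_inj_is_hom[of G H] by (simp add: finite_group_def)
    show "G\<lparr>carrier := H\<rparr> \<in> ?V"
    proof (rule VI)
      show "finite (carrier (G\<lparr>carrier := H\<rparr>))"
        using VD(2)[OF G] finite_subset[OF subgroup.subset[OF H]] by simp
      fix p :: nat assume "Factorial_Ring.prime p"
      then obtain s where s: "coprime s p" "L p s G \<subseteq> {\<one>\<^bsub>G\<^esub>}"
        using VD(3)[OF G] by blast
      have "L p s (G\<lparr>carrier := H\<rparr>) \<subseteq> L p s G"
        using hom[OF group_hom_axioms, of p s] by simp
      with s show "\<exists>s. coprime s p \<and> L p s (G\<lparr>carrier := H\<rparr>) \<subseteq> {\<one>\<^bsub>G\<lparr>carrier := H\<rparr>\<^esub>}"
        by (intro exI[of _ s]) simp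
    qed (rule G.is_group)
  next
    fix G H :: "nat monoid" assume G: "G \<in> ?V" and H: "group H \<and> epi G H \<noteq> {}"
    then obtain h where h: "h \<in> hom G H" "h ` carrier G = carrier H"
      unfolding epi_def by blast
    interpret group_hom G H h
      using G H h by (simp add: group_hom_def group_hom_axioms_def finite_group_def)
    show "H \<in> ?V"
    proof (rule VI)
      show "finite (carrier H)"
        using VD(2)[OF G] by (simp flip: h(2))
      fix p :: nat assume "Factorial_Ring.prime p"
      then obtain s where s: "coprime s p" "L p s G \<subseteq> {\<one>\<^bsub>G\<^esub>}"
        using VD(3)[OF G] by blast
      then have "h ` L p s G \<subseteq> {\<one>\<^bsub>H\<^esub>}"
        by auto
      with epi[OF group_hom_axioms h(2), of p s] s(1)
      show "\<exists>s. coprime s p \<and> L p s H \<subseteq> {\<one>\<^bsub>H\<^esub>}"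
        by (intro exI[of _ s]) simp
    qed (use H in simp)
  next
    fix n :: nat and F :: "nat \<Rightarrow> nat monoid" and H :: "nat monoid"
    assume F: "\<forall>i<n. F i \<in> ?V" and H: "group H \<and> H \<cong> product_group {..<n} F"
    then obtain h where h: "h \<in> iso H (product_group {..<n} F)"
      unfolding is_iso_def by blast
    have F': "group (F i)" "finite (carrier (F i))" if "i < n" for i
      using VD(1)[of "F i"] VD(2)[of "F i"] F that by simp_all
    have P: "group (product_group {..<n} F)" "finite (carrier (product_group {..<n} F))"
      using F' by (auto intro!: product_group finite_PiE)
    interpret h: group_hom H "product_group {..<n} F" h
      using H h P by (simp add: group_hom_def group_hom_axioms_def iso_def)
    have fin: "finite (carrier H)"
      using iso_finite[of H] H P(2) by blast
    have pr: "group_hom H (F i) (\<lambda>x. h x i)" if i: "i < n" for i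
    proof -
      have "h x i \<in> carrier (F i)" if "x \<in> carrier H" for x
        using h.hom_closed[OF that] i by auto
      moreover have "h (x \<otimes>\<^bsub>H\<^esub> y) i = h x i \<otimes>\<^bsub>F i\<^esub> h y i" if "x \<in> carrier H" "y \<in> carrier H" for x y
        using that i by simp
      ultimately show ?thesis
        using H F'[OF i] by (auto simp: group_hom_def group_hom_axioms_def hom_def)
    qed
    have "\<exists>s. coprime s p \<and> L p s H \<subseteq> {\<one>\<^bsub>H\<^esub>}" if p: "Factorial_Ring.prime p" for p :: nat
    proof -
      have "\<exists>s. coprime s p \<and> (\<forall>i\<in>{..<n}. L p s (F i) \<subseteq> {\<one>\<^bsub>F i\<^esub>})"
      proof (rule common_exponent)
        show "\<exists>s. coprime s p \<and> L p s (F i) \<subseteq> {\<one>\<^bsub>F i\<^esub>}" if "i \<in> {..<n}" for i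
          using VD(3)[of "F i"] F p that by blast
      qed (use mono F'(1) in auto)
      then obtain s where s: "coprime s p" "\<forall>i\<in>{..<n}. L p s (F i) \<subseteq> {\<one>\<^bsub>F i\<^esub>}"
        by blast
      have "t = \<one>\<^bsub>H\<^esub>" if t: "t \<in> L p s H" for t
      proof -
        have tc: "t \<in> carrier H"
          using closed[of H p s] t H by auto
        have "h t = \<one>\<^bsub>product_group {..<n} F\<^esub>"
        proof
          fix i
          show "h t i = \<one>\<^bsub>product_group {..<n} F\<^esub> i"
          proof (cases "i < n")
            case True
            then show ?thesis
              using hom[OF pr[OF True], of p s] t s(2) by auto
          next
            case False
            then show ?thesis
              using PiE_arb[of "h t" "{..<n}" "\<lambda>i. carrier (F i)" i] h.hom_closed[OF tc] by simp
          qed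
        qed
        moreover have "inj_on h (carrier H)"
          using h by (simp add: iso_iff)
        ultimately show ?thesis
          using tc h.hom_one inj_onD[of h "carrier H" t "\<one>\<^bsub>H\<^esub>"] by simp
      qed
      then show ?thesis
        using s(1) by (intro exI[of _ s]) auto
    qed
    then show "H \<in> ?V"
      using fin H by (intro VI) simp_all
  qed
qed

lemma pseudovariety_obeys_laws: "pseudovariety {G. finite_group G \<and> obeys_laws G}"
  unfolding obeys_laws_def
  by (rule pseudovariety_of_laws)
    (simp_all add: group.laws_subset_carrier group_hom.hom_laws group_hom.laws_epi group.laws_mono)

section \<open>Arithmetic modulo a prime\<close>

lemma primroot_power_cong_iff:
  assumes "Factorial_Ring.prime p" "residue_primroot p q"
  shows "[int q ^ i = int q ^ j] (mod int p) \<longleftrightarrow> [i = j] (mod (p - 1))"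
proof -
  have "[int q ^ i = int q ^ j] (mod int p) \<longleftrightarrow> [q ^ i = q ^ j] (mod p)"
    by (metis cong_int_iff of_nat_power)
  also have "\<dots> \<longleftrightarrow> [i = j] (mod (p - 1))"
    using assms by (simp add: order_divides_expdiff residue_primroot_def totient_prime)
  finally show ?thesis .
qed

lemma prime_has_primroot:
  assumes "Factorial_Ring.prime (p::nat)" shows "\<exists>q. residue_primroot p q"
  using prime_primitive_root_exists[OF prime_gt_1_nat[OF assms]] assms
  by (metis prime_elem_nat_iff prime_prime_factor prime_nat_iff)

lemma primroot_coprime:
  "residue_primroot p q \<Longrightarrow> coprime (int q) (int p)"
  by (simp add: residue_primroot_def coprime_commute)

lemma primroot_generates:
  assumes p: "Factorial_Ring.prime p" and q: "residue_primroot p q" and c: "coprime c (int p)"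
  obtains j where "[int q ^ j = c] (mod int p)"
proof -
  have p1: "p > 1"
    using p prime_gt_1_nat by blast
  define a where "a = nat (c mod int p)"
  have a: "int a = c mod int p"
    using p1 by (simp add: a_def)
  have "coprime (int a) (int p)"
    using c p1 by (simp add: a coprime_mod_left_iff)
  moreover have "a < p"
    using p1 by (simp add: a_def nat_less_iff)
  moreover have "a \<noteq> 0"
    using calculation p1 by (intro notI) simp
  ultimately have "a \<in> totatives p"
    by (simp add: totatives_def)
  then have "a \<in> (\<lambda>i. q ^ i mod p) ` {..<totient p}"
    using bij_betw_imp_surj_on[OF residue_primroot_is_generator[OF p1 q]] by simp
  then obtain j where "q ^ j mod p = a"
    by auto
  then have "[int q ^ j = c] (mod int p)"
    unfolding cong_def a[symmetric] by (simp flip: of_nat_power of_nat_mod)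
  then show ?thesis ..
qed

text \<open>
  The ratio of this geometric sum is a nontrivial root of unity. The lemma is the orthogonality
  relation behind the decomposition of a character into eigencharacters.
\<close>

lemma primroot_power_sum:
  assumes p: "Factorial_Ring.prime p" and q: "residue_primroot p q" and j: "0 < j" "j < p - 1"
  shows "[(\<Sum>i<p - 1. int q ^ (i * j)) = 0] (mod int p)"
proof -
  let ?r = "int q ^ j"
  have "(?r - 1) * (\<Sum>i<p - 1. ?r ^ i) = ?r ^ (p - 1) - 1"
    by (simp add: power_diff_1_eq)
  also have "[\<dots> = 0] (mod int p)"
    using primroot_power_cong_iff[OF p q, of "j * (p - 1)" 0]
    by (simp add: power_mult cong_iff_dvd_diff cong_0_iff cong_def)
  finally have "int p dvd (?r - 1) * (\<Sum>i<p - 1. ?r ^ i)"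
    by (simp add: cong_0_iff)
  moreover have "\<not> int p dvd ?r - 1"
    using primroot_power_cong_iff[OF p q, of j 0] j by (simp add: cong_iff_dvd_diff cong_def)
  ultimately have "int p dvd (\<Sum>i<p - 1. ?r ^ i)"
    using p prime_dvd_mult_iff[of "int p"] by (simp add: prime_int_nat_transfer)
  then show ?thesis
    by (simp add: cong_0_iff power_mult mult.commute[of _ j])
qed

lemma prime_power_dvd_not_dvd:
  assumes "n > 0" "\<not> int n dvd c"
  obtains p k where "Factorial_Ring.prime p" "p ^ k dvd n" "\<not> int (p ^ k) dvd c"
proof -
  have "c \<noteq> 0"
    using assms(2) by auto
  then have "\<not> n dvd nat \<bar>c\<bar>" "nat \<bar>c\<bar> \<noteq> 0"
    using assms(2) by auto
  then obtain p where p: "Factorial_Ring.prime p" "\<not> multiplicity p n \<le> multiplicity p (nat \<bar>c\<bar>)"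
    using multiplicity_le_imp_dvd[of n "nat \<bar>c\<bar>"] assms(1) by blast
  then have "\<not> p ^ multiplicity p n dvd nat \<bar>c\<bar>"
    using \<open>nat \<bar>c\<bar> \<noteq> 0\<close> by (metis multiplicity_geI not_prime_unit)
  then have "\<not> int (p ^ multiplicity p n) dvd c"
    by (metis int_dvd_int_iff dvd_abs_iff int_nat_eq abs_ge_zero)
  with p multiplicity_dvd show ?thesis
    by (intro that[of p "multiplicity p n"]) auto
qed

text \<open>
  A special case of Dirichlet's theorem with an elementary proof: for \<open>a = p^(p^l)\<close> every prime
  factor \<open>r\<close> of \<open>1 + a + \<dots> + a^(p - 1)\<close> differs from \<open>p\<close> and does not divide \<open>a - 1\<close>. So the order
  of \<open>p\<close> modulo \<open>r\<close> divides \<open>p^(l + 1)\<close> but not \<open>p^l\<close>.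
\<close>

lemma prime_congruent_1_mod_prime_power:
  assumes p: "Factorial_Ring.prime (p::nat)"
  obtains r where "Factorial_Ring.prime r" "p ^ k dvd r - 1"
proof (cases k)
  case 0
  then show ?thesis
    using that[OF p] by simp
next
  case (Suc l)
  have p1: "p > 1"
    using p prime_gt_1_nat by blast
  define a where "a = p ^ (p ^ l)"
  define S where "S = (\<Sum>i<p. a ^ i)"
  have a1: "a > 1"
    unfolding a_def using p1 by (intro one_less_power) auto
  have "S \<noteq> 1"
  proof -
    have "1 + a = (\<Sum>i<2. a ^ i)"
      by (simp add: numeral_2_eq_2)
    also have "\<dots> \<le> S"
      unfolding S_def using p1 by (intro sum_mono2) auto
    finally show ?thesis
      using a1 by simp
  qed
  then obtain r where r: "Factorial_Ring.prime r" "r dvd S"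
    using prime_factor_nat by blast
  have geo: "(int a - 1) * int S = int a ^ p - 1"
    unfolding S_def by (simp add: power_diff_1_eq)
  have "int r dvd int a ^ p - 1"
    using r(2) by (simp flip: geo)
  then have ap: "[a ^ p = 1] (mod r)"
    by (metis cong_iff_dvd_diff cong_int_iff of_nat_1 of_nat_power)
  have na: "\<not> [a = 1] (mod r)"
  proof
    assume a: "[a = 1] (mod r)"
    have "[S = (\<Sum>i<p. 1)] (mod r)"
      unfolding S_def using cong_pow[OF a] by (intro cong_sum) simp
    then have "r dvd p"
      using r(2) by (simp add: cong_dvd_iff)
    then have "r dvd a"
      unfolding a_def using p1 by (simp add: dvd_trans dvd_power)
    then have "r dvd 1"
      using a by (simp add: cong_dvd_iff)
    then show False
      using r(1) by simp
  qed
  have "coprime r a"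
    using ap by (metis cong_imp_coprime cong_sym coprime_1_left coprime_commute coprime_power_left_iff p1 less_one not_less_iff_gr_or_eq)
  then have cop: "coprime r p"
    unfolding a_def using p1 by simp
  have "ord r p dvd p ^ Suc l"
    using ap unfolding a_def by (simp add: power_mult[symmetric] mult.commute flip: ord_divides)
  moreover have "\<not> ord r p dvd p ^ l"
    using na unfolding a_def by (simp flip: ord_divides)
  ultimately have "ord r p = p ^ Suc l"
    using p by (metis divides_primepow_nat le_Suc_eq power_le_dvd dvd_refl le_imp_power_dvd)
  then have "p ^ k dvd r - 1"
    using order_divides_totient[OF cop] r(1) Suc by (simp add: totient_prime)
  then show ?thesis
    using that r(1) by blast
qed

section \<open>Characters with values modulo an integer\<close>

text \<open>
  Characters are integer-valued functions that are additive modulo \<open>n\<close>, so that eigenvalues and sums of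
  characters become ordinary integer arithmetic.
\<close>

definition additive_mod :: "int \<Rightarrow> ('a, 'b) monoid_scheme \<Rightarrow> 'a set \<Rightarrow> ('a \<Rightarrow> int) \<Rightarrow> bool" where
  "additive_mod n G H lam \<longleftrightarrow>
     (\<forall>x\<in>H. \<forall>y\<in>H. [lam (x \<otimes>\<^bsub>G\<^esub> y) = lam x + lam y] (mod n))"

lemma additive_modD:
  "additive_mod n G H lam \<Longrightarrow> x \<in> H \<Longrightarrow> y \<in> H \<Longrightarrow> [lam (x \<otimes>\<^bsub>G\<^esub> y) = lam x + lam y] (mod n)"
  by (simp add: additive_mod_def)

context group
begin

lemma additive_mod_one:
  assumes "additive_mod n G H lam" "subgroup H G"
  shows "[lam \<one> = 0] (mod n)"
proof -
  have "[lam \<one> + 0 = lam \<one> + lam \<one>] (mod n)"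
    using additive_modD[OF assms(1), of \<one> \<one>] subgroup.one_closed[OF assms(2)] by simp
  then show ?thesis
    by (metis cong_add_lcancel cong_sym)
qed

lemma additive_mod_inv:
  assumes "additive_mod n G H lam" "subgroup H G" "x \<in> H"
  shows "[lam (inv x) = - lam x] (mod n)"
proof -
  have "[lam x + lam (inv x) = lam \<one>] (mod n)"
    using additive_modD[OF assms(1), of x "inv x"] assms subgroup.mem_carrier[OF assms(2,3)]
    by (simp add: subgroup.m_inv_closed cong_sym)
  also have "[lam \<one> = 0] (mod n)"
    using additive_mod_one[OF assms(1,2)] .
  finally show ?thesis
    by (simp add: cong_iff_dvd_diff add.commute)
qed

lemma additive_mod_pow:
  assumes "additive_mod n G H lam" "subgroup H G" "x \<in> H"
  shows "[lam (x [^] (k::nat)) = int k * lam x] (mod n)"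
proof (induction k)
  case 0
  then show ?case using additive_mod_one[OF assms(1,2)] by simp
next
  case (Suc k)
  have "x [^] k \<in> H"
    using assms(2,3) by (induction k) (auto simp: subgroup.one_closed subgroup.m_closed)
  then have "[lam (x [^] Suc k) = lam (x [^] k) + lam x] (mod n)"
    using additive_modD[OF assms(1)] assms(3) by simp
  also have "[lam (x [^] k) + lam x = int k * lam x + lam x] (mod n)"
    using Suc by (rule cong_add) simp
  finally show ?case
    by (simp add: algebra_simps)
qed

lemma character_kernel_subgroup:
  assumes lam: "additive_mod n G H lam" and H: "subgroup H G"
  shows "subgroup {a \<in> H. [lam a = 0] (mod n)} G"
proof (rule subgroupI)
  show "{a \<in> H. [lam a = 0] (mod n)} \<subseteq> carrier G"
    using subgroup.subset[OF H] by blast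
  show "{a \<in> H. [lam a = 0] (mod n)} \<noteq> {}"
    using subgroup.one_closed[OF H] additive_mod_one[OF lam H] by blast
next
  fix a assume a: "a \<in> {a \<in> H. [lam a = 0] (mod n)}"
  then have "[lam (inv a) = - lam a] (mod n)"
    using additive_mod_inv[OF lam H] by blast
  also have "[- lam a = - 0] (mod n)"
    using a by (subst cong_minus_minus_iff) simp
  finally show "inv a \<in> {a \<in> H. [lam a = 0] (mod n)}"
    using a subgroup.m_inv_closed[OF H] by simp
next
  fix a b assume ab: "a \<in> {a \<in> H. [lam a = 0] (mod n)}" "b \<in> {a \<in> H. [lam a = 0] (mod n)}"
  then have "[lam (a \<otimes> b) = lam a + lam b] (mod n)"
    using additive_modD[OF lam] by blast
  also have "[lam a + lam b = 0 + 0] (mod n)"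
    using ab by (intro cong_add) auto
  finally show "a \<otimes> b \<in> {a \<in> H. [lam a = 0] (mod n)}"
    using ab subgroup.m_closed[OF H] by simp
qed

lemma subgroup_pow_closed:
  "subgroup H G \<Longrightarrow> x \<in> H \<Longrightarrow> x [^] (k::nat) \<in> H"
  by (induction k) (auto simp: subgroup.one_closed subgroup.m_closed)

lemma finite_subgroupI:
  assumes "finite (carrier G)" "H \<subseteq> carrier G" "\<one> \<in> H"
    and "\<And>x y. x \<in> H \<Longrightarrow> y \<in> H \<Longrightarrow> x \<otimes> y \<in> H"
  shows "subgroup H G"
proof (rule subgroupI)
  fix x assume x: "x \<in> H"
  then have xc: "x \<in> carrier G" using assms(2) by blast
  have pow: "x [^] (k::nat) \<in> H" for k
    by (induction k) (use assms x in auto)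
  obtain k where "order G = Suc k"
    using assms(1) order_gt_0_iff_finite gr0_implies_Suc by blast
  then have "x [^] k \<otimes> x = \<one>"
    using pow_order_eq_1[OF xc] by simp
  then have "inv x = x [^] k"
    using xc by (simp add: inv_equality)
  with pow show "inv x \<in> H" by simp
qed (use assms in auto)

lemma minimal_exponent:
  assumes H: "subgroup H G" and x: "x \<in> carrier G" and n: "n > 0" "x [^] (n::nat) \<in> H"
  obtains d where "d > 0" "x [^] d \<in> H" "\<And>e::nat. x [^] e \<in> H \<Longrightarrow> d dvd e"
proof -
  define d where "d = (LEAST e. e > 0 \<and> x [^] (e::nat) \<in> H)"
  have d: "d > 0" "x [^] d \<in> H"
    using LeastI[of "\<lambda>e. e > 0 \<and> x [^] e \<in> H" n] n by (auto simp: d_def)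
  have "d dvd e" if e: "x [^] e \<in> H" for e
  proof -
    have "x [^] e = (x [^] d) [^] (e div d) \<otimes> x [^] (e mod d)"
      using x by (simp add: nat_pow_pow nat_pow_mult)
    then have "x [^] (e mod d) = inv ((x [^] d) [^] (e div d)) \<otimes> x [^] e"
      using x by (simp add: cancel_inv_left)
    then have "x [^] (e mod d) \<in> H"
      using H d e by (simp add: subgroup.m_closed subgroup.m_inv_closed subgroup_pow_closed)
    moreover have "e mod d < d"
      using d by simp
    ultimately have "e mod d = 0"
      using not_less_Least[of "e mod d" "\<lambda>e. e > 0 \<and> x [^] e \<in> H"] by (auto simp: d_def)
    then show ?thesis by auto
  qed
  with d show ?thesis using that by blast
qed

text \<open>
  A character of \<open>H\<close> extends to the subgroup generated by \<open>H\<close> and \<open>x\<close> once the value \<open>t\<close> at \<open>x\<close>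
  is consistent with the value at the first power of \<open>x\<close> that falls into \<open>H\<close>. Commutators do not
  interfere, because they lie in \<open>N\<close>, where the character vanishes.
\<close>

lemma extend_character:
  assumes fin: "finite (carrier G)" and H: "subgroup H G" and NH: "N \<subseteq> H"
    and comm: "\<And>x y. x \<in> carrier G \<Longrightarrow> y \<in> carrier G \<Longrightarrow> gcomm G x y \<in> N"
    and lam: "additive_mod n G H lam" and lamN: "\<And>x. x \<in> N \<Longrightarrow> [lam x = 0] (mod n)"
    and x: "x \<in> carrier G" and d: "x [^] (d::nat) \<in> H" "\<And>e::nat. x [^] e \<in> H \<Longrightarrow> d dvd e"
    and t: "[int d * t = lam (x [^] d)] (mod n)"
  obtains K mu where "subgroup K G" "H \<subseteq> K" "x \<in> K" "additive_mod n G K mu"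
    "\<forall>h\<in>H. [mu h = lam h] (mod n)" "[mu x = t] (mod n)"
proof -
  have Hc: "h \<in> carrier G" if "h \<in> H" for h
    using that H subgroup.mem_carrier by metis
  have wd: "[lam h + int i * t = lam h' + int j * t] (mod n)"
    if hh: "h \<in> H" "h' \<in> H" and eq: "h \<otimes> x [^] i = h' \<otimes> x [^] j" and ij: "i \<le> j" for h h' and i j :: nat
  proof -
    have "x [^] j = x [^] (j - i) \<otimes> x [^] i"
      using x ij by (simp add: nat_pow_mult)
    then have "h \<otimes> x [^] i = (h' \<otimes> x [^] (j - i)) \<otimes> x [^] i"
      using eq x Hc[OF hh(1)] Hc[OF hh(2)] by (simp add: m_assoc)
    then have h: "h = h' \<otimes> x [^] (j - i)"
      using x Hc[OF hh(1)] Hc[OF hh(2)] by simp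
    then have "x [^] (j - i) = inv h' \<otimes> h"
      using x Hc[OF hh(2)] by (simp add: cancel_inv_left)
    then have mem: "x [^] (j - i) \<in> H"
      using H hh by (simp add: subgroup.m_closed subgroup.m_inv_closed)
    then obtain c where c: "j - i = d * c"
      using d(2) by blast
    have "[lam h = lam h' + lam (x [^] (j - i))] (mod n)"
      unfolding h using additive_modD[OF lam hh(2) mem] .
    also have "x [^] (j - i) = (x [^] d) [^] c"
      using x by (simp add: c nat_pow_pow)
    also have "[lam h' + lam ((x [^] d) [^] c) = lam h' + int c * lam (x [^] d)] (mod n)"
      using additive_mod_pow[OF lam H d(1)] by (intro cong_add) auto
    also have "[lam h' + int c * lam (x [^] d) = lam h' + int c * (int d * t)] (mod n)"
      using t by (intro cong_add cong_mult) (auto simp: cong_sym)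
    finally have "[lam h + int i * t = lam h' + int c * (int d * t) + int i * t] (mod n)"
      by (rule cong_add) simp
    also have "lam h' + int c * (int d * t) + int i * t = lam h' + (int (d * c) + int i) * t"
      by (simp add: algebra_simps)
    also have "int (d * c) + int i = int j"
      using ij by (simp flip: c)
    finally show ?thesis .
  qed
  define K where "K = {h \<otimes> x [^] i | h i::nat. h \<in> H}"
  define rep where "rep z = (SOME (h, i::nat). h \<in> H \<and> z = h \<otimes> x [^] i)" for z
  define mu where "mu z = lam (fst (rep z)) + int (snd (rep z)) * t" for z
  have mu: "[mu (h \<otimes> x [^] i) = lam h + int i * t] (mod n)" if "h \<in> H" for h and i :: nat
  proof -
    have "case rep (h \<otimes> x [^] i) of (h', j) \<Rightarrow> h' \<in> H \<and> h \<otimes> x [^] i = h' \<otimes> x [^] j"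
      unfolding rep_def by (rule someI[of _ "(h, i)"]) (use that in simp)
    then obtain h' j where "rep (h \<otimes> x [^] i) = (h', j)" "h' \<in> H" "h \<otimes> x [^] i = h' \<otimes> x [^] j"
      by (cases "rep (h \<otimes> x [^] i)") simp
    then show ?thesis
      using wd[of h h' i j] wd[of h' h j i] that unfolding mu_def
      by (cases "i \<le> j") (auto simp: cong_sym)
  qed
  have step: "(h \<otimes> x [^] i) \<otimes> (h' \<otimes> x [^] j) = (h \<otimes> (gcomm G (x [^] i) h' \<otimes> h')) \<otimes> x [^] (i + j)"
    if "h \<in> H" "h' \<in> H" for h h' and i j :: nat
    using Hc[OF that(1)] Hc[OF that(2)] x
    by (simp add: gcomm_def group_word flip: nat_pow_mult)
  have cm: "gcomm G (x [^] i) h' \<in> H" "[lam (gcomm G (x [^] i) h') = 0] (mod n)"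
    if "h' \<in> H" for h' and i :: nat
    using comm[of "x [^] i" h'] x Hc[OF that] NH lamN by auto
  have mem: "h \<otimes> (gcomm G (x [^] i) h' \<otimes> h') \<in> H" if "h \<in> H" "h' \<in> H" for h h' and i :: nat
    using that cm H by (simp add: subgroup.m_closed)
  have "subgroup K G"
  proof (rule finite_subgroupI[OF fin])
    show "K \<subseteq> carrier G"
      unfolding K_def using x Hc by auto
    show "\<one> \<in> K"
      unfolding K_def using subgroup.one_closed[OF H] by (auto intro!: exI[of _ \<one>] exI[of _ "0::nat"])
    fix y z assume "y \<in> K" "z \<in> K"
    then show "y \<otimes> z \<in> K"
      unfolding K_def using step mem by blast
  qed
  moreover have HK: "H \<subseteq> K"
  proof
    fix h assume "h \<in> H"
    then show "h \<in> K"
      unfolding K_def using Hc by (auto intro!: exI[of _ h] exI[of _ "0::nat"])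
  qed
  moreover have "x \<in> K"
    unfolding K_def using x subgroup.one_closed[OF H] by (auto intro!: exI[of _ \<one>] exI[of _ "1::nat"])
  moreover have "additive_mod n G K mu"
    unfolding additive_mod_def
  proof (intro ballI)
    fix y z assume "y \<in> K" "z \<in> K"
    then obtain h h' i j where yz: "y = h \<otimes> x [^] (i::nat)" "z = h' \<otimes> x [^] (j::nat)" "h \<in> H" "h' \<in> H"
      unfolding K_def by blast
    have "[mu (y \<otimes> z) = lam (h \<otimes> (gcomm G (x [^] i) h' \<otimes> h')) + int (i + j) * t] (mod n)"
      unfolding yz step[OF yz(3,4)] using mu[OF mem[OF yz(3,4)]] .
    also have "[lam (h \<otimes> (gcomm G (x [^] i) h' \<otimes> h')) + int (i + j) * t
        = (lam h + (0 + lam h')) + int (i + j) * t] (mod n)"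
    proof (rule cong_add)
      have "[lam (h \<otimes> (gcomm G (x [^] i) h' \<otimes> h')) = lam h + lam (gcomm G (x [^] i) h' \<otimes> h')] (mod n)"
        using additive_modD[OF lam] yz(3,4) cm(1) H by (simp add: subgroup.m_closed)
      also have "[lam h + lam (gcomm G (x [^] i) h' \<otimes> h')
          = lam h + (lam (gcomm G (x [^] i) h') + lam h')] (mod n)"
        using additive_modD[OF lam cm(1)[OF yz(4)] yz(4)] by (intro cong_add) auto
      also have "[lam h + (lam (gcomm G (x [^] i) h') + lam h') = lam h + (0 + lam h')] (mod n)"
        using cm(2)[OF yz(4)] by (intro cong_add) auto
      finally show "[lam (h \<otimes> (gcomm G (x [^] i) h' \<otimes> h')) = lam h + (0 + lam h')] (mod n)" .
    qed simp
    also have "(lam h + (0 + lam h')) + int (i + j) * t = (lam h + int i * t) + (lam h' + int j * t)"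
      by (simp add: algebra_simps)
    also have "[\<dots> = mu y + mu z] (mod n)"
      unfolding yz by (intro cong_add cong_sym[OF mu] yz(3,4))
    finally show "[mu (y \<otimes> z) = mu y + mu z] (mod n)" .
  qed
  moreover have "[mu h = lam h] (mod n)" if "h \<in> H" for h
    using mu[OF that, of 0] Hc[OF that] by simp
  moreover have "[mu x = t] (mod n)"
  proof -
    have "[mu (\<one> \<otimes> x [^] (1::nat)) = lam \<one> + int 1 * t] (mod n)"
      using mu[OF subgroup.one_closed[OF H], of 1] .
    also have "[lam \<one> + int 1 * t = 0 + int 1 * t] (mod n)"
      using additive_mod_one[OF lam H] by (intro cong_add) auto
    finally show ?thesis
      using x by simp
  qed
  ultimately show ?thesis
    by (intro that[of K mu] ballI) auto
qed

text \<open>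
  Start with a character of the subgroup generated by \<open>N\<close> and \<open>g\<close>, and extend it to a largest
  possible subgroup. Each extension step succeeds since \<open>n\<close> is an exponent of the group:
  if \<open>d\<close> is minimal with \<open>x^d\<close> in the domain and \<open>n = d c\<close>, then \<open>c\<close> times the value at \<open>x^d\<close>
  is zero modulo \<open>n\<close>, so that value is divisible by \<open>d\<close>.
\<close>

lemma separating_character:
  assumes fin: "finite (carrier G)" and n: "n > 0" "\<And>x. x \<in> carrier G \<Longrightarrow> x [^] (n::nat) = \<one>"
    and N: "subgroup N G"
    and comm: "\<And>x y. x \<in> carrier G \<Longrightarrow> y \<in> carrier G \<Longrightarrow> gcomm G x y \<in> N"
    and g: "g \<in> carrier G" "g \<notin> N"
  obtains lam where "additive_mod (int n) G (carrier G) lam"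
    "\<And>x. x \<in> N \<Longrightarrow> [lam x = 0] (mod int n)" "\<not> [lam g = 0] (mod int n)"
proof -
  define good where "good H lam \<longleftrightarrow> subgroup H G \<and> N \<subseteq> H \<and> g \<in> H \<and> additive_mod (int n) G H lam \<and>
    (\<forall>x\<in>N. [lam x = 0] (mod int n)) \<and> \<not> [lam g = 0] (mod int n)" for H lam
  have "\<exists>H lam. good H lam"
  proof -
    obtain d where d: "d > 0" "g [^] d \<in> N" "\<And>e::nat. g [^] e \<in> N \<Longrightarrow> d dvd e"
      using minimal_exponent[OF N g(1), of n] n g(1) subgroup.one_closed[OF N] by metis
    have "d dvd n"
      using d(3)[of n] n(2)[OF g(1)] subgroup.one_closed[OF N] by simp
    then obtain t where t: "n = d * t" by blast
    have "d \<noteq> 1"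
      using d(2) g by auto
    have z: "additive_mod (int n) G N (\<lambda>_. 0)"
      by (simp add: additive_mod_def)
    obtain K mu where "subgroup K G" "N \<subseteq> K" "g \<in> K" "additive_mod (int n) G K mu"
      "\<forall>h\<in>N. [mu h = 0] (mod int n)" "[mu g = int t] (mod int n)"
      using extend_character[OF fin N subset_refl comm z _ g(1) d(2,3), of "int t"]
      by (auto simp: t cong_0_iff)
    moreover have "\<not> [int t = 0] (mod int n)"
    proof
      assume "[int t = 0] (mod int n)"
      then have "n dvd t" by (simp add: cong_0_iff)
      then have "d * t dvd 1 * t" "t > 0"
        using t n(1) by auto
      then have "d dvd 1"
        using dvd_times_right_cancel_iff[of t d 1] by simp
      then show False
        using \<open>d \<noteq> 1\<close> by simp
    qed
    moreover have "\<not> [mu g = 0] (mod int n)"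
      using calculation(6,7) cong_trans[OF cong_sym] by blast
    ultimately have "good K mu"
      unfolding good_def by blast
    then show ?thesis by blast
  qed
  then obtain H0 where H0: "\<exists>lam. good H0 lam" by blast
  have bound: "card H \<le> card (carrier G)" if "\<exists>lam. good H lam" for H
    using that fin by (auto simp: good_def intro!: card_mono dest: subgroup.subset)
  obtain H where H: "\<exists>lam. good H lam" and max: "\<And>K. \<exists>lam. good K lam \<Longrightarrow> card K \<le> card H"
    using ex_has_greatest_nat[of "\<lambda>H. \<exists>lam. good H lam" H0 card "Suc (card (carrier G))", OF H0]
      bound le_imp_less_Suc by auto
  then obtain lam where lam: "subgroup H G" "N \<subseteq> H" "g \<in> H" "additive_mod (int n) G H lam"
    "\<And>x. x \<in> N \<Longrightarrow> [lam x = 0] (mod int n)" "\<not> [lam g = 0] (mod int n)"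
    by (auto simp: good_def)
  have "carrier G \<subseteq> H"
  proof
    fix x assume x: "x \<in> carrier G"
    obtain d where d: "d > 0" "x [^] d \<in> H" "\<And>e::nat. x [^] e \<in> H \<Longrightarrow> d dvd e"
      using minimal_exponent[OF lam(1) x, of n] n x subgroup.one_closed[OF lam(1)] by metis
    have "d dvd n"
      using d(3)[of n] n(2)[OF x] subgroup.one_closed[OF lam(1)] by simp
    then obtain c where c: "n = d * c" by blast
    have "[int c * lam (x [^] d) = lam ((x [^] d) [^] c)] (mod int n)"
      using additive_mod_pow[OF lam(4,1) d(2)] by (simp add: cong_sym)
    also have "(x [^] d) [^] c = \<one>"
      using x n(2) by (simp add: nat_pow_pow flip: c)
    also have "[lam \<one> = 0] (mod int n)"
      using additive_mod_one[OF lam(4,1)] .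
    finally have "int c * int d dvd int c * lam (x [^] d)"
      by (simp add: cong_0_iff c mult.commute)
    then have "int d dvd lam (x [^] d)"
      using n(1) c by simp
    then obtain t where t: "lam (x [^] d) = int d * t" by blast
    have t': "[int d * t = lam (x [^] d)] (mod int n)"
      by (simp add: t)
    obtain K mu where K: "subgroup K G" "H \<subseteq> K" "x \<in> K" "additive_mod (int n) G K mu"
      "\<forall>h\<in>H. [mu h = lam h] (mod int n)" "[mu x = t] (mod int n)"
      using extend_character[OF fin lam(1,2) comm lam(4,5) x d(2,3) t'] .
    have "[mu h = 0] (mod int n)" if "h \<in> N" for h
      using cong_trans[OF bspec[OF K(5) subsetD[OF lam(2) that]] lam(5)[OF that]] .
    moreover have "\<not> [mu g = 0] (mod int n)"
      using cong_trans[OF cong_sym[OF bspec[OF K(5) lam(3)]]] lam(6) by blast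
    ultimately have "good K mu"
      using K lam unfolding good_def by blast
    then have "card K \<le> card H"
      using max by blast
    moreover have "finite K"
      using K(1) fin subgroup.subset finite_subset by metis
    ultimately have "H = K"
      using K(2) by (simp add: card_seteq)
    then show "x \<in> H" using K(3) by simp
  qed
  then have "H = carrier G"
    using lam(1) subgroup.subset by blast
  then show ?thesis
    using that lam by blast
qed

end

section \<open>Affine representations over prime fields\<close>

text \<open>
  The pair \<open>(f, chi)\<close> stands for the action of \<open>u\<close> on the integers modulo \<open>p\<close> by
  \<open>z \<mapsto> f u + chi u * z\<close>. The condition at the identity excludes \<open>chi = 0\<close>.
\<close>

definition affine_rep :: "nat \<Rightarrow> ('a, 'b) monoid_scheme \<Rightarrow> ('a \<Rightarrow> int) \<Rightarrow> ('a \<Rightarrow> int) \<Rightarrow> bool" where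
  "affine_rep p G f chi \<longleftrightarrow>
     (\<forall>u\<in>carrier G. \<forall>v\<in>carrier G.
        [f (u \<otimes>\<^bsub>G\<^esub> v) = f u + chi u * f v] (mod int p) \<and>
        [chi (u \<otimes>\<^bsub>G\<^esub> v) = chi u * chi v] (mod int p)) \<and>
     [chi \<one>\<^bsub>G\<^esub> = 1] (mod int p)"

lemma fermat_int:
  assumes p: "Factorial_Ring.prime p" and c: "coprime c (int p)"
  shows "[c ^ (p - 1) = 1] (mod int p)"
proof -
  obtain q where q: "residue_primroot p q"
    using prime_has_primroot[OF p] by blast
  obtain j where "[int q ^ j = c] (mod int p)"
    using primroot_generates[OF p q c] .
  then have "[(int q ^ j) ^ (p - 1) = c ^ (p - 1)] (mod int p)"
    by (rule cong_pow)
  moreover have "[(int q ^ j) ^ (p - 1) = 1] (mod int p)"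
    using primroot_power_cong_iff[OF p q, of "j * (p - 1)" 0] by (simp add: power_mult cong_def)
  ultimately show ?thesis
    using cong_trans cong_sym by blast
qed

locale affine_group = group G for G (structure) +
  fixes p :: nat and f chi :: "'a \<Rightarrow> int"
  assumes prime: "Factorial_Ring.prime p" and rep: "affine_rep p G f chi"
begin

lemma f_mult: "u \<in> carrier G \<Longrightarrow> v \<in> carrier G \<Longrightarrow> [f (u \<otimes> v) = f u + chi u * f v] (mod int p)"
  and chi_mult: "u \<in> carrier G \<Longrightarrow> v \<in> carrier G \<Longrightarrow> [chi (u \<otimes> v) = chi u * chi v] (mod int p)"
  and chi_one: "[chi \<one> = 1] (mod int p)"
  using rep by (auto simp: affine_rep_def)

lemma chi_inv: "u \<in> carrier G \<Longrightarrow> [chi u * chi (inv u) = 1] (mod int p)"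
  using cong_trans[OF cong_sym[OF chi_mult[of u "inv u"]]] chi_one by simp

lemma coprime_chi:
  assumes "u \<in> carrier G" shows "coprime (chi u) (int p)"
proof -
  have "coprime (chi u * chi (inv u)) (int p)"
    using cong_imp_coprime[OF cong_sym[OF chi_inv[OF assms]]] by simp
  then show ?thesis by simp
qed

lemma f_one: "[f \<one> = 0] (mod int p)"
proof -
  have "[f \<one> = f \<one> + chi \<one> * f \<one>] (mod int p)"
    using f_mult[of \<one> \<one>] by simp
  also have "[f \<one> + chi \<one> * f \<one> = f \<one> + 1 * f \<one>] (mod int p)"
    by (intro cong_add cong_mult chi_one) auto
  finally show ?thesis
    by (simp add: cong_iff_dvd_diff)
qed

lemma chi_pow:
  assumes "u \<in> carrier G" shows "[chi (u [^] (n::nat)) = chi u ^ n] (mod int p)"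
proof (induction n)
  case (Suc n)
  have "[chi (u [^] Suc n) = chi (u [^] n) * chi u] (mod int p)"
    using chi_mult assms by simp
  also have "[chi (u [^] n) * chi u = chi u ^ n * chi u] (mod int p)"
    using Suc by (intro cong_mult) auto
  finally show ?case
    by (simp add: mult.commute)
qed (use chi_one in simp)

definition chi_kernel :: "'a set" where
  "chi_kernel = {u \<in> carrier G. [chi u = 1] (mod int p)}"

lemma chi_kernel_carrier: "u \<in> chi_kernel \<Longrightarrow> u \<in> carrier G"
  by (simp add: chi_kernel_def)

lemma gcomm_chi_kernel:
  assumes "u \<in> carrier G" "v \<in> carrier G" shows "gcomm G u v \<in> chi_kernel"
proof -
  have "[chi (gcomm G u v) = chi u * chi v * chi (inv u) * chi (inv v)] (mod int p)"
    unfolding gcomm_def using assms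
    by (intro cong_trans[OF chi_mult] cong_mult) (auto intro: cong_trans[OF chi_mult] cong_mult chi_mult)
  also have "chi u * chi v * chi (inv u) * chi (inv v) = (chi u * chi (inv u)) * (chi v * chi (inv v))"
    by (simp add: ac_simps)
  also have "[\<dots> = 1 * 1] (mod int p)"
    using assms by (intro cong_mult chi_inv)
  finally show ?thesis
    using assms by (simp add: chi_kernel_def)
qed

lemma pow_chi_kernel:
  assumes "u \<in> carrier G" shows "u [^] (p - 1) \<in> chi_kernel"
  using cong_trans[OF chi_pow[OF assms] fermat_int[OF prime coprime_chi[OF assms]]] assms
  by (simp add: chi_kernel_def)

lemma subgroup_chi_kernel: "subgroup chi_kernel G"
proof (rule subgroupI)
  show "chi_kernel \<noteq> {}"
    using chi_one by (auto simp: chi_kernel_def)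
next
  fix u assume u: "u \<in> chi_kernel"
  have "[1 * chi (inv u) = chi u * chi (inv u)] (mod int p)"
    using u by (intro cong_mult) (auto simp: chi_kernel_def cong_sym)
  with u chi_inv[of u] show "inv u \<in> chi_kernel"
    using cong_trans by (auto simp: chi_kernel_def)
next
  fix u v assume uv: "u \<in> chi_kernel" "v \<in> chi_kernel"
  have "[chi (u \<otimes> v) = chi u * chi v] (mod int p)"
    using uv chi_mult by (simp add: chi_kernel_def)
  also have "[chi u * chi v = 1 * 1] (mod int p)"
    using uv by (intro cong_mult) (simp_all add: chi_kernel_def)
  finally show "u \<otimes> v \<in> chi_kernel"
    using uv by (simp add: chi_kernel_def)
qed (simp add: chi_kernel_def)

lemma f_chi_kernel:
  assumes "u \<in> chi_kernel" "v \<in> carrier G"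
  shows "[f (u \<otimes> v) = f u + f v] (mod int p)"
proof -
  have "[f (u \<otimes> v) = f u + chi u * f v] (mod int p)"
    using assms f_mult by (simp add: chi_kernel_def)
  also have "[f u + chi u * f v = f u + 1 * f v] (mod int p)"
    using assms by (intro cong_add cong_mult) (simp_all add: chi_kernel_def)
  finally show ?thesis by simp
qed

lemma f_pow_chi_kernel:
  assumes "u \<in> chi_kernel" shows "[f (u [^] (n::nat)) = int n * f u] (mod int p)"
  using additive_mod_pow[OF _ subgroup_chi_kernel assms, of "int p" f]
    f_chi_kernel chi_kernel_carrier by (simp add: additive_mod_def)

end

locale faithful_affine_group = affine_group +
  assumes faithful: "\<And>u. u \<in> carrier G \<Longrightarrow> [f u = 0] (mod int p) \<Longrightarrow> [chi u = 1] (mod int p) \<Longrightarrow> u = \<one>"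
begin

lemma eq_if_cong:
  assumes uv: "u \<in> carrier G" "v \<in> carrier G"
    and "[f u = f v] (mod int p)" "[chi u = chi v] (mod int p)"
  shows "u = v"
proof -
  have iv: "inv v \<in> carrier G"
    using uv by simp
  have "[chi (u \<otimes> inv v) = chi u * chi (inv v)] (mod int p)"
    by (rule chi_mult[OF uv(1) iv])
  also have "[chi u * chi (inv v) = chi v * chi (inv v)] (mod int p)"
    using assms by (intro cong_mult) auto
  also have "[chi v * chi (inv v) = 1] (mod int p)"
    by (rule chi_inv[OF uv(2)])
  finally have 1: "[chi (u \<otimes> inv v) = 1] (mod int p)" .
  have "[f (u \<otimes> inv v) = f u + chi u * f (inv v)] (mod int p)"
    by (rule f_mult[OF uv(1) iv])
  also have "[f u + chi u * f (inv v) = f v + chi v * f (inv v)] (mod int p)"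
    using assms by (intro cong_mult cong_add) auto
  also have "[f v + chi v * f (inv v) = f (v \<otimes> inv v)] (mod int p)"
    by (rule cong_sym[OF f_mult[OF uv(2) iv]])
  also have "[f (v \<otimes> inv v) = 0] (mod int p)"
    using f_one uv by simp
  finally have "u \<otimes> inv v = \<one>"
    using faithful 1 uv by simp
  then show ?thesis
    using uv by (metis inv_equality inv_inv iv)
qed

lemma chi_kernel_commute:
  assumes "u \<in> chi_kernel" "v \<in> chi_kernel" shows "u \<otimes> v = v \<otimes> u"
proof (rule eq_if_cong)
  note c = chi_kernel_carrier[OF assms(1)] chi_kernel_carrier[OF assms(2)]
  show "u \<otimes> v \<in> carrier G" "v \<otimes> u \<in> carrier G"
    using c by auto
  have "[f (u \<otimes> v) = f v + f u] (mod int p)"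
    using f_chi_kernel[OF assms(1) c(2)] by (simp add: add.commute)
  with f_chi_kernel[OF assms(2) c(1)] show "[f (u \<otimes> v) = f (v \<otimes> u)] (mod int p)"
    using cong_trans cong_sym by blast
  have "[chi (u \<otimes> v) = chi v * chi u] (mod int p)"
    using chi_mult[OF c] by (simp add: mult.commute)
  with chi_mult[OF c(2,1)] show "[chi (u \<otimes> v) = chi (v \<otimes> u)] (mod int p)"
    using cong_trans cong_sym by blast
qed

lemma chi_kernel_exponent:
  assumes "u \<in> chi_kernel" shows "u [^] p = \<one>"
proof (rule faithful)
  show "u [^] p \<in> carrier G"
    using chi_kernel_carrier[OF assms] by simp
  show "[f (u [^] p) = 0] (mod int p)"
    using f_pow_chi_kernel[OF assms, of p] by (auto simp: cong_0_iff cong_dvd_iff)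
  have "u [^] p \<in> chi_kernel"
    using subgroup_pow_closed[OF subgroup_chi_kernel assms] .
  then show "[chi (u [^] p) = 1] (mod int p)"
    by (simp add: chi_kernel_def)
qed

end

text \<open>
  This covers the members of \<open>Ab(p) * Ab(p - 1)\<close> as well as the affine groups. For the
  prime \<open>p\<close> the exponent \<open>p - 1\<close> moves everything into the abelian group \<open>T\<close>; for every other prime the
  exponent \<open>p\<close> kills all commutators.
\<close>

lemma (in group) obeys_laws_if_abelian_of_prime_exponent:
  fixes p :: nat
  assumes p: "Factorial_Ring.prime p" and T: "subgroup T G"
    and comm: "\<And>x y. x \<in> carrier G \<Longrightarrow> y \<in> carrier G \<Longrightarrow> gcomm G x y \<in> T"
    and pow: "\<And>x. x \<in> carrier G \<Longrightarrow> x [^] (p - 1) \<in> T"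
    and Tcomm: "\<And>x y. x \<in> T \<Longrightarrow> y \<in> T \<Longrightarrow> x \<otimes> y = y \<otimes> x"
    and Texp: "\<And>x. x \<in> T \<Longrightarrow> x [^] p = \<one>"
  shows "obeys_laws G"
  unfolding obeys_laws_def
proof (intro allI impI)
  fix r :: nat assume r: "Factorial_Ring.prime r"
  show "\<exists>s. coprime s r \<and> laws r s G \<subseteq> {\<one>}"
  proof (cases "r = p")
    case True
    have "laws p (p - 1) G \<subseteq> {\<one>}"
      unfolding laws_trivial_iff
    proof (intro ballI conjI)
      fix x y z w assume xy: "x \<in> carrier G" "y \<in> carrier G" "z \<in> carrier G" "w \<in> carrier G"
      show "gcomm G x y \<otimes> gcomm G z w = gcomm G z w \<otimes> gcomm G x y"
        using xy by (intro Tcomm comm)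
      have "gcomm G x y [^] ((p - 1) * p) = (gcomm G x y [^] (p - 1)) [^] p"
        using xy by (simp add: nat_pow_pow)
      also have "\<dots> = \<one>"
        by (intro Texp subgroup_pow_closed[OF T] comm xy)
      finally show "gcomm G x y [^] ((p - 1) * p) = \<one>" .
      show "z [^] (p - 1) \<otimes> gcomm G x y [^] (p - 1) = gcomm G x y [^] (p - 1) \<otimes> z [^] (p - 1)"
        using xy by (intro Tcomm pow subgroup_pow_closed[OF T] comm)
      have "gcomm G (x [^] (p - 1)) (y [^] (p - 1)) = \<one>"
        using xy Tcomm[OF pow pow] by (simp add: gcomm_eq_one_iff)
      then show "gcomm G (x [^] (p - 1)) (y [^] (p - 1)) [^] (p - 1) = \<one>"
        by simp
    qed
    moreover have "coprime (p - 1) p"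
      using coprime_diff_one_left_nat prime_gt_0_nat[OF p] by blast
    ultimately show ?thesis
      using True by blast
  next
    case False
    have "laws r p G \<subseteq> {\<one>}"
      unfolding laws_trivial_iff
    proof (intro ballI conjI)
      fix x y z w assume xy: "x \<in> carrier G" "y \<in> carrier G" "z \<in> carrier G" "w \<in> carrier G"
      show "gcomm G x y \<otimes> gcomm G z w = gcomm G z w \<otimes> gcomm G x y"
        using xy by (intro Tcomm comm)
      have g: "gcomm G x y [^] p = \<one>"
        by (intro Texp comm xy)
      have "gcomm G x y [^] (p * r) = (gcomm G x y [^] p) [^] r"
        using xy by (simp add: nat_pow_pow)
      then show "gcomm G x y [^] (p * r) = \<one>"
        by (simp add: g)
      show "z [^] (r - 1) \<otimes> gcomm G x y [^] p = gcomm G x y [^] p \<otimes> z [^] (r - 1)"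
        using xy by (simp add: g)
      show "gcomm G (x [^] p) (y [^] p) [^] p = \<one>"
        using xy by (intro Texp comm) auto
    qed
    then show ?thesis
      using False p r primes_coprime by blast
  qed
qed

lemma (in faithful_affine_group) obeys_laws: "obeys_laws G"
  by (rule obeys_laws_if_abelian_of_prime_exponent[OF prime subgroup_chi_kernel gcomm_chi_kernel
        pow_chi_kernel chi_kernel_commute chi_kernel_exponent])

section \<open>The metacyclic groups given by presentations\<close>

abbreviation pclass :: "('g word \<times> 'g word) set \<Rightarrow> 'g word \<Rightarrow> 'g word set" where
  "pclass R u \<equiv> Collect (pres_eq R u)"

lemma pclass_eq_iff: "pclass R u = pclass R v \<longleftrightarrow> pres_eq R u v"
proof
  assume "pclass R u = pclass R v"
  then show "pres_eq R u v"
    using pres_eq.refl[of R v] by blast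
next
  assume "pres_eq R u v"
  then show "pclass R u = pclass R v"
    by (auto intro: pres_eq.trans pres_eq.sym)
qed

definition word_inv :: "'g word \<Rightarrow> 'g word" where
  "word_inv w = rev (map (\<lambda>(a, b). (a, \<not> b)) w)"

lemma word_inv_left: "pres_eq R (word_inv w @ w) []"
proof (induction w)
  case Nil
  then show ?case by (simp add: word_inv_def pres_eq.refl)
next
  case (Cons l w)
  obtain a b where l: "l = (a, b)" by (cases l)
  have c: "pres_eq R [(a, \<not> b), (a, b)] []"
    using pres_eq.cancel[of R a "\<not> b"] by simp
  have "pres_eq R (word_inv w @ ([(a, \<not> b), (a, b)] @ w)) (word_inv w @ ([] @ w))"
    by (intro pres_eq.append pres_eq.refl c)
  with Cons have "pres_eq R (word_inv w @ ([(a, \<not> b), (a, b)] @ w)) []"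
    using pres_eq.trans by fastforce
  then show ?case by (simp add: word_inv_def l)
qed

lemma presented_group_simps:
  "carrier (presented_group R) = range (pclass R)"
  "\<one>\<^bsub>presented_group R\<^esub> = pclass R []"
  "pclass R u \<otimes>\<^bsub>presented_group R\<^esub> pclass R v = pclass R (u @ v)"
proof -
  have "(\<exists>u'. pres_eq R u u' \<and> (\<exists>v'. pres_eq R v v' \<and> pres_eq R (u' @ v') w)) \<longleftrightarrow> pres_eq R (u @ v) w" for w
    by (meson pres_eq.append pres_eq.refl pres_eq.trans)
  then show "pclass R u \<otimes>\<^bsub>presented_group R\<^esub> pclass R v = pclass R (u @ v)"
    by (simp add: presented_group_def)
qed (simp_all add: presented_group_def)

lemma group_presented_group: "group (presented_group R)"
proof (rule groupI)
  fix x assume "x \<in> carrier (presented_group R)"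
  then obtain w where w: "x = pclass R w"
    by (auto simp: presented_group_simps)
  have "pclass R (word_inv w) \<otimes>\<^bsub>presented_group R\<^esub> x = \<one>\<^bsub>presented_group R\<^esub>"
    using word_inv_left[of R w] by (simp add: w presented_group_simps pclass_eq_iff)
  then show "\<exists>y\<in>carrier (presented_group R). y \<otimes>\<^bsub>presented_group R\<^esub> x = \<one>\<^bsub>presented_group R\<^esub>"
    by (intro bexI[of _ "pclass R (word_inv w)"]) (simp_all add: presented_group_simps)
qed (auto simp: presented_group_simps)

abbreviation "gx \<equiv> (Gen_x, True)"
abbreviation "gy \<equiv> (Gen_y, True)"
abbreviation "gx' \<equiv> (Gen_x, False)"
abbreviation "gy' \<equiv> (Gen_y, False)"

definition metacyclic_relators :: "nat \<Rightarrow> nat \<Rightarrow> (generator word \<times> generator word) set" where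
  "metacyclic_relators p q =
     {(replicate p gx, []), (replicate (p - 1) gy, []), ([gy, gx, gy'], replicate q gx)}"

lemma metacyclic_eq: "metacyclic p q = presented_group (metacyclic_relators p q)"
  by (simp add: metacyclic_def metacyclic_relators_def Let_def)

text \<open>
  A word in the two generators acts on the line by \<open>x: z \<mapsto> z + 1\<close> and \<open>y: z \<mapsto> q z\<close>. These functions
  compute the linear part and the translation part of that action; \<open>q^(p - 2)\<close> is the inverse of \<open>q\<close>
  modulo \<open>p\<close>.
\<close>

fun linear_part :: "nat \<Rightarrow> nat \<Rightarrow> generator word \<Rightarrow> int" where
  "linear_part p q [] = 1"
| "linear_part p q ((Gen_x, _) # w) = linear_part p q w"
| "linear_part p q ((Gen_y, b) # w) = int (if b then q else q ^ (p - 2)) * linear_part p q w"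

fun translation_part :: "nat \<Rightarrow> nat \<Rightarrow> generator word \<Rightarrow> int" where
  "translation_part p q [] = 0"
| "translation_part p q ((Gen_x, b) # w) = (if b then 1 else - 1) + translation_part p q w"
| "translation_part p q ((Gen_y, b) # w) = int (if b then q else q ^ (p - 2)) * translation_part p q w"

lemma linear_part_append: "linear_part p q (u @ v) = linear_part p q u * linear_part p q v"
  by (induction p q u rule: linear_part.induct) auto

lemma translation_part_append:
  "translation_part p q (u @ v) = translation_part p q u + linear_part p q u * translation_part p q v"
  by (induction p q u rule: linear_part.induct) (auto simp: algebra_simps)

lemma parts_replicate:
  "linear_part p q (replicate n gx) = 1" "translation_part p q (replicate n gx) = int n"
  "linear_part p q (replicate n gy) = int q ^ n" "translation_part p q (replicate n gy) = 0"
  by (induction n) auto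

locale metacyclic_presentation =
  fixes p q :: nat
  assumes p: "Factorial_Ring.prime p" and q: "residue_primroot p q"
begin

abbreviation "R \<equiv> metacyclic_relators p q"
abbreviation "M \<equiv> metacyclic p q"

lemma p_gt_1: "p > 1"
  using p prime_gt_1_nat by blast

lemma p_minus_1: "p - 1 = Suc (p - 2)"
  using p_gt_1 by simp

lemma q_power_cong_1: "[int q ^ (p - 1) = 1] (mod int p)"
  using fermat_int[OF p primroot_coprime[OF q]] .

lemma q_inverse: "[int q * int q ^ (p - 2) = 1] (mod int p)" "[int q ^ (p - 2) * int q = 1] (mod int p)"
  using q_power_cong_1 unfolding p_minus_1 by (simp_all add: mult.commute)

text \<open>
  The affine maps satisfy the defining relations, so the action is well defined on the presented group.
\<close>

lemma pres_eq_parts: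
  assumes "pres_eq R u v"
  shows "[linear_part p q u = linear_part p q v] (mod int p) \<and>
    [translation_part p q u = translation_part p q v] (mod int p)"
  using assms
proof (induction rule: pres_eq.induct)
  case (relator u v)
  then consider "u = replicate p gx" "v = []" | "u = replicate (p - 1) gy" "v = []"
    | "u = [gy, gx, gy']" "v = replicate q gx"
    by (auto simp: metacyclic_relators_def)
  then show ?case
  proof cases
    case 1
    then show ?thesis by (simp add: parts_replicate cong_0_iff)
  next
    case 2
    then show ?thesis using q_power_cong_1 by (simp add: parts_replicate)
  next
    case 3
    then show ?thesis using q_inverse by (simp add: parts_replicate)
  qed
next
  case (cancel a b)
  then show ?case
    using q_inverse by (cases a; cases b) simp_all
next
  case (append u v u' v')
  then show ?case
    by (simp add: linear_part_append translation_part_append cong_add cong_mult)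
qed (auto intro: cong_sym cong_trans)

lemma eq_context: "pres_eq R u v \<Longrightarrow> pres_eq R (a @ u @ b) (a @ v @ b)"
  by (intro pres_eq.append pres_eq.refl)

lemma x_order: "pres_eq R (replicate (k * p) gx) []"
proof (induction k)
  case (Suc k)
  have "pres_eq R (replicate p gx @ replicate (k * p) gx) ([] @ [])"
    by (intro pres_eq.append pres_eq.relator Suc) (simp add: metacyclic_relators_def)
  then show ?case by (simp add: replicate_add)
qed (simp add: pres_eq.refl)

lemma y_order: "pres_eq R (replicate (k * (p - 1)) gy) []"
proof (induction k)
  case (Suc k)
  have "pres_eq R (replicate (p - 1) gy @ replicate (k * (p - 1)) gy) ([] @ [])"
    by (intro pres_eq.append pres_eq.relator Suc) (simp add: metacyclic_relators_def)
  then show ?case by (simp add: replicate_add)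
qed (simp add: pres_eq.refl)

lemma inverse_letters:
  "pres_eq R [gx'] (replicate (p - 1) gx)" "pres_eq R [gy'] (replicate (p - 2) gy)"
proof -
  have "pres_eq R ([gx'] @ replicate p gx) ([gx'] @ [])"
    using x_order[of 1] by (intro pres_eq.append pres_eq.refl) simp
  moreover have "pres_eq R ([gx', gx] @ replicate (p - 1) gx) ([] @ replicate (p - 1) gx)"
    using pres_eq.cancel[of R Gen_x False] by (intro pres_eq.append pres_eq.refl) simp
  moreover have "[gx'] @ replicate p gx = [gx', gx] @ replicate (p - 1) gx"
    using p_gt_1 by (cases p) auto
  ultimately show "pres_eq R [gx'] (replicate (p - 1) gx)"
    by (metis append_Nil append_Nil2 pres_eq.sym pres_eq.trans)
  have "pres_eq R ([gy'] @ replicate (p - 1) gy) ([gy'] @ [])"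
    using y_order[of 1] by (intro pres_eq.append pres_eq.refl) simp
  moreover have "pres_eq R ([gy', gy] @ replicate (p - 2) gy) ([] @ replicate (p - 2) gy)"
    using pres_eq.cancel[of R Gen_y False] by (intro pres_eq.append pres_eq.refl) simp
  moreover have "[gy'] @ replicate (p - 1) gy = [gy', gy] @ replicate (p - 2) gy"
    by (subst p_minus_1) (simp only: replicate_Suc append_Cons append_Nil)
  ultimately show "pres_eq R [gy'] (replicate (p - 2) gy)"
    by (metis append_Nil append_Nil2 pres_eq.sym pres_eq.trans)
qed

lemma y_past_x: "pres_eq R (gy # replicate i gx) (replicate (q * i) gx @ [gy])"
proof (induction i)
  case (Suc i)
  have yx: "pres_eq R [gy, gx] (replicate q gx @ [gy])"
  proof -
    have "pres_eq R ([gy, gx, gy'] @ [gy]) (replicate q gx @ [gy])"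
      by (intro pres_eq.append pres_eq.refl pres_eq.relator) (simp add: metacyclic_relators_def)
    moreover have "pres_eq R ([gy, gx] @ [gy', gy]) ([gy, gx] @ [])"
      using pres_eq.cancel[of R Gen_y False] by (intro pres_eq.append pres_eq.refl) simp
    ultimately show ?thesis
      using pres_eq.sym pres_eq.trans by fastforce
  qed
  have "pres_eq R ([gy, gx] @ replicate i gx) ((replicate q gx @ [gy]) @ replicate i gx)"
    by (intro pres_eq.append pres_eq.refl yx)
  moreover have "pres_eq R (replicate q gx @ (gy # replicate i gx)) (replicate q gx @ (replicate (q * i) gx @ [gy]))"
    by (intro pres_eq.append pres_eq.refl Suc)
  ultimately show ?case
    using pres_eq.trans by (fastforce simp: replicate_add)
qed (simp add: pres_eq.refl)

lemma positive_normal_form: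
  "\<exists>i j. pres_eq R (replicate n gy @ replicate k gx @ replicate l gy) (replicate i gx @ replicate j gy)"
proof (induction n arbitrary: k l)
  case 0
  then show ?case using pres_eq.refl by fastforce
next
  case (Suc n)
  have "pres_eq R (replicate n gy @ (gy # replicate k gx) @ replicate l gy)
      (replicate n gy @ (replicate (q * k) gx @ [gy]) @ replicate l gy)"
    by (rule eq_context[OF y_past_x])
  moreover obtain i j where
    "pres_eq R (replicate n gy @ replicate (q * k) gx @ replicate (Suc l) gy) (replicate i gx @ replicate j gy)"
    using Suc by blast
  ultimately have "pres_eq R (replicate n gy @ (gy # replicate k gx) @ replicate l gy) (replicate i gx @ replicate j gy)"
    using pres_eq.trans by fastforce
  then show ?case
    by (metis append_Cons append_assoc replicate_Suc replicate_append_same append_Nil)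
qed

text \<open>
  Inverse letters are positive powers by the order relations, and the conjugation relation moves every
  \<open>y\<close> to the right of every \<open>x\<close>.
\<close>

lemma normal_form: "\<exists>i j. pres_eq R w (replicate i gx @ replicate j gy)"
proof (induction w)
  case Nil
  show ?case
    by (intro exI[of _ 0]) (simp add: pres_eq.refl)
next
  case (Cons l w)
  then obtain i j where ij: "pres_eq R w (replicate i gx @ replicate j gy)" by blast
  obtain m n where "pres_eq R [l] (replicate m gx @ replicate n gy)" and mn: "m = 0 \<or> n = 0"
  proof -
    obtain a b where l: "l = (a, b)" by (cases l)
    show ?thesis
    proof (cases a; cases b)
      assume "a = Gen_x" "b" then show ?thesis
        using that[of 1 0] by (simp add: l pres_eq.refl)
    next
      assume "a = Gen_x" "\<not> b" then show ?thesis
        using that[of "p - 1" 0] inverse_letters by (simp add: l)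
    next
      assume "a = Gen_y" "b" then show ?thesis
        using that[of 0 1] by (simp add: l pres_eq.refl)
    next
      assume "a = Gen_y" "\<not> b" then show ?thesis
        using that[of 0 "p - 2"] inverse_letters by (simp add: l)
    qed
  qed
  then have "pres_eq R ([l] @ w) ((replicate m gx @ replicate n gy) @ (replicate i gx @ replicate j gy))"
    by (intro pres_eq.append ij)
  moreover obtain i' j' where
    "pres_eq R (replicate n gy @ replicate i gx @ replicate j gy) (replicate i' gx @ replicate j' gy)"
    using positive_normal_form by blast
  then have "pres_eq R (replicate m gx @ (replicate n gy @ replicate i gx @ replicate j gy))
      (replicate m gx @ (replicate i' gx @ replicate j' gy))"
    by (rule pres_eq.append[OF pres_eq.refl])
  ultimately have "pres_eq R ([l] @ w) (replicate (m + i') gx @ replicate j' gy)"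
    using pres_eq.trans by (fastforce simp: replicate_add)
  then show ?case by auto
qed

text \<open>
  The action is faithful since the normal form \<open>x^i y^j\<close> acts by \<open>z \<mapsto> i + q^j z\<close>, which determines
  \<open>i\<close> modulo \<open>p\<close> and, as \<open>q\<close> is a primitive root, \<open>j\<close> modulo \<open>p - 1\<close>.
\<close>

lemma parts_faithful:
  assumes "[translation_part p q w = 0] (mod int p)" "[linear_part p q w = 1] (mod int p)"
  shows "pres_eq R w []"
proof -
  obtain i j where ij: "pres_eq R w (replicate i gx @ replicate j gy)"
    using normal_form by blast
  then have "[linear_part p q w = int q ^ j] (mod int p)" "[translation_part p q w = int i] (mod int p)"
    using pres_eq_parts[OF ij] by (simp_all add: linear_part_append translation_part_append parts_replicate)
  then have "[int i = 0] (mod int p)" "[int q ^ j = int q ^ 0] (mod int p)"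
    using assms cong_trans cong_sym by (metis power_0)+
  then have "p dvd i" "[j = 0] (mod (p - 1))"
    using primroot_power_cong_iff[OF p q, of j 0] by (simp_all only: cong_0_iff int_dvd_int_iff)
  then have "p dvd i" "p - 1 dvd j"
    by (simp_all only: cong_0_iff)
  then have "pres_eq R (replicate i gx @ replicate j gy) ([] @ [])"
    using x_order y_order by (intro pres_eq.append) (auto elim!: dvdE simp: mult.commute)
  with ij show ?thesis
    using pres_eq.trans by fastforce
qed

definition tp :: "generator word set \<Rightarrow> int" where
  "tp A = translation_part p q (SOME w. w \<in> A)"

definition lp :: "generator word set \<Rightarrow> int" where
  "lp A = linear_part p q (SOME w. w \<in> A)"

lemma tp_lp_class:
  "[tp (pclass R w) = translation_part p q w] (mod int p)"
  "[lp (pclass R w) = linear_part p q w] (mod int p)"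
proof -
  have "(SOME v. v \<in> pclass R w) \<in> pclass R w"
    by (rule someI[of _ w]) (simp add: pres_eq.refl)
  then have "pres_eq R (SOME v. v \<in> pclass R w) w"
    using pres_eq.sym by blast
  then show "[tp (pclass R w) = translation_part p q w] (mod int p)"
    "[lp (pclass R w) = linear_part p q w] (mod int p)"
    unfolding tp_def lp_def using pres_eq_parts by blast+
qed

sublocale faithful_affine_group M p tp lp
proof -
  interpret group M
    unfolding metacyclic_eq by (rule group_presented_group)
  show "faithful_affine_group M p tp lp"
  proof
    show "Factorial_Ring.prime p" by (rule p)
    show "affine_rep p M tp lp"
      unfolding affine_rep_def
    proof (intro conjI ballI)
      fix u v assume "u \<in> carrier M" "v \<in> carrier M"
      then obtain a b where ab: "u = pclass R a" "v = pclass R b"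
        by (auto simp: metacyclic_eq presented_group_simps)
      have uv: "u \<otimes>\<^bsub>M\<^esub> v = pclass R (a @ b)"
        by (simp add: ab metacyclic_eq presented_group_simps)
      have "[tp (pclass R (a @ b)) = translation_part p q a + linear_part p q a * translation_part p q b] (mod int p)"
        using tp_lp_class(1)[of "a @ b"] by (simp add: translation_part_append)
      also have "[translation_part p q a + linear_part p q a * translation_part p q b = tp u + lp u * tp v] (mod int p)"
        unfolding ab by (intro cong_add cong_mult cong_sym[OF tp_lp_class(1)] cong_sym[OF tp_lp_class(2)])
      finally show "[tp (u \<otimes>\<^bsub>M\<^esub> v) = tp u + lp u * tp v] (mod int p)"
        unfolding uv .
      have "[lp (pclass R (a @ b)) = linear_part p q a * linear_part p q b] (mod int p)"
        using tp_lp_class(2)[of "a @ b"] by (simp add: linear_part_append)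
      also have "[linear_part p q a * linear_part p q b = lp u * lp v] (mod int p)"
        unfolding ab by (intro cong_mult cong_sym[OF tp_lp_class(2)])
      finally show "[lp (u \<otimes>\<^bsub>M\<^esub> v) = lp u * lp v] (mod int p)"
        unfolding uv .
    next
      show "[lp \<one>\<^bsub>M\<^esub> = 1] (mod int p)"
        using tp_lp_class(2)[of "[]"] by (simp add: metacyclic_eq presented_group_simps)
    qed
    fix u assume "u \<in> carrier M" and c: "[tp u = 0] (mod int p)" "[lp u = 1] (mod int p)"
    then obtain w where w: "u = pclass R w"
      by (auto simp: metacyclic_eq presented_group_simps)
    have "pres_eq R w []"
      using parts_faithful[of w] c tp_lp_class[of w] cong_trans cong_sym unfolding w by metis
    then show "u = \<one>\<^bsub>M\<^esub>"
      by (simp add: w metacyclic_eq presented_group_simps pclass_eq_iff)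
  qed
qed

lemma finite_metacyclic: "finite (carrier M)"
proof (rule finite_imageD)
  let ?h = "\<lambda>u. (tp u mod int p, lp u mod int p)"
  show "inj_on ?h (carrier M)"
    by (rule inj_onI) (rule eq_if_cong, simp_all add: cong_def)
  have "?h ` carrier M \<subseteq> {0..<int p} \<times> {0..<int p}"
    using p_gt_1 by auto
  then show "finite (?h ` carrier M)"
    using finite_subset by blast
qed

text \<open>
  All affine maps occur in the metacyclic group, and its elements are determined by the maps;
  hence an affine representation of any group is a homomorphism to it.
\<close>

lemma affine_rep_factors:
  assumes "affine_group G p f chi"
  obtains h where "h \<in> hom G M"
    "\<forall>u\<in>carrier G. [tp (h u) = f u] (mod int p) \<and> [lp (h u) = chi u] (mod int p)"
proof -
  interpret A: affine_group G p f chi by fact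
  have "\<exists>z\<in>carrier M. [tp z = f u] (mod int p) \<and> [lp z = chi u] (mod int p)" if u: "u \<in> carrier G" for u
  proof -
    obtain j where j: "[int q ^ j = chi u] (mod int p)"
      using primroot_generates[OF p q A.coprime_chi[OF u]] .
    define i where "i = nat (f u mod int p)"
    have i: "[int i = f u] (mod int p)"
      using p_gt_1 by (simp add: i_def)
    let ?w = "replicate i gx @ replicate j gy"
    have "[tp (pclass R ?w) = int i] (mod int p)" "[lp (pclass R ?w) = int q ^ j] (mod int p)"
      using tp_lp_class[of ?w] by (simp_all add: linear_part_append translation_part_append parts_replicate)
    then show ?thesis
      using i j cong_trans
      by (intro bexI[of _ "pclass R ?w"]) (auto simp: metacyclic_eq presented_group_simps)
  qed
  then obtain h where h: "\<And>u. u \<in> carrier G \<Longrightarrow> h u \<in> carrier M"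
    "\<And>u. u \<in> carrier G \<Longrightarrow> [tp (h u) = f u] (mod int p)"
    "\<And>u. u \<in> carrier G \<Longrightarrow> [lp (h u) = chi u] (mod int p)"
    by metis
  have "h (u \<otimes>\<^bsub>G\<^esub> v) = h u \<otimes>\<^bsub>M\<^esub> h v" if uv: "u \<in> carrier G" "v \<in> carrier G" for u v
  proof (rule eq_if_cong)
    have uv': "u \<otimes>\<^bsub>G\<^esub> v \<in> carrier G"
      using uv by simp
    show "h (u \<otimes>\<^bsub>G\<^esub> v) \<in> carrier M" "h u \<otimes>\<^bsub>M\<^esub> h v \<in> carrier M"
      using uv h(1) by auto
    have "[tp (h (u \<otimes>\<^bsub>G\<^esub> v)) = f u + chi u * f v] (mod int p)"
      using cong_trans[OF h(2)[OF uv'] A.f_mult[OF uv]] .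
    also have "[f u + chi u * f v = tp (h u) + lp (h u) * tp (h v)] (mod int p)"
      using uv h by (intro cong_add cong_mult) (simp_all add: cong_sym)
    also have "[tp (h u) + lp (h u) * tp (h v) = tp (h u \<otimes>\<^bsub>M\<^esub> h v)] (mod int p)"
      using uv h(1) f_mult cong_sym by blast
    finally show "[tp (h (u \<otimes>\<^bsub>G\<^esub> v)) = tp (h u \<otimes>\<^bsub>M\<^esub> h v)] (mod int p)" .
    have "[lp (h (u \<otimes>\<^bsub>G\<^esub> v)) = chi u * chi v] (mod int p)"
      using cong_trans[OF h(3)[OF uv'] A.chi_mult[OF uv]] .
    also have "[chi u * chi v = lp (h u) * lp (h v)] (mod int p)"
      using uv h by (intro cong_mult) (simp_all add: cong_sym)
    also have "[lp (h u) * lp (h v) = lp (h u \<otimes>\<^bsub>M\<^esub> h v)] (mod int p)"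
      using uv h(1) chi_mult cong_sym by blast
    finally show "[lp (h (u \<otimes>\<^bsub>G\<^esub> v)) = lp (h u \<otimes>\<^bsub>M\<^esub> h v)] (mod int p)" .
  qed
  then have "h \<in> hom G M"
    using h(1) by (auto simp: hom_def)
  with h show ?thesis
    using that by blast
qed

lemma affine_rep_separates:
  assumes "affine_group G p f chi" "g \<in> carrier G"
    and "\<not> ([f g = 0] (mod int p) \<and> [chi g = 1] (mod int p))"
  obtains h where "h \<in> hom G M" "h g \<noteq> \<one>\<^bsub>M\<^esub>"
proof -
  obtain h where h: "h \<in> hom G M"
    "\<forall>u\<in>carrier G. [tp (h u) = f u] (mod int p) \<and> [lp (h u) = chi u] (mod int p)"
    using affine_rep_factors[OF assms(1)] .
  have "h g \<noteq> \<one>\<^bsub>M\<^esub>"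
  proof
    assume "h g = \<one>\<^bsub>M\<^esub>"
    then have "[f g = 0] (mod int p)" "[chi g = 1] (mod int p)"
      using h(2) assms(2) f_one chi_one cong_trans cong_sym by metis+
    with assms(3) show False by simp
  qed
  with h(1) show ?thesis
    using that by blast
qed

end

section \<open>Equivariant characters of the derived subgroup\<close>

context group
begin

lemma centralizer_subgroup:
  assumes "S \<subseteq> carrier G"
  shows "subgroup {c \<in> carrier G. \<forall>b\<in>S. c \<otimes> b = b \<otimes> c} G"
proof (rule subgroupI)
  show "{c \<in> carrier G. \<forall>b\<in>S. c \<otimes> b = b \<otimes> c} \<noteq> {}"
    using assms by (auto intro!: exI[of _ \<one>])
next
  fix a assume a: "a \<in> {c \<in> carrier G. \<forall>b\<in>S. c \<otimes> b = b \<otimes> c}"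
  have "inv a \<otimes> b = b \<otimes> inv a" if "b \<in> S" for b
  proof -
    have b: "b \<in> carrier G" using that assms by blast
    have "inv a \<otimes> b = inv a \<otimes> (b \<otimes> a) \<otimes> inv a"
      using a b by (simp add: m_assoc)
    also have "\<dots> = inv a \<otimes> (a \<otimes> b) \<otimes> inv a"
      using a that by simp
    also have "\<dots> = b \<otimes> inv a"
      using a b by (simp add: group_word)
    finally show ?thesis .
  qed
  then show "inv a \<in> {c \<in> carrier G. \<forall>b\<in>S. c \<otimes> b = b \<otimes> c}"
    using a by simp
next
  fix a b assume ab: "a \<in> {c \<in> carrier G. \<forall>b\<in>S. c \<otimes> b = b \<otimes> c}" "b \<in> {c \<in> carrier G. \<forall>b\<in>S. c \<otimes> b = b \<otimes> c}"
  have "a \<otimes> b \<otimes> z = z \<otimes> (a \<otimes> b)" if "z \<in> S" for z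
  proof -
    have z: "z \<in> carrier G" using that assms by blast
    have c: "a \<in> carrier G" "b \<in> carrier G" "b \<otimes> z = z \<otimes> b" "a \<otimes> z = z \<otimes> a"
      using ab that by auto
    have "a \<otimes> b \<otimes> z = a \<otimes> z \<otimes> b"
      using c(1-3) z by (simp add: m_assoc)
    also have "\<dots> = z \<otimes> (a \<otimes> b)"
      using c(1,2,4) z by (simp add: m_assoc[of z])
    finally show ?thesis .
  qed
  then show "a \<otimes> b \<in> {c \<in> carrier G. \<forall>b\<in>S. c \<otimes> b = b \<otimes> c}"
    using ab by simp
qed auto

text \<open>
  If the commutators commute, each of them lies in the centralizer of all others. Two
  applications of the minimality of the derived subgroup yield that it is abelian.
\<close>

lemma derived_commute_iff:
  "(\<forall>x\<in>carrier G. \<forall>y\<in>carrier G. \<forall>z\<in>carrier G. \<forall>w\<in>carrier G.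
      gcomm G x y \<otimes> gcomm G z w = gcomm G z w \<otimes> gcomm G x y) \<longleftrightarrow>
   (\<forall>a\<in>derived_subgroup. \<forall>b\<in>derived_subgroup. a \<otimes> b = b \<otimes> a)" (is "?L \<longleftrightarrow> ?R")
proof
  assume L: ?L
  let ?S = "{gcomm G z w | z w. z \<in> carrier G \<and> w \<in> carrier G}"
  have "derived_subgroup \<subseteq> {c \<in> carrier G. \<forall>b\<in>?S. c \<otimes> b = b \<otimes> c}"
    by (rule derived_subgroup_least[OF centralizer_subgroup]) (use L in auto)
  then have 1: "a \<otimes> gcomm G z w = gcomm G z w \<otimes> a"
    if "a \<in> derived_subgroup" "z \<in> carrier G" "w \<in> carrier G" for a z w
    using that by blast
  have "derived_subgroup \<subseteq> {c \<in> carrier G. \<forall>b\<in>derived_subgroup. c \<otimes> b = b \<otimes> c}"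
    by (rule derived_subgroup_least[OF centralizer_subgroup]) (use 1 derived_carrier in auto)
  then show ?R by blast
next
  assume ?R
  then show ?L
    using gcomm_in_derived by blast
qed

lemma derived_pow_trivial:
  assumes ab: "\<forall>a\<in>derived_subgroup. \<forall>b\<in>derived_subgroup. a \<otimes> b = b \<otimes> a"
    and "\<And>x y. x \<in> carrier G \<Longrightarrow> y \<in> carrier G \<Longrightarrow> gcomm G x y [^] (n::nat) = \<one>"
    and a: "a \<in> derived_subgroup"
  shows "a [^] n = \<one>"
proof -
  note D = derived_is_subgroup[of "carrier G", simplified]
  have "derived_subgroup \<subseteq> {a \<in> derived_subgroup. a [^] n = \<one>}"
  proof (rule derived_subgroup_least)
    show "subgroup {a \<in> derived_subgroup. a [^] n = \<one>} G"
    proof (rule subgroupI)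
      show "{a \<in> derived_subgroup. a [^] n = \<one>} \<subseteq> carrier G"
        using derived_carrier by blast
      show "{a \<in> derived_subgroup. a [^] n = \<one>} \<noteq> {}"
        using subgroup.one_closed[OF D] by auto
    next
      fix a assume a: "a \<in> {a \<in> derived_subgroup. a [^] n = \<one>}"
      then show "inv a \<in> {a \<in> derived_subgroup. a [^] n = \<one>}"
        using subgroup.m_inv_closed[OF D] by (simp add: nat_pow_inv derived_carrier)
    next
      fix a b assume "a \<in> {a \<in> derived_subgroup. a [^] n = \<one>}" "b \<in> {a \<in> derived_subgroup. a [^] n = \<one>}"
      then show "a \<otimes> b \<in> {a \<in> derived_subgroup. a [^] n = \<one>}"
        using subgroup.m_closed[OF D] ab by (simp add: pow_mult_distrib derived_carrier)
    qed
  qed (use assms(2) gcomm_in_derived in auto)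
  with a show ?thesis by blast
qed

lemma derived_pow_commutes:
  assumes ab: "\<forall>a\<in>derived_subgroup. \<forall>b\<in>derived_subgroup. a \<otimes> b = b \<otimes> a"
    and v: "v \<in> carrier G"
    and com: "\<And>x y. x \<in> carrier G \<Longrightarrow> y \<in> carrier G \<Longrightarrow> v \<otimes> gcomm G x y [^] (s::nat) = gcomm G x y [^] s \<otimes> v"
    and a: "a \<in> derived_subgroup"
  shows "v \<otimes> a [^] s = a [^] s \<otimes> v"
proof -
  note D = derived_is_subgroup[of "carrier G", simplified]
  have C: "subgroup {c \<in> carrier G. \<forall>b\<in>{v}. c \<otimes> b = b \<otimes> c} G" (is "subgroup ?C G")
    using v by (intro centralizer_subgroup) simp
  have "derived_subgroup \<subseteq> {a \<in> derived_subgroup. a [^] s \<in> ?C}"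
  proof (rule derived_subgroup_least)
    show "subgroup {a \<in> derived_subgroup. a [^] s \<in> ?C} G"
    proof (rule subgroupI)
      show "{a \<in> derived_subgroup. a [^] s \<in> ?C} \<subseteq> carrier G"
        using derived_carrier by blast
      have "\<one> [^] s \<in> ?C"
        using v by simp
      then show "{a \<in> derived_subgroup. a [^] s \<in> ?C} \<noteq> {}"
        using subgroup.one_closed[OF D] by blast
    next
      fix a assume "a \<in> {a \<in> derived_subgroup. a [^] s \<in> ?C}"
      then show "inv a \<in> {a \<in> derived_subgroup. a [^] s \<in> ?C}"
        using subgroup.m_inv_closed[OF D] subgroup.m_inv_closed[OF C, of "a [^] s"]
        by (simp add: nat_pow_inv derived_carrier)
    next
      fix a b assume "a \<in> {a \<in> derived_subgroup. a [^] s \<in> ?C}" "b \<in> {a \<in> derived_subgroup. a [^] s \<in> ?C}"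
      then show "a \<otimes> b \<in> {a \<in> derived_subgroup. a [^] s \<in> ?C}"
        using subgroup.m_closed[OF D, of a b] subgroup.m_closed[OF C, of "a [^] s" "b [^] s"] ab
        by (simp add: pow_mult_distrib derived_carrier)
    qed
  qed (use com gcomm_in_derived in auto)
  with a show ?thesis by auto
qed

text \<open>
  The two sides differ by the conjugation with \<open>[u, v]\<close>, which is trivial on an abelian derived subgroup.
\<close>

lemma conj_commute_derived:
  assumes ab: "\<forall>a\<in>derived_subgroup. \<forall>b\<in>derived_subgroup. a \<otimes> b = b \<otimes> a"
    and uv: "u \<in> carrier G" "v \<in> carrier G" and a: "a \<in> derived_subgroup"
  shows "conj u (conj v a) = conj v (conj u a)"
proof -
  note ac = derived_carrier[OF a]
  let ?c = "gcomm G u v"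
  have "conj u (conj v a) = conj (?c \<otimes> (v \<otimes> u)) a"
    using uv ac by (simp add: conj_conj flip: mult_eq_gcomm)
  also have "\<dots> = conj ?c (conj (v \<otimes> u) a)"
    using uv ac by (intro conj_conj) auto
  also have "\<dots> = conj (v \<otimes> u) a"
  proof -
    have d: "conj (v \<otimes> u) a \<in> derived_subgroup"
      using uv a by (intro derived_conj_closed) auto
    show ?thesis
      by (rule iffD2[OF conj_eq_self_iff bspec[OF bspec[OF ab gcomm_in_derived[OF uv]] d]])
        (use uv derived_carrier[OF d] in auto)
  qed
  also have "\<dots> = conj v (conj u a)"
    using uv ac by (simp add: conj_conj)
  finally show ?thesis .
qed

lemma laws_trivial_iff_derived:
  "laws p s G \<subseteq> {\<one>} \<longleftrightarrow>
     (\<forall>a\<in>derived_subgroup. \<forall>b\<in>derived_subgroup. a \<otimes> b = b \<otimes> a) \<and>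
     (\<forall>a\<in>derived_subgroup. a [^] (s * p) = \<one>) \<and>
     (\<forall>a\<in>derived_subgroup. \<forall>u\<in>carrier G. u [^] (p - 1) \<otimes> a [^] s = a [^] s \<otimes> u [^] (p - 1)) \<and>
     (\<forall>x\<in>carrier G. \<forall>y\<in>carrier G. gcomm G (x [^] s) (y [^] s) [^] s = \<one>)" (is "_ \<longleftrightarrow> ?R")
proof
  assume "laws p s G \<subseteq> {\<one>}"
  note L = this[unfolded laws_trivial_iff, rule_format]
  have ab: "\<forall>a\<in>derived_subgroup. \<forall>b\<in>derived_subgroup. a \<otimes> b = b \<otimes> a"
    unfolding derived_commute_iff[symmetric] using L by blast
  show ?R
  proof (intro conjI ballI)
    fix a assume a: "a \<in> derived_subgroup"
    show "a [^] (s * p) = \<one>"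
      using derived_pow_trivial[OF ab _ a, of "s * p"] L by simp
    fix u assume u: "u \<in> carrier G"
    show "u [^] (p - 1) \<otimes> a [^] s = a [^] s \<otimes> u [^] (p - 1)"
      using derived_pow_commutes[OF ab _ _ a, of "u [^] (p - 1)" s] u L by simp
  qed (use ab L in auto)
next
  assume ?R
  then show "laws p s G \<subseteq> {\<one>}"
    unfolding laws_trivial_iff using gcomm_in_derived by simp
qed

end

locale law_group = group +
  assumes fin: "finite (carrier G)" and obeys: "obeys_laws G"
begin

lemma derived_commute:
  assumes "a \<in> derived_subgroup" "b \<in> derived_subgroup" shows "a \<otimes> b = b \<otimes> a"
proof -
  obtain s where "laws 2 s G \<subseteq> {\<one>}"
    using obeys two_is_prime_nat unfolding obeys_laws_def by blast
  with assms show ?thesis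
    unfolding laws_trivial_iff_derived by blast
qed

lemma law_exponent:
  fixes p :: nat
  assumes "Factorial_Ring.prime p"
  obtains s where "coprime s p" "\<forall>a\<in>derived_subgroup. a [^] (s * p) = \<one>"
    "\<forall>a\<in>derived_subgroup. \<forall>u\<in>carrier G. conj (u [^] (p - 1)) (a [^] s) = a [^] s"
    "\<forall>x\<in>carrier G. \<forall>y\<in>carrier G. gcomm G (x [^] s) (y [^] s) [^] s = \<one>"
proof -
  obtain s where s: "coprime s p" "laws p s G \<subseteq> {\<one>}"
    using obeys assms unfolding obeys_laws_def by blast
  note L = s(2)[unfolded laws_trivial_iff_derived, THEN conjunct2]
  show ?thesis
  proof (rule that[OF s(1) L[THEN conjunct1]]; intro ballI)
    fix a u assume au: "a \<in> derived_subgroup" "u \<in> carrier G"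
    then have "u [^] (p - 1) \<otimes> a [^] s = a [^] s \<otimes> u [^] (p - 1)"
      using L[THEN conjunct2, THEN conjunct1] by blast
    then show "conj (u [^] (p - 1)) (a [^] s) = a [^] s"
      by (rule iffD2[OF conj_eq_self_iff, rotated 2]) (simp_all add: au derived_carrier)
  next
    fix x y assume "x \<in> carrier G" "y \<in> carrier G"
    then show "gcomm G (x [^] s) (y [^] s) [^] s = \<one>"
      using L[THEN conjunct2, THEN conjunct2] by blast
  qed
qed

lemma derived_subgroup_subgroup: "subgroup derived_subgroup G"
  by (rule derived_is_subgroup) simp

lemma conj_commute:
  "u \<in> carrier G \<Longrightarrow> v \<in> carrier G \<Longrightarrow> a \<in> derived_subgroup \<Longrightarrow> conj u (conj v a) = conj v (conj u a)"
  by (rule conj_commute_derived) (intro ballI derived_commute)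

text \<open>
  A separating character with values modulo the group order is reduced to one prime power \<open>p^k\<close> that
  still sees \<open>g\<close>. The law \<open>a^(s p) = 1\<close> makes all its values divisible by \<open>p^(k - 1)\<close>; dividing leaves
  a character modulo \<open>p\<close>.
\<close>

lemma derived_character:
  assumes N: "subgroup N G" "N \<subseteq> derived_subgroup" and g: "g \<in> derived_subgroup" "g \<notin> N"
  obtains p lam where "Factorial_Ring.prime p" "additive_mod (int p) G derived_subgroup lam"
    "\<forall>x\<in>N. [lam x = 0] (mod int p)" "\<not> [lam g = 0] (mod int p)"
proof -
  let ?A = "G\<lparr>carrier := derived_subgroup\<rparr>"
  define n where "n = order G"
  have n: "n > 0"
    using fin order_gt_0_iff_finite by (simp add: n_def)
  interpret A: group ?A
    by (rule subgroup.subgroup_is_group[OF derived_subgroup_subgroup is_group])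
  have pow: "x [^]\<^bsub>?A\<^esub> k = x [^] k" for x and k :: nat
    by (simp flip: nat_pow_consistent)
  obtain lam where lam: "additive_mod (int n) ?A (carrier ?A) lam"
    "\<And>x. x \<in> N \<Longrightarrow> [lam x = 0] (mod int n)" "\<not> [lam g = 0] (mod int n)"
  proof (rule A.separating_character[of n N g])
    show "finite (carrier ?A)"
      using finite_subset[OF subgroup.subset[OF derived_subgroup_subgroup] fin] by simp
    show "x [^]\<^bsub>?A\<^esub> n = \<one>\<^bsub>?A\<^esub>" if "x \<in> carrier ?A" for x
      using that pow_order_eq_1 derived_carrier by (simp add: pow n_def)
    show "subgroup N ?A"
      using subgroup_incl[OF N(1) derived_subgroup_subgroup N(2)] .
    show "gcomm ?A x y \<in> N" if "x \<in> carrier ?A" "y \<in> carrier ?A" for x y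
    proof -
      have "gcomm ?A x y = \<one>\<^bsub>?A\<^esub>"
        using A.gcomm_eq_one_iff[OF that] that derived_commute by simp
      then show ?thesis
        using subgroup.one_closed[OF N(1)] by simp
    qed
  qed (use n g in auto)
  have add: "additive_mod (int n) G derived_subgroup lam"
    using lam(1) by (simp add: additive_mod_def)
  obtain p k where p: "Factorial_Ring.prime p" and k: "p ^ k dvd n" "\<not> int (p ^ k) dvd lam g"
    using prime_power_dvd_not_dvd[OF n lam(3)[unfolded cong_0_iff]] .
  have "k \<noteq> 0"
    using k(2) by (intro notI) simp
  then obtain l where l: "k = Suc l"
    using not0_implies_Suc by blast
  have pk: "int (p ^ k) = int p * int (p ^ l)"
    by (simp add: l)
  have addk: "additive_mod (int (p ^ k)) G derived_subgroup lam"
    unfolding additive_mod_def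
  proof (intro ballI)
    fix x y assume "x \<in> derived_subgroup" "y \<in> derived_subgroup"
    from additive_modD[OF add this] show "[lam (x \<otimes> y) = lam x + lam y] (mod int (p ^ k))"
      by (rule cong_dvd_modulus) (use k(1) in \<open>simp only: int_dvd_int_iff\<close>)
  qed
  obtain s where s: "coprime s p" "\<forall>a\<in>derived_subgroup. a [^] (s * p) = \<one>"
    by (rule law_exponent[OF p])
  have dvd: "int (p ^ l) dvd lam a" if a: "a \<in> derived_subgroup" for a
  proof -
    have "[int (s * p) * lam a = lam (a [^] (s * p))] (mod int (p ^ k))"
      using additive_mod_pow[OF addk derived_subgroup_subgroup a] by (rule cong_sym)
    also have "[lam (a [^] (s * p)) = 0] (mod int (p ^ k))"
      using additive_mod_one[OF addk derived_subgroup_subgroup] bspec[OF s(2) a] by simp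
    finally have "int p * int (p ^ l) dvd int p * (int s * lam a)"
      by (simp only: cong_0_iff pk) (simp add: ac_simps)
    then have "int (p ^ l) dvd int s * lam a"
      using prime_gt_0_nat[OF p] by (subst (asm) dvd_times_left_cancel_iff) auto
    moreover have "coprime (int (p ^ l)) (int s)"
      using s(1) by (simp add: coprime_commute)
    ultimately show ?thesis
      by (simp add: coprime_dvd_mult_right_iff)
  qed
  define mu where "mu a = lam a div int (p ^ l)" for a
  have mu: "lam a = int (p ^ l) * mu a" if "a \<in> derived_subgroup" for a
    using dvd[OF that] by (simp add: mu_def)
  have pl: "int (p ^ l) \<noteq> 0"
    using prime_gt_0_nat[OF p] by simp
  have "additive_mod (int p) G derived_subgroup mu"
    unfolding additive_mod_def
  proof (intro ballI)
    fix x y assume xy: "x \<in> derived_subgroup" "y \<in> derived_subgroup"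
    then have xy': "x \<otimes> y \<in> derived_subgroup"
      using subgroup.m_closed[OF derived_subgroup_subgroup] by blast
    have "int (p ^ k) dvd lam (x \<otimes> y) - (lam x + lam y)"
      using additive_modD[OF addk xy] by (simp add: cong_iff_dvd_diff)
    then have "int (p ^ l) * int p dvd int (p ^ l) * (mu (x \<otimes> y) - (mu x + mu y))"
      unfolding mu[OF xy(1)] mu[OF xy(2)] mu[OF xy'] pk by (simp add: algebra_simps)
    then have "int p dvd mu (x \<otimes> y) - (mu x + mu y)"
      using pl by (subst (asm) dvd_times_left_cancel_iff) auto
    then show "[mu (x \<otimes> y) = mu x + mu y] (mod int p)"
      by (simp add: cong_iff_dvd_diff)
  qed
  moreover have "[mu x = 0] (mod int p)" if "x \<in> N" for x
  proof -
    have "int n dvd lam x"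
      using lam(2)[OF that] by (simp add: cong_0_iff)
    then have "int (p ^ k) dvd lam x"
      using k(1) dvd_trans int_dvd_int_iff by blast
    then have "int (p ^ l) * int p dvd int (p ^ l) * mu x"
      using mu[of x] N(2) that unfolding pk by (simp add: mult.commute subset_iff)
    then have "int p dvd mu x"
      using pl by (subst (asm) dvd_times_left_cancel_iff) auto
    then show ?thesis
      by (simp add: cong_0_iff)
  qed
  moreover have "\<not> [mu g = 0] (mod int p)"
  proof
    assume "[mu g = 0] (mod int p)"
    then have "int (p ^ l) * int p dvd int (p ^ l) * mu g"
      by (intro mult_dvd_mono) (simp_all add: cong_0_iff)
    then show False
      using k(2) mu[OF g(1)] unfolding pk by (simp add: mult.commute)
  qed
  ultimately show ?thesis
    using that[OF p] by blast
qed

text \<open>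
  The third law speaks about \<open>a^s\<close> only, but modulo \<open>p\<close> the factor \<open>s\<close> can be cancelled.
\<close>

lemma additive_conj_power:
  assumes p: "Factorial_Ring.prime p" and add: "additive_mod (int p) G derived_subgroup lam"
    and a: "a \<in> derived_subgroup" and u: "u \<in> carrier G"
  shows "[lam (conj (u [^] (p - 1)) a) = lam a] (mod int p)"
proof -
  obtain s where s: "coprime s p"
    "\<forall>a\<in>derived_subgroup. \<forall>u\<in>carrier G. conj (u [^] (p - 1)) (a [^] s) = a [^] s"
    by (rule law_exponent[OF p])
  let ?v = "u [^] (p - 1)"
  have ca: "conj ?v a \<in> derived_subgroup"
    using u a by (intro derived_conj_closed) auto
  have "[int s * lam (conj ?v a) = lam (conj ?v a [^] s)] (mod int p)"
    by (rule cong_sym[OF additive_mod_pow[OF add derived_subgroup_subgroup ca]])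
  also have "conj ?v a [^] s = a [^] s"
    using bspec[OF bspec[OF s(2) a] u] conj_pow[of ?v a s] u derived_carrier[OF a] by simp
  also have "[lam (a [^] s) = int s * lam a] (mod int p)"
    by (rule additive_mod_pow[OF add derived_subgroup_subgroup a])
  finally show ?thesis
    using s(1) by (subst (asm) cong_mult_lcancel) auto
qed

text \<open>
  One step of the simultaneous diagonalization. With a primitive root \<open>q\<close>, the character \<open>\<lambda>\<close> is, up to
  the factor \<open>p - 1\<close>, the sum of the characters
  \<open>e\<^sub>i(a) = \<Sum>\<^sub>j q^(i j) \<lambda>(u^j a u^(-j))\<close>, and each \<open>e\<^sub>i\<close> is an eigenvector for
  the conjugation by \<open>u\<close>. Some \<open>e\<^sub>i\<close> is nonzero at \<open>g\<close>. Since conjugations commute on the derived subgroup,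
  \<open>e\<^sub>i\<close> keeps the eigenvalues that \<open>\<lambda>\<close> has for the elements of \<open>S\<close>.
\<close>

lemma split_eigencharacter:
  assumes p: "Factorial_Ring.prime p" and N: "N \<lhd> G" "N \<subseteq> derived_subgroup"
    and g: "g \<in> derived_subgroup" and u: "u \<in> carrier G"
    and add: "additive_mod (int p) G derived_subgroup lam"
    and kills: "\<forall>x\<in>N. [lam x = 0] (mod int p)" and nz: "\<not> [lam g = 0] (mod int p)"
    and S: "S \<subseteq> carrier G"
    and eigen: "\<forall>v\<in>S. \<exists>c. \<forall>a\<in>derived_subgroup. [lam (conj v a) = c * lam a] (mod int p)"
  shows "\<exists>mu. additive_mod (int p) G derived_subgroup mu \<and>
    (\<forall>x\<in>N. [mu x = 0] (mod int p)) \<and> \<not> [mu g = 0] (mod int p) \<and>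
    (\<forall>v\<in>insert u S. \<exists>c. \<forall>a\<in>derived_subgroup. [mu (conj v a) = c * mu a] (mod int p))"
proof -
  obtain q where q: "residue_primroot p q"
    using prime_has_primroot[OF p] by blast
  interpret Q: metacyclic_presentation p q
    by standard (rule p, rule q)
  have uj: "u [^] (j::nat) \<in> carrier G" for j
    using u by simp
  define e where "e i a = (\<Sum>j<p - 1. int q ^ (i * j) * lam (conj (u [^] j) a))" for i a
  have e_add: "additive_mod (int p) G derived_subgroup (e i)" for i
    unfolding additive_mod_def
  proof (intro ballI)
    fix a b assume ab: "a \<in> derived_subgroup" "b \<in> derived_subgroup"
    have "[e i (a \<otimes> b) = (\<Sum>j<p - 1. int q ^ (i * j) * (lam (conj (u [^] j) a) + lam (conj (u [^] j) b)))] (mod int p)"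
      unfolding e_def
    proof (intro cong_sum cong_mult)
      fix j :: nat
      have "conj (u [^] j) (a \<otimes> b) = conj (u [^] j) a \<otimes> conj (u [^] j) b"
        using uj ab derived_carrier by (intro conj_mult) auto
      then show "[lam (conj (u [^] j) (a \<otimes> b)) = lam (conj (u [^] j) a) + lam (conj (u [^] j) b)] (mod int p)"
        using additive_modD[OF add derived_conj_closed[OF uj ab(1)] derived_conj_closed[OF uj ab(2)]] by simp
    qed simp
    also have "(\<Sum>j<p - 1. int q ^ (i * j) * (lam (conj (u [^] j) a) + lam (conj (u [^] j) b))) = e i a + e i b"
      by (simp add: e_def distrib_left sum.distrib)
    finally show "[e i (a \<otimes> b) = e i a + e i b] (mod int p)" .
  qed
  have e_kills: "[e i x = 0] (mod int p)" if x: "x \<in> N" for i x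
  proof -
    have "conj (u [^] j) x \<in> N" for j :: nat
      using N(1) uj x by (simp add: normal_inv_iff)
    then have "[e i x = (\<Sum>j<p - 1. int q ^ (i * j) * 0)] (mod int p)"
      unfolding e_def using kills by (intro cong_sum cong_mult) auto
    then show ?thesis by simp
  qed
  have e_old: "[e i (conj v a) = c * e i a] (mod int p)"
    if v: "v \<in> carrier G" and c: "\<forall>a\<in>derived_subgroup. [lam (conj v a) = c * lam a] (mod int p)"
      and a: "a \<in> derived_subgroup" for i v c a
  proof -
    have "[e i (conj v a) = (\<Sum>j<p - 1. int q ^ (i * j) * (c * lam (conj (u [^] j) a)))] (mod int p)"
      unfolding e_def
    proof (intro cong_sum cong_mult)
      fix j :: nat
      have "conj (u [^] j) (conj v a) = conj v (conj (u [^] j) a)"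
        using conj_commute[OF uj v a] .
      then show "[lam (conj (u [^] j) (conj v a)) = c * lam (conj (u [^] j) a)] (mod int p)"
        using c derived_conj_closed[OF uj a] by simp
    qed simp
    also have "(\<Sum>j<p - 1. int q ^ (i * j) * (c * lam (conj (u [^] j) a))) = c * e i a"
      by (simp add: e_def sum_distrib_left ac_simps)
    finally show ?thesis .
  qed
  have e_new: "[e i (conj u a) = int q ^ (i * (p - 2)) * e i a] (mod int p)"
    if a: "a \<in> derived_subgroup" for i a
  proof -
    note ac = derived_carrier[OF a]
    define h where "h j = int q ^ (i * j) * lam (conj (u [^] j) a)" for j
    have "conj (u [^] j) (conj u a) = conj (u [^] Suc j) a" for j :: nat
      using conj_conj[of "u [^] j" u a] u ac by simp
    then have "int q ^ i * e i (conj u a) = (\<Sum>j<p - 1. h (Suc j))"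
      unfolding e_def h_def by (simp add: sum_distrib_left power_add mult.assoc)
    also have "\<dots> = e i a + (h (p - 1) - h 0)"
      using sum.lessThan_Suc_shift[of h "p - 1"] by (simp add: e_def h_def)
    also have "[\<dots> = e i a + (h 0 - h 0)] (mod int p)"
    proof (intro cong_add cong_diff)
      have "[(int q ^ (p - 1)) ^ i * lam (conj (u [^] (p - 1)) a) = 1 ^ i * lam a] (mod int p)"
        by (intro cong_mult cong_pow Q.q_power_cong_1 additive_conj_power[OF p add a u])
      then show "[h (p - 1) = h 0] (mod int p)"
        using ac by (simp add: h_def mult.commute flip: power_mult)
    qed auto
    finally have *: "[int q ^ i * e i (conj u a) = e i a] (mod int p)"
      by simp
    have "[(int q ^ (p - 2) * int q) ^ i * e i (conj u a) = 1 ^ i * e i (conj u a)] (mod int p)"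
      by (intro cong_mult cong_pow Q.q_inverse) simp
    moreover have "(int q ^ (p - 2) * int q) ^ i = int q ^ (i * (p - 2)) * int q ^ i"
      by (simp only: power_mult_distrib power_mult[symmetric] mult.commute[of i])
    ultimately have "[int q ^ (i * (p - 2)) * (int q ^ i * e i (conj u a)) = e i (conj u a)] (mod int p)"
      by (simp only: mult.assoc power_one mult_1)
    then have "[e i (conj u a) = int q ^ (i * (p - 2)) * (int q ^ i * e i (conj u a))] (mod int p)"
      by (rule cong_sym)
    also have "[int q ^ (i * (p - 2)) * (int q ^ i * e i (conj u a)) = int q ^ (i * (p - 2)) * e i a] (mod int p)"
      by (intro cong_mult *) simp
    finally show ?thesis .
  qed
  have "\<exists>i<p - 1. \<not> [e i g = 0] (mod int p)"
  proof (rule ccontr)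
    assume "\<not> ?thesis"
    then have zero: "[(\<Sum>i<p - 1. e i g) = (\<Sum>i<p - 1. 0)] (mod int p)"
      by (intro cong_sum) auto
    have total: "[(\<Sum>i<p - 1. e i g) = int (p - 1) * lam g] (mod int p)"
    proof -
      have "(\<Sum>i<p - 1. e i g) = (\<Sum>j<p - 1. (\<Sum>i<p - 1. int q ^ (i * j)) * lam (conj (u [^] j) g))"
        unfolding e_def by (subst sum.swap) (simp add: sum_distrib_right)
      also have "[\<dots> = (\<Sum>j<p - 1. (if j = 0 then int (p - 1) * lam g else 0))] (mod int p)"
      proof (intro cong_sum)
        fix j assume j: "j \<in> {..<p - 1}"
        show "[(\<Sum>i<p - 1. int q ^ (i * j)) * lam (conj (u [^] j) g) = (if j = 0 then int (p - 1) * lam g else 0)] (mod int p)"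
        proof (cases "j = 0")
          case False
          then have "[(\<Sum>i<p - 1. int q ^ (i * j)) = 0] (mod int p)"
            using j by (intro primroot_power_sum[OF p q]) auto
          from cong_mult[OF this cong_refl, of "lam (conj (u [^] j) g)"] False show ?thesis
            by simp
        qed (use derived_carrier[OF g] in simp)
      qed
      also have "(\<Sum>j<p - 1. (if j = 0 then int (p - 1) * lam g else 0)) = int (p - 1) * lam g"
        using Q.p_gt_1 by (simp add: sum.delta)
      finally show ?thesis .
    qed
    have "[int (p - 1) * lam g = 0] (mod int p)"
      using cong_trans[OF cong_sym[OF total] zero] by simp
    then have "int p dvd int (p - 1) * lam g"
      by (simp add: cong_0_iff)
    moreover have "coprime (int p) (int (p - 1))"
      using coprime_diff_one_left_nat[of p] Q.p_gt_1 by (simp add: coprime_commute)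
    ultimately have "int p dvd lam g"
      by (simp add: coprime_dvd_mult_right_iff)
    with nz show False
      by (simp add: cong_0_iff)
  qed
  then obtain i where i: "\<not> [e i g = 0] (mod int p)"
    by blast
  show ?thesis
  proof (intro exI[of _ "e i"] conjI ballI)
    fix v assume "v \<in> insert u S"
    then consider "v = u" | "v \<in> S" by blast
    then show "\<exists>c. \<forall>a\<in>derived_subgroup. [e i (conj v a) = c * e i a] (mod int p)"
    proof cases
      case 1
      then show ?thesis using e_new by blast
    next
      case 2
      then obtain c where "\<forall>a\<in>derived_subgroup. [lam (conj v a) = c * lam a] (mod int p)"
        using eigen by blast
      then show ?thesis
        using e_old[of v c] S 2 by blast
    qed
  qed (use e_add e_kills i in auto)
qed

text \<open>
  The normal subgroup \<open>N\<close> is carried along for the analysis of chief factors; for the embedding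
  theorem it is trivial.
\<close>

lemma equivariant_character:
  assumes N: "N \<lhd> G" "N \<subseteq> derived_subgroup" and g: "g \<in> derived_subgroup" "g \<notin> N"
  obtains p lam chi where "Factorial_Ring.prime p" "additive_mod (int p) G derived_subgroup lam"
    "\<forall>x\<in>N. [lam x = 0] (mod int p)" "\<not> [lam g = 0] (mod int p)"
    "\<forall>u\<in>carrier G. \<forall>a\<in>derived_subgroup. [lam (conj u a) = chi u * lam a] (mod int p)"
proof -
  obtain p lam where p: "Factorial_Ring.prime p" and lam: "additive_mod (int p) G derived_subgroup lam"
    "\<forall>x\<in>N. [lam x = 0] (mod int p)" "\<not> [lam g = 0] (mod int p)"
    using derived_character[OF normal_imp_subgroup[OF N(1)] N(2) g] .
  have "\<exists>mu. additive_mod (int p) G derived_subgroup mu \<and>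
    (\<forall>x\<in>N. [mu x = 0] (mod int p)) \<and> \<not> [mu g = 0] (mod int p) \<and>
    (\<forall>v\<in>S. \<exists>c. \<forall>a\<in>derived_subgroup. [mu (conj v a) = c * mu a] (mod int p))"
    if "finite S" "S \<subseteq> carrier G" for S
    using that
  proof (induction S)
    case empty
    then show ?case using lam by blast
  next
    case (insert u S)
    then obtain mu where "additive_mod (int p) G derived_subgroup mu"
      "\<forall>x\<in>N. [mu x = 0] (mod int p)" "\<not> [mu g = 0] (mod int p)"
      "\<forall>v\<in>S. \<exists>c. \<forall>a\<in>derived_subgroup. [mu (conj v a) = c * mu a] (mod int p)"
      by auto
    then show ?case
      using insert.prems by (intro split_eigencharacter[OF p N g(1)]) auto
  qed
  from this[OF fin subset_refl] obtain mu where mu: "additive_mod (int p) G derived_subgroup mu"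
    "\<forall>x\<in>N. [mu x = 0] (mod int p)" "\<not> [mu g = 0] (mod int p)"
    "\<forall>v\<in>carrier G. \<exists>c. \<forall>a\<in>derived_subgroup. [mu (conj v a) = c * mu a] (mod int p)"
    by blast
  from bchoice[OF mu(4)] obtain chi where
    "\<forall>u\<in>carrier G. \<forall>a\<in>derived_subgroup. [mu (conj u a) = chi u * mu a] (mod int p)"
    by blast
  with p mu show ?thesis
    using that by blast
qed

end

context law_group
begin

text \<open>
  For an invariant character, \<open>(x, y) \<mapsto> lam [x, y]\<close> is additive in both arguments. So
  \<open>s^3 lam [x, y]\<close> equals the value at \<open>[x^s, y^s]^s\<close>, which is zero by the last law.
\<close>

lemma invariant_character_trivial:
  assumes p: "Factorial_Ring.prime p" and add: "additive_mod (int p) G derived_subgroup lam"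
    and inv: "\<forall>u\<in>carrier G. \<forall>a\<in>derived_subgroup. [lam (conj u a) = lam a] (mod int p)"
    and g: "g \<in> derived_subgroup"
  shows "[lam g = 0] (mod int p)"
proof -
  note D = derived_subgroup_subgroup
  obtain s where s: "coprime s p"
    "\<forall>x\<in>carrier G. \<forall>y\<in>carrier G. gcomm G (x [^] s) (y [^] s) [^] s = \<one>"
    by (rule law_exponent[OF p])
  have left: "[lam (gcomm G (v \<otimes> w) u) = lam (gcomm G w u) + lam (gcomm G v u)] (mod int p)"
    if "u \<in> carrier G" "v \<in> carrier G" "w \<in> carrier G" for u v w
  proof -
    have "[lam (gcomm G (v \<otimes> w) u) = lam (conj v (gcomm G w u)) + lam (gcomm G v u)] (mod int p)"
      unfolding gcomm_mult_left[OF that]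
      by (intro additive_modD[OF add] derived_conj_closed gcomm_in_derived that)
    also have "[lam (conj v (gcomm G w u)) + lam (gcomm G v u) = lam (gcomm G w u) + lam (gcomm G v u)] (mod int p)"
      using inv that by (intro cong_add) (auto intro: gcomm_in_derived)
    finally show ?thesis .
  qed
  have right: "[lam (gcomm G u (v \<otimes> w)) = lam (gcomm G u v) + lam (gcomm G u w)] (mod int p)"
    if "u \<in> carrier G" "v \<in> carrier G" "w \<in> carrier G" for u v w
  proof -
    have "[lam (gcomm G u (v \<otimes> w)) = lam (gcomm G u v) + lam (conj v (gcomm G u w))] (mod int p)"
      unfolding gcomm_mult_right[OF that]
      by (intro additive_modD[OF add] derived_conj_closed gcomm_in_derived that)
    also have "[lam (gcomm G u v) + lam (conj v (gcomm G u w)) = lam (gcomm G u v) + lam (gcomm G u w)] (mod int p)"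
      using inv that by (intro cong_add) (auto intro: gcomm_in_derived)
    finally show ?thesis .
  qed
  have one: "[lam \<one> = 0] (mod int p)"
    by (rule additive_mod_one[OF add D])
  have lpow: "[lam (gcomm G (x [^] (n::nat)) y) = int n * lam (gcomm G x y)] (mod int p)"
    if "x \<in> carrier G" "y \<in> carrier G" for x y n
    by (rule additive_mod_pow[OF _ subgroup_self, of "int p" "\<lambda>x. lam (gcomm G x y)"])
      (use left[OF that(2)] that in \<open>auto simp: additive_mod_def add.commute\<close>)
  have rpow: "[lam (gcomm G x (y [^] (n::nat))) = int n * lam (gcomm G x y)] (mod int p)"
    if "x \<in> carrier G" "y \<in> carrier G" for x y n
    by (rule additive_mod_pow[OF _ subgroup_self, of "int p" "\<lambda>y. lam (gcomm G x y)"])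
      (use right[OF that(1)] that in \<open>auto simp: additive_mod_def\<close>)
  have "[lam (gcomm G x y) = 0] (mod int p)" if xy: "x \<in> carrier G" "y \<in> carrier G" for x y
  proof -
    have c: "gcomm G (x [^] s) (y [^] s) \<in> derived_subgroup"
      using xy by (intro gcomm_in_derived) auto
    have "[int s * (int s * (int s * lam (gcomm G x y))) = int s * (int s * lam (gcomm G x (y [^] s)))] (mod int p)"
      by (intro cong_mult cong_refl cong_sym[OF rpow] xy)
    also have "[int s * (int s * lam (gcomm G x (y [^] s))) = int s * lam (gcomm G (x [^] s) (y [^] s))] (mod int p)"
      using xy by (intro cong_mult cong_refl cong_sym[OF lpow]) auto
    also have "[int s * lam (gcomm G (x [^] s) (y [^] s)) = lam (gcomm G (x [^] s) (y [^] s) [^] s)] (mod int p)"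
      by (rule cong_sym[OF additive_mod_pow[OF add D c]])
    also have "gcomm G (x [^] s) (y [^] s) [^] s = \<one>"
      by (rule bspec[OF bspec[OF s(2) xy(1)] xy(2)])
    also note one
    finally have "int p dvd int s * (int s * (int s * lam (gcomm G x y)))"
      by (simp only: cong_0_iff)
    moreover have "coprime (int p) (int s)"
      using s(1) by (simp add: coprime_commute)
    ultimately show ?thesis
      by (simp add: cong_0_iff coprime_dvd_mult_right_iff)
  qed
  then have "derived_subgroup \<subseteq> {a \<in> derived_subgroup. [lam a = 0] (mod int p)}"
    by (intro derived_subgroup_least[OF character_kernel_subgroup[OF add D]]) (simp add: gcomm_in_derived)
  with g show ?thesis by blast
qed

text \<open>
  The prime divides the group order, because a group of order prime to \<open>p\<close> has no nonzero character
  modulo \<open>p\<close>.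
\<close>

lemma derived_separated_by_affine_rep:
  assumes g: "g \<in> derived_subgroup" "g \<noteq> \<one>"
  obtains p f chi where "affine_group G p f chi" "p dvd order G" "\<not> [f g = 0] (mod int p)"
proof -
  note D = derived_subgroup_subgroup
  note gc = derived_carrier[OF g(1)]
  have "{\<one>} \<subseteq> derived_subgroup"
    using subgroup.one_closed[OF D] by simp
  moreover have "g \<notin> {\<one>}"
    using g(2) by simp
  ultimately obtain p lam chi where p: "Factorial_Ring.prime p" and add: "additive_mod (int p) G derived_subgroup lam"
    and "\<forall>x\<in>{\<one>}. [lam x = 0] (mod int p)" and nz: "\<not> [lam g = 0] (mod int p)"
    and eq: "\<forall>u\<in>carrier G. \<forall>a\<in>derived_subgroup. [lam (conj u a) = chi u * lam a] (mod int p)"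
    using equivariant_character[OF one_is_normal _ g(1)] by blast
  have cop: "coprime (lam g) (int p)"
    using nz p by (simp add: cong_0_iff prime_imp_coprime coprime_commute prime_int_nat_transfer)
  have cancel: "[b = c] (mod int p)" if "[b * lam g = c * lam g] (mod int p)" for b c
    using that cop by (simp add: cong_mult_rcancel)
  have chi_mult: "[chi (u \<otimes> v) = chi u * chi v] (mod int p)" if uv: "u \<in> carrier G" "v \<in> carrier G" for u v
  proof (rule cancel)
    have cv: "conj v g \<in> derived_subgroup"
      by (rule derived_conj_closed[OF uv(2) g(1)])
    have "[chi (u \<otimes> v) * lam g = lam (conj (u \<otimes> v) g)] (mod int p)"
      using eq uv g(1) by (intro cong_sym[OF bspec[OF bspec[OF eq]]]) auto
    also have "conj (u \<otimes> v) g = conj u (conj v g)"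
      by (rule conj_conj[OF uv gc])
    also have "[lam (conj u (conj v g)) = chi u * lam (conj v g)] (mod int p)"
      using eq uv(1) cv by blast
    also have "[chi u * lam (conj v g) = chi u * (chi v * lam g)] (mod int p)"
      using eq uv(2) g(1) by (intro cong_mult) auto
    finally show "[chi (u \<otimes> v) * lam g = chi u * chi v * lam g] (mod int p)"
      by (simp add: mult.assoc)
  qed
  have chi_one: "[chi \<one> = 1] (mod int p)"
  proof (rule cancel)
    have "[chi \<one> * lam g = lam (conj \<one> g)] (mod int p)"
      using g(1) by (intro cong_sym[OF bspec[OF bspec[OF eq]]]) auto
    then show "[chi \<one> * lam g = 1 * lam g] (mod int p)"
      using gc by simp
  qed
  have "\<exists>u\<in>carrier G. \<not> [chi u = 1] (mod int p)"
  proof (rule ccontr)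
    assume "\<not> ?thesis"
    then have one: "[chi u * lam a = 1 * lam a] (mod int p)" if "u \<in> carrier G" for u a
      using that by (intro cong_mult) auto
    have "\<forall>u\<in>carrier G. \<forall>a\<in>derived_subgroup. [lam (conj u a) = lam a] (mod int p)"
    proof (intro ballI)
      fix u a assume ua: "u \<in> carrier G" "a \<in> derived_subgroup"
      show "[lam (conj u a) = lam a] (mod int p)"
        using cong_trans[OF bspec[OF bspec[OF eq ua(1)] ua(2)] one[OF ua(1)]] by simp
    qed
    then show False
      using invariant_character_trivial[OF p add _ g(1)] nz by blast
  qed
  then obtain u where u: "u \<in> carrier G" "\<not> [chi u = 1] (mod int p)" by blast
  \<comment> \<open>The identity \<open>[u, v w] = [u, v] (v [u, w] v^(-1))\<close> turns into the cocycle equation.\<close>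
  define f where "f v = lam (gcomm G u v)" for v
  have "affine_rep p G f chi"
    unfolding affine_rep_def
  proof (intro conjI ballI)
    fix v w assume vw: "v \<in> carrier G" "w \<in> carrier G"
    have "[f (v \<otimes> w) = lam (gcomm G u v) + lam (conj v (gcomm G u w))] (mod int p)"
      unfolding f_def gcomm_mult_right[OF u(1) vw]
      by (intro additive_modD[OF add] derived_conj_closed gcomm_in_derived vw u(1))
    also have "[lam (gcomm G u v) + lam (conj v (gcomm G u w)) = f v + chi v * f w] (mod int p)"
      unfolding f_def using eq vw u(1) by (intro cong_add) (auto intro: gcomm_in_derived)
    finally show "[f (v \<otimes> w) = f v + chi v * f w] (mod int p)" .
  qed (use chi_mult chi_one in auto)
  then have "affine_group G p f chi"
    using p by unfold_locales
  moreover have "p dvd order G"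
  proof -
    have "[int (order G) * lam g = lam (g [^] order G)] (mod int p)"
      by (rule cong_sym[OF additive_mod_pow[OF add D g(1)]])
    also have "g [^] order G = \<one>"
      by (rule pow_order_eq_1[OF gc])
    also have "[lam \<one> = 0] (mod int p)"
      by (rule additive_mod_one[OF add D])
    finally have "int p dvd int (order G) * lam g"
      by (simp only: cong_0_iff)
    then show ?thesis
      using cop by (simp add: coprime_dvd_mult_left_iff coprime_commute)
  qed
  moreover have "\<not> [f g = 0] (mod int p)"
  proof
    assume f0: "[f g = 0] (mod int p)"
    have "[chi u * lam g = lam (conj u g)] (mod int p)"
      by (rule cong_sym[OF bspec[OF bspec[OF eq u(1)] g(1)]])
    also have "conj u g = gcomm G u g \<otimes> g"
      using u(1) gc by (simp add: gcomm_def group_word)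
    also have "[lam (gcomm G u g \<otimes> g) = f g + lam g] (mod int p)"
      unfolding f_def by (intro additive_modD[OF add] gcomm_in_derived u(1) gc g(1))
    also have "[f g + lam g = 0 + lam g] (mod int p)"
      using f0 by (intro cong_add) auto
    finally have "[chi u * lam g = 1 * lam g] (mod int p)"
      by simp
    then have "[chi u = 1] (mod int p)"
      by (rule cancel)
    with u(2) show False by simp
  qed
  ultimately show ?thesis
    using that by blast
qed

lemma nonderived_separated_by_character:
  assumes "g \<in> carrier G" "g \<notin> derived_subgroup"
  obtains lam where "additive_mod (int (order G)) G (carrier G) lam" "\<not> [lam g = 0] (mod int (order G))"
  using separating_character[OF fin _ pow_order_eq_1 derived_subgroup_subgroup gcomm_in_derived assms]
    fin order_gt_0_iff_finite that by blast

text \<open>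
  Here the translation part is zero: a character with values modulo \<open>p^k\<close> becomes multiplicative through
  a power of a primitive root modulo a prime \<open>r\<close> for which \<open>p^k\<close> divides \<open>r - 1\<close>.
\<close>

lemma nonderived_separated_by_affine_rep:
  assumes g: "g \<in> carrier G" "g \<notin> derived_subgroup"
  obtains p f chi where "affine_group G p f chi" "\<not> [chi g = 1] (mod int p)"
proof -
  let ?n = "order G"
  obtain lam where lam: "additive_mod (int ?n) G (carrier G) lam" "\<not> [lam g = 0] (mod int ?n)"
    using nonderived_separated_by_character[OF g] .
  have n: "?n > 0"
    using fin order_gt_0_iff_finite by simp
  obtain p k where p: "Factorial_Ring.prime p" and k: "p ^ k dvd ?n" "\<not> int (p ^ k) dvd lam g"
    using prime_power_dvd_not_dvd[OF n lam(2)[unfolded cong_0_iff]] .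
  obtain r where r: "Factorial_Ring.prime r" "p ^ k dvd r - 1"
    using prime_congruent_1_mod_prime_power[OF p] .
  then obtain d where d: "r - 1 = p ^ k * d" by blast
  obtain q where q: "residue_primroot r q"
    using prime_has_primroot[OF r(1)] by blast
  have pk: "p ^ k > 0"
    using prime_gt_0_nat[OF p] by simp
  have d0: "d > 0"
    using d prime_gt_1_nat[OF r(1)] by (intro Nat.gr0I) simp
  define e where "e u = nat (lam u mod int (p ^ k))" for u
  have e: "[int (e u) = lam u] (mod int (p ^ k))" for u
    using pk by (simp add: e_def)
  define chi where "chi u = int q ^ (d * e u)" for u
  have key: "[int q ^ (d * a) = int q ^ (d * b)] (mod int r) \<longleftrightarrow> [a = b] (mod (p ^ k))" for a b
  proof -
    have "[int q ^ (d * a) = int q ^ (d * b)] (mod int r) \<longleftrightarrow> [int (d * a) = int (d * b)] (mod int (d * p ^ k))"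
      unfolding primroot_power_cong_iff[OF r(1) q] cong_int_iff d by (simp add: mult.commute)
    also have "\<dots> \<longleftrightarrow> int d * int (p ^ k) dvd int d * (int a - int b)"
      by (simp add: cong_iff_dvd_diff right_diff_distrib)
    also have "\<dots> \<longleftrightarrow> [int a = int b] (mod int (p ^ k))"
      using d0 by (subst dvd_times_left_cancel_iff) (auto simp: cong_iff_dvd_diff)
    finally show ?thesis
      by (simp only: cong_int_iff)
  qed
  have "affine_rep r G (\<lambda>_. 0) chi"
    unfolding affine_rep_def
  proof (intro conjI ballI)
    fix u v assume uv: "u \<in> carrier G" "v \<in> carrier G"
    have "[lam (u \<otimes> v) = lam u + lam v] (mod int (p ^ k))"
      by (rule cong_dvd_modulus[OF additive_modD[OF lam(1) uv]]) (use k(1) in \<open>simp only: int_dvd_int_iff\<close>)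
    with e[of "u \<otimes> v"] have "[int (e (u \<otimes> v)) = lam u + lam v] (mod int (p ^ k))"
      by (rule cong_trans)
    also have "[lam u + lam v = int (e u) + int (e v)] (mod int (p ^ k))"
      by (intro cong_add cong_sym[OF e])
    finally have "[e (u \<otimes> v) = e u + e v] (mod (p ^ k))"
      by (simp only: cong_int_iff flip: of_nat_add)
    then show "[chi (u \<otimes> v) = chi u * chi v] (mod int r)"
      unfolding chi_def power_add[symmetric] distrib_left[symmetric] by (simp only: key)
    show "[(0::int) = 0 + chi u * 0] (mod int r)"
      by simp
  next
    have "[int (e \<one>) = 0] (mod int (p ^ k))"
    proof -
      have "[lam \<one> = 0] (mod int (p ^ k))"
        by (rule cong_dvd_modulus[OF additive_mod_one[OF lam(1) subgroup_self]])
          (use k(1) in \<open>simp only: int_dvd_int_iff\<close>)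
      with e show ?thesis by (rule cong_trans)
    qed
    then have "[int (e \<one>) = int 0] (mod int (p ^ k))"
      by simp
    then have "[e \<one> = 0] (mod (p ^ k))"
      by (simp only: cong_int_iff)
    then show "[chi \<one> = 1] (mod int r)"
      using key[of "e \<one>" 0] by (simp add: chi_def)
  qed
  then have "affine_group G r (\<lambda>_. 0) chi"
    using r(1) by unfold_locales
  moreover have "\<not> [chi g = 1] (mod int r)"
  proof
    assume "[chi g = 1] (mod int r)"
    then have "[e g = 0] (mod (p ^ k))"
      using key[of "e g" 0] by (simp add: chi_def)
    then have "[int (e g) = int 0] (mod int (p ^ k))"
      by (simp only: cong_int_iff)
    then have "[int (e g) = 0] (mod int (p ^ k))"
      by simp
    from cong_trans[OF cong_sym[OF e] this] have "[lam g = 0] (mod int (p ^ k))" .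
    with k(2) show False
      by (simp add: cong_0_iff)
  qed
  ultimately show ?thesis
    using that by blast
qed

end

section \<open>Copies on the natural numbers\<close>

text \<open>
  Pseudovarieties consist of groups on the natural numbers, so groups on other types enter through copies.
\<close>

lemma nat_copy:
  assumes "group G" "finite (carrier G)"
  obtains H :: "nat monoid" where "group H" "finite (carrier H)" "G \<cong> H"
proof -
  obtain f :: "'a \<Rightarrow> nat" where f: "inj_on f (carrier G)"
    using finite_imp_inj_to_nat_seg[OF assms(2)] by blast
  have "finite (carrier (image_group f G))"
    using assms(2) by (simp add: image_group_carrier)
  then show ?thesis
    using that group.inj_imp_image_group_is_group[OF assms(1) f] inj_imp_image_group_iso[OF f]
      is_isoI by blast
qed

lemma iso_sym_group:
  assumes "group G" "G \<cong> H" shows "H \<cong> G"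
  using assms group.iso_set_sym unfolding is_iso_def by blast

lemma mon_of_iso: "h \<in> iso G H \<Longrightarrow> h \<in> mon G H"
  by (simp add: iso_iff_mon_epi)

lemma obeys_laws_iso:
  assumes "group G" "group H" "G \<cong> H" shows "obeys_laws G \<longleftrightarrow> obeys_laws H"
proof -
  obtain h where "h \<in> iso G H"
    using assms(3) by (auto simp: is_iso_def)
  moreover obtain k where "k \<in> iso H G"
    using iso_sym_group[OF assms(1,3)] by (auto simp: is_iso_def)
  ultimately show ?thesis
    using obeys_laws_embedding[OF assms(1,2) mon_of_iso] obeys_laws_embedding[OF assms(2,1) mon_of_iso]
    by blast
qed

section \<open>Separating families of homomorphisms\<close>

lemma family_hom:
  assumes h: "\<And>i. i \<in> I \<Longrightarrow> h i \<in> hom G (F i)"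
  shows "(\<lambda>x. \<lambda>i\<in>I. h i x) \<in> hom G (product_group I F)"
proof (rule homI)
  show "(\<lambda>i\<in>I. h i x) \<in> carrier (product_group I F)" if "x \<in> carrier G" for x
    using that hom_in_carrier[OF h] by simp
  show "(\<lambda>i\<in>I. h i (x \<otimes>\<^bsub>G\<^esub> y)) = (\<lambda>i\<in>I. h i x) \<otimes>\<^bsub>product_group I F\<^esub> (\<lambda>i\<in>I. h i y)"
    if "x \<in> carrier G" "y \<in> carrier G" for x y
    using that hom_mult[OF h] by (auto simp: restrict_def)
qed

lemma separating_family_mon:
  assumes G: "group G" and F: "\<And>i. i \<in> I \<Longrightarrow> group (F i)"
    and h: "\<And>i. i \<in> I \<Longrightarrow> h i \<in> hom G (F i)"
    and sep: "\<And>g. g \<in> carrier G \<Longrightarrow> g \<noteq> \<one>\<^bsub>G\<^esub> \<Longrightarrow> \<exists>i\<in>I. h i g \<noteq> \<one>\<^bsub>F i\<^esub>"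
  shows "(\<lambda>x. \<lambda>i\<in>I. h i x) \<in> mon G (product_group I F)"
proof -
  let ?h = "\<lambda>x. \<lambda>i\<in>I. h i x"
  have hom: "?h \<in> hom G (product_group I F)"
    by (rule family_hom) (rule h)
  interpret group_hom G "product_group I F" ?h
    using G F hom by (simp add: group_hom_def group_hom_axioms_def)
  have "inj_on ?h (carrier G)"
    unfolding inj_iff_trivial_ker kernel_def
  proof (intro equalityI subsetI)
    fix g assume g: "g \<in> {x \<in> carrier G. ?h x = \<one>\<^bsub>product_group I F\<^esub>}"
    show "g \<in> {\<one>\<^bsub>G\<^esub>}"
    proof (rule ccontr)
      assume "g \<notin> {\<one>\<^bsub>G\<^esub>}"
      then obtain i where i: "i \<in> I" "h i g \<noteq> \<one>\<^bsub>F i\<^esub>"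
        using sep g by blast
      have "?h g i = \<one>\<^bsub>product_group I F\<^esub> i"
        using g by simp
      with i show False by simp
    qed
  qed (use hom_one in auto)
  with hom show ?thesis
    by (simp add: mon_def)
qed

lemma pseudovariety_finite_group: "pseudovariety V \<Longrightarrow> F \<in> V \<Longrightarrow> finite_group F"
  unfolding pseudovariety_def by (elim conjE bspec)

lemma pseudovariety_subgroup:
  assumes "pseudovariety V" "F \<in> V" "subgroup H F" shows "F\<lparr>carrier := H\<rparr> \<in> V"
proof -
  have "\<forall>G\<in>V. \<forall>H. subgroup H G \<longrightarrow> G\<lparr>carrier := H\<rparr> \<in> V"
    using assms(1) unfolding pseudovariety_def by (elim conjE)
  then show ?thesis
    using assms(2,3) by simp
qed

lemma pseudovariety_image:
  assumes "pseudovariety V" "F \<in> V" "group H" "h \<in> epi F H" shows "H \<in> V"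
proof -
  have "\<forall>G\<in>V. \<forall>H. group H \<and> epi G H \<noteq> {} \<longrightarrow> H \<in> V"
    using assms(1) unfolding pseudovariety_def by (elim conjE)
  then show ?thesis
    using assms(2-4) by blast
qed

lemma pseudovariety_product:
  assumes "pseudovariety V" "\<And>i. i < n \<Longrightarrow> F i \<in> V" "group H" "H \<cong> product_group {..<n::nat} F"
  shows "H \<in> V"
proof -
  have "\<forall>(n::nat) F. (\<forall>i<n. F i \<in> V) \<longrightarrow> (\<forall>H. group H \<and> H \<cong> product_group {..<n} F \<longrightarrow> H \<in> V)"
    using assms(1) unfolding pseudovariety_def by (elim conjE)
  then have "\<forall>H. group H \<and> H \<cong> product_group {..<n} F \<longrightarrow> H \<in> V"
    using assms(2) by (elim allE[of _ n] allE[of _ F]) simp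
  then show ?thesis
    using assms(3,4) by simp
qed

lemma pseudovariety_iso_closed:
  assumes V: "pseudovariety V" and "F \<in> V" "group H" "F \<cong> H"
  shows "H \<in> V"
proof -
  obtain h where "h \<in> epi F H"
    using assms(4) by (auto simp: is_iso_def iso_iff_mon_epi)
  then show ?thesis
    by (rule pseudovariety_image[OF V assms(2,3)])
qed

lemma pseudovariety_embedding:
  assumes V: "pseudovariety V" and "Q \<in> V" "group (H :: nat monoid)" "h \<in> mon H Q"
  shows "H \<in> V"
proof -
  have Q: "group Q"
    using pseudovariety_finite_group[OF V assms(2)] by (simp add: finite_group_def)
  interpret group_hom H Q h
    using assms(3,4) Q by (simp add: group_hom_def group_hom_axioms_def mon_def)
  have "Q\<lparr>carrier := h ` carrier H\<rparr> \<in> V"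
    by (rule pseudovariety_subgroup[OF V assms(2) img_is_subgroup])
  moreover have "h \<in> iso H (Q\<lparr>carrier := h ` carrier H\<rparr>)"
    using assms(4) by (auto simp: iso_def mon_def hom_def bij_betw_def)
  then have "Q\<lparr>carrier := h ` carrier H\<rparr> \<cong> H"
    by (rule iso_sym_group[OF assms(3) is_isoI])
  ultimately show ?thesis
    using pseudovariety_iso_closed[OF V] assms(3) by blast
qed

text \<open>
  A finite group whose elements are separated by homomorphisms to members of the pseudovariety embeds in
  a finite product of them.
\<close>

lemma pseudovariety_separated:
  assumes V: "pseudovariety V" and K: "group (K :: nat monoid)" "finite (carrier K)"
    and sep: "\<And>g. g \<in> carrier K \<Longrightarrow> g \<noteq> \<one>\<^bsub>K\<^esub> \<Longrightarrow> \<exists>F\<in>V. \<exists>h\<in>hom K F. h g \<noteq> \<one>\<^bsub>F\<^esub>"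
  shows "K \<in> V"
proof -
  let ?S = "carrier K - {\<one>\<^bsub>K\<^esub>}"
  have "\<forall>g\<in>?S. \<exists>F. \<exists>h. F \<in> V \<and> h \<in> hom K F \<and> h g \<noteq> \<one>\<^bsub>F\<^esub>"
  proof
    fix g assume "g \<in> ?S"
    then show "\<exists>F. \<exists>h. F \<in> V \<and> h \<in> hom K F \<and> h g \<noteq> \<one>\<^bsub>F\<^esub>"
      using sep[of g] by blast
  qed
  from bchoice[OF this] obtain F where "\<forall>g\<in>?S. \<exists>h. F g \<in> V \<and> h \<in> hom K (F g) \<and> h g \<noteq> \<one>\<^bsub>F g\<^esub>" ..
  from bchoice[OF this] obtain h where
    Fh: "\<forall>g\<in>?S. F g \<in> V \<and> h g \<in> hom K (F g) \<and> h g g \<noteq> \<one>\<^bsub>F g\<^esub>" ..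
  obtain gs where gs: "set gs = carrier K - {\<one>\<^bsub>K\<^esub>}"
    using finite_list[of "carrier K - {\<one>\<^bsub>K\<^esub>}"] K(2) by auto
  let ?F = "\<lambda>i. F (gs ! i)" and ?I = "{..<length gs}"
  have i: "F (gs ! i) \<in> V" "h (gs ! i) \<in> hom K (F (gs ! i))" if "i \<in> ?I" for i
  proof -
    have "gs ! i \<in> ?S"
      using that nth_mem[of i gs] by (simp only: gs lessThan_iff)
    with Fh show "F (gs ! i) \<in> V" "h (gs ! i) \<in> hom K (F (gs ! i))"
      by blast+
  qed
  have Fg: "group (?F i)" "finite (carrier (?F i))" if "i \<in> ?I" for i
  proof -
    have "finite_group (?F i)"
      by (rule pseudovariety_finite_group[OF V i(1)[OF that]])
    then show "group (?F i)" "finite (carrier (?F i))"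
      by (simp_all add: finite_group_def)
  qed
  have P: "group (product_group ?I ?F)"
    using Fg by (intro product_group)
  have finP: "finite (carrier (product_group ?I ?F))"
    using Fg(2) by (auto intro!: finite_PiE)
  obtain Q :: "nat monoid" where Q: "group Q" "finite (carrier Q)" "product_group ?I ?F \<cong> Q"
    using nat_copy[OF P finP] .
  have "Q \<in> V"
    by (rule pseudovariety_product[OF V _ Q(1) iso_sym_group[OF P Q(3)]]) (use i(1) in simp)
  moreover have "(\<lambda>x. \<lambda>i\<in>?I. h (gs ! i) x) \<in> mon K (product_group ?I ?F)"
  proof (rule separating_family_mon[OF K(1) Fg(1) i(2)])
    fix g assume "g \<in> carrier K" "g \<noteq> \<one>\<^bsub>K\<^esub>"
    then have g: "g \<in> ?S" by simp
    then have "g \<in> set gs" by (simp only: gs)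
    then obtain j where j: "j < length gs" "gs ! j = g"
      unfolding in_set_conv_nth by blast
    have "h (gs ! j) g \<noteq> \<one>\<^bsub>F (gs ! j)\<^esub>"
      unfolding j(2) using Fh g by blast
    with j(1) show "\<exists>i\<in>?I. h (gs ! i) g \<noteq> \<one>\<^bsub>?F i\<^esub>"
      by blast
  qed
  moreover obtain k where "k \<in> mon (product_group ?I ?F) Q"
    using Q(3) by (auto simp: is_iso_def iso_iff_mon_epi)
  ultimately show ?thesis
    using pseudovariety_embedding[OF V _ K(1)] mon_compose by blast
qed

section \<open>The generators of the join\<close>

text \<open>
  Here and in the next lemma, membership in \<open>Ab(p) * Ab(m)\<close> is translated into statements about elements, which
  avoids the quotient group later on.
\<close>

lemma pv_prod_Ab_expI:
  fixes D :: "nat monoid" (structure) and p m :: nat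
  assumes D: "group D" "finite (carrier D)" and N: "N \<lhd> D"
    and comm: "\<And>x y. x \<in> carrier D \<Longrightarrow> y \<in> carrier D \<Longrightarrow> gcomm D x y \<in> N"
    and pow: "\<And>x. x \<in> carrier D \<Longrightarrow> x [^] m \<in> N"
    and Ncomm: "\<And>x y. x \<in> N \<Longrightarrow> y \<in> N \<Longrightarrow> x \<otimes> y = y \<otimes> x"
    and Nexp: "\<And>x. x \<in> N \<Longrightarrow> x [^] p = \<one>"
  shows "D \<in> Ab_exp p \<star> Ab_exp m"
proof -
  interpret D: group D by fact
  interpret N: normal N D by fact
  have Ns: "subgroup N D" by (rule N.subgroup_axioms)
  have gN: "group (D\<lparr>carrier := N\<rparr>)"
    by (rule subgroup.subgroup_is_group[OF Ns D(1)])
  have cN: "comm_group (D\<lparr>carrier := N\<rparr>)"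
    by (rule group.group_comm_groupI[OF gN]) (simp add: Ncomm)
  have finN: "finite N"
    using D(2) N.subset finite_subset by blast
  have pN: "x [^]\<^bsub>D\<lparr>carrier := N\<rparr>\<^esub> p = \<one>" if "x \<in> N" for x
    using Nexp[OF that] by (simp flip: D.nat_pow_consistent)
  have 1: "D\<lparr>carrier := N\<rparr> \<in> Ab_exp p"
    using gN cN finN pN by (simp add: Ab_exp_def Ab_def finite_group_def)
  have gQ: "group (D Mod N)"
    by (rule N.factorgroup_is_group)
  have finQ: "finite (carrier (D Mod N))"
    using D(2) by (simp add: carrier_FactGroup)
  have "comm_group (D Mod N)"
  proof (rule group.group_comm_groupI[OF gQ])
    fix C Y assume "C \<in> carrier (D Mod N)" "Y \<in> carrier (D Mod N)"
    then obtain x y where xy: "x \<in> carrier D" "y \<in> carrier D" "C = N #> x" "Y = N #> y"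
      by (auto simp: carrier_FactGroup)
    have "C \<otimes>\<^bsub>D Mod N\<^esub> Y = N #> (gcomm D x y \<otimes> (y \<otimes> x))"
      using xy N.rcos_sum by (simp flip: D.mult_eq_gcomm)
    also have "\<dots> = N #> (y \<otimes> x)"
      using xy comm[OF xy(1,2)] N.subset D.coset_join2[OF _ Ns comm[OF xy(1,2)]]
      by (subst D.coset_mult_assoc[symmetric]) auto
    also have "\<dots> = Y \<otimes>\<^bsub>D Mod N\<^esub> C"
      using xy N.rcos_sum by simp
    finally show "C \<otimes>\<^bsub>D Mod N\<^esub> Y = Y \<otimes>\<^bsub>D Mod N\<^esub> C" .
  qed
  moreover have "C [^]\<^bsub>D Mod N\<^esub> m = \<one>\<^bsub>D Mod N\<^esub>" if C: "C \<in> carrier (D Mod N)" for C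
  proof -
    obtain x where x: "x \<in> carrier D" "C = N #> x"
      using C by (auto simp: carrier_FactGroup)
    then have "C [^]\<^bsub>D Mod N\<^esub> m = N #> (x [^] m)"
      using N.FactGroup_pow by simp
    also have "\<dots> = N"
      using x(1) by (intro D.coset_join2 Ns pow) auto
    finally show ?thesis by simp
  qed
  moreover obtain Q :: "nat monoid" where Q: "group Q" "finite (carrier Q)" "D Mod N \<cong> Q"
    using nat_copy[OF gQ finQ] .
  ultimately have "Q \<in> Ab_exp m"
  proof -
    assume c: "comm_group (D Mod N)"
      and e: "\<And>C. C \<in> carrier (D Mod N) \<Longrightarrow> C [^]\<^bsub>D Mod N\<^esub> m = \<one>\<^bsub>D Mod N\<^esub>"
    obtain h where h: "h \<in> iso (D Mod N) Q"
      using Q(3) by (auto simp: is_iso_def)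
    interpret h: group_hom "D Mod N" Q h
      using gQ Q(1) h by (simp add: group_hom_def group_hom_axioms_def iso_def)
    have im: "h ` carrier (D Mod N) = carrier Q"
      using h by (simp add: iso_iff)
    have "comm_group Q"
    proof (rule group.group_comm_groupI[OF Q(1)])
      fix a b assume "a \<in> carrier Q" "b \<in> carrier Q"
      then obtain C Y where CC: "C \<in> carrier (D Mod N)" "Y \<in> carrier (D Mod N)" "a = h C" "b = h Y"
        unfolding im[symmetric] by blast
      then show "a \<otimes>\<^bsub>Q\<^esub> b = b \<otimes>\<^bsub>Q\<^esub> a"
        using arg_cong[OF comm_groupE(4)[OF c CC(1,2)], of h] h.hom_mult[OF CC(1,2)] h.hom_mult[OF CC(2,1)]
        by simp
    qed
    moreover have "a [^]\<^bsub>Q\<^esub> m = \<one>\<^bsub>Q\<^esub>" if a: "a \<in> carrier Q" for a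
    proof -
      obtain C where C: "C \<in> carrier (D Mod N)" "a = h C"
        using a unfolding im[symmetric] by blast
      then have "a [^]\<^bsub>Q\<^esub> m = h (C [^]\<^bsub>D Mod N\<^esub> m)"
        by (simp only: h.hom_nat_pow)
      then show ?thesis
        by (simp only: e[OF C(1)] h.hom_one)
    qed
    ultimately show ?thesis
      using Q by (simp add: Ab_exp_def Ab_def finite_group_def)
  qed
  then have "in_class (D Mod N) (Ab_exp m)"
    using gQ Q(3) by (auto simp: in_class_def)
  with 1 D N show ?thesis
    by (auto simp: pv_prod_def finite_group_def)
qed

lemma pv_prod_Ab_expD:
  fixes D (structure)
  assumes "D \<in> Ab_exp p \<star> Ab_exp m"
  obtains N where "group D" "finite (carrier D)" "subgroup N D"
    "\<forall>x\<in>carrier D. \<forall>y\<in>carrier D. gcomm D x y \<in> N"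
    "\<forall>x\<in>carrier D. x [^] m \<in> N"
    "\<forall>x\<in>N. \<forall>y\<in>N. x \<otimes> y = y \<otimes> x"
    "\<forall>x\<in>N. x [^] p = \<one>"
proof -
  obtain N where D: "group D" "finite (carrier D)" and N: "N \<lhd> D"
    and NA: "D\<lparr>carrier := N\<rparr> \<in> Ab_exp p" and Q: "in_class (D Mod N) (Ab_exp m)"
    using assms by (auto simp: pv_prod_def finite_group_def)
  interpret D: group D by fact
  interpret N: normal N D by fact
  have Ns: "subgroup N D" by (rule N.subgroup_axioms)
  obtain Q where Q: "Q \<in> Ab_exp m" "D Mod N \<cong> Q"
    using Q by (auto simp: in_class_def)
  then have cQ: "comm_group Q" and eQ: "\<And>a. a \<in> carrier Q \<Longrightarrow> a [^]\<^bsub>Q\<^esub> m = \<one>\<^bsub>Q\<^esub>"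
    by (auto simp: Ab_exp_def Ab_def)
  obtain h where h: "h \<in> iso (D Mod N) Q"
    using Q(2) by (auto simp: is_iso_def)
  interpret h: group_hom "D Mod N" Q h
    using N.factorgroup_is_group comm_group.axioms(2)[OF cQ] h
    by (simp add: group_hom_def group_hom_axioms_def iso_def)
  have inj: "inj_on h (carrier (D Mod N))"
    using h by (simp add: iso_iff)
  have co: "N #> x \<in> carrier (D Mod N)" if "x \<in> carrier D" for x
    using that by (simp add: carrier_FactGroup)
  have "gcomm D x y \<in> N" if xy: "x \<in> carrier D" "y \<in> carrier D" for x y
  proof -
    have "h ((N #> x) \<otimes>\<^bsub>D Mod N\<^esub> (N #> y)) = h ((N #> y) \<otimes>\<^bsub>D Mod N\<^esub> (N #> x))"
      unfolding h.hom_mult[OF co[OF xy(1)] co[OF xy(2)]] h.hom_mult[OF co[OF xy(2)] co[OF xy(1)]]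
      by (rule comm_groupE(4)[OF cQ h.hom_closed[OF co[OF xy(1)]] h.hom_closed[OF co[OF xy(2)]]])
    then have "(N #> x) \<otimes>\<^bsub>D Mod N\<^esub> (N #> y) = (N #> y) \<otimes>\<^bsub>D Mod N\<^esub> (N #> x)"
      by (rule inj_onD[OF inj]) (intro h.G.m_closed co xy)+
    then have "N #> (x \<otimes> y) = N #> (y \<otimes> x)"
      using xy N.rcos_sum by simp
    then have "x \<otimes> y \<in> N #> (y \<otimes> x)"
      using D.rcos_self[OF _ Ns, of "x \<otimes> y"] xy by simp
    then obtain n where n: "n \<in> N" "x \<otimes> y = n \<otimes> (y \<otimes> x)"
      by (auto simp: r_coset_def)
    have nc: "n \<in> carrier D"
      using n(1) by simp
    have "gcomm D x y \<otimes> (y \<otimes> x) = n \<otimes> (y \<otimes> x)"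
      using D.mult_eq_gcomm[OF xy] n(2) by simp
    then have "gcomm D x y = n"
      using xy nc by simp
    with n(1) show ?thesis by simp
  qed
  moreover have "x [^] m \<in> N" if x: "x \<in> carrier D" for x
  proof -
    have "h ((N #> x) [^]\<^bsub>D Mod N\<^esub> m) = h \<one>\<^bsub>D Mod N\<^esub>"
      unfolding h.hom_nat_pow[OF co[OF x]] h.hom_one by (rule eQ[OF h.hom_closed[OF co[OF x]]])
    then have "(N #> x) [^]\<^bsub>D Mod N\<^esub> m = \<one>\<^bsub>D Mod N\<^esub>"
      by (rule inj_onD[OF inj]) (intro h.G.nat_pow_closed h.G.one_closed co x)+
    then have "N #> (x [^] m) = N"
      using N.FactGroup_pow[OF x] by simp
    then show ?thesis
      by (rule D.coset_join1) (use x Ns in auto)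
  qed
  moreover have "comm_group (D\<lparr>carrier := N\<rparr>)" "\<And>x. x \<in> N \<Longrightarrow> x [^]\<^bsub>D\<lparr>carrier := N\<rparr>\<^esub> p = \<one>"
    using NA by (auto simp: Ab_exp_def Ab_def)
  ultimately show ?thesis
    using that[OF D Ns] comm_groupE(4)[of "D\<lparr>carrier := N\<rparr>"] by (simp flip: D.nat_pow_consistent)
qed

lemma obeys_laws_pv_prod:
  assumes p: "Factorial_Ring.prime p" and D: "D \<in> Ab_exp p \<star> Ab_exp (p - 1)"
  shows "finite_group D \<and> obeys_laws D"
proof -
  obtain N where N: "group D" "finite (carrier D)" "subgroup N D"
    "\<forall>x\<in>carrier D. \<forall>y\<in>carrier D. gcomm D x y \<in> N"
    "\<forall>x\<in>carrier D. x [^]\<^bsub>D\<^esub> (p - 1) \<in> N"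
    "\<forall>x\<in>N. \<forall>y\<in>N. x \<otimes>\<^bsub>D\<^esub> y = y \<otimes>\<^bsub>D\<^esub> x"
    "\<forall>x\<in>N. x [^]\<^bsub>D\<^esub> p = \<one>\<^bsub>D\<^esub>"
    using pv_prod_Ab_expD[OF D] .
  have "obeys_laws D"
    by (rule group.obeys_laws_if_abelian_of_prime_exponent[OF N(1) p N(3)]) (use N in auto)
  with N show ?thesis
    by (simp add: finite_group_def)
qed

lemma \<U>_obeys_laws:
  assumes "H \<in> \<U>" shows "finite_group H \<and> obeys_laws H"
proof -
  have "\<forall>W\<in>{Ab_exp p \<star> Ab_exp (p - 1) | p. Factorial_Ring.prime p}.
      W \<subseteq> {G. finite_group G \<and> obeys_laws G}"
    using obeys_laws_pv_prod by blast
  then show ?thesis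
    using assms pseudovariety_obeys_laws unfolding \<U>_def pv_join_def by blast
qed

lemma (in faithful_affine_group) in_pv_prod:
  fixes D :: "nat monoid"
  assumes D: "group D" "finite (carrier D)" and h: "h \<in> iso D G"
  shows "D \<in> Ab_exp p \<star> Ab_exp (p - 1)"
proof -
  interpret h: group_hom D G h
    using D h by (simp add: group_hom_def group_hom_axioms_def iso_def is_group)
  have rep: "affine_rep p D (f \<circ> h) (chi \<circ> h)"
    unfolding affine_rep_def using f_mult chi_mult chi_one by simp
  interpret D: faithful_affine_group D p "f \<circ> h" "chi \<circ> h"
  proof
    fix u assume u: "u \<in> carrier D" "[(f \<circ> h) u = 0] (mod int p)" "[(chi \<circ> h) u = 1] (mod int p)"
    then have "h u = h \<one>\<^bsub>D\<^esub>"
      using faithful[of "h u"] by simp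
    moreover have "inj_on h (carrier D)"
      using h by (simp add: iso_iff)
    ultimately show "u = \<one>\<^bsub>D\<^esub>"
      using u(1) inj_onD[of h "carrier D" u "\<one>\<^bsub>D\<^esub>"] by simp
  qed (rule prime, rule rep)
  have "D.chi_kernel \<lhd> D"
    unfolding h.G.normal_inv_iff
  proof (intro conjI ballI)
    fix x n assume x: "x \<in> carrier D" and n: "n \<in> D.chi_kernel"
    have nc: "n \<in> carrier D"
      by (rule D.chi_kernel_carrier[OF n])
    have "x \<otimes>\<^bsub>D\<^esub> n \<otimes>\<^bsub>D\<^esub> inv\<^bsub>D\<^esub> x = gcomm D x n \<otimes>\<^bsub>D\<^esub> n"
      using x nc by (simp add: gcomm_def h.G.group_word)
    then show "x \<otimes>\<^bsub>D\<^esub> n \<otimes>\<^bsub>D\<^esub> inv\<^bsub>D\<^esub> x \<in> D.chi_kernel"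
      using subgroup.m_closed[OF D.subgroup_chi_kernel D.gcomm_chi_kernel[OF x nc] n] by simp
  qed (rule D.subgroup_chi_kernel)
  then show ?thesis
    by (rule pv_prod_Ab_expI[OF D]) (auto intro: D.gcomm_chi_kernel D.pow_chi_kernel[simplified] D.chi_kernel_commute D.chi_kernel_exponent)
qed

lemma (in law_group) separated_by_metacyclic:
  assumes q: "\<And>p. Factorial_Ring.prime p \<Longrightarrow> residue_primroot p (q p)"
    and g: "g \<in> carrier G" "g \<noteq> \<one>"
  shows "\<exists>p h. Factorial_Ring.prime p \<and> (g \<in> derived_subgroup \<longrightarrow> p dvd order G) \<and>
    h \<in> hom G (metacyclic p (q p)) \<and> h g \<noteq> \<one>\<^bsub>metacyclic p (q p)\<^esub>"
proof -
  obtain p f chi where A: "affine_group G p f chi" "g \<in> derived_subgroup \<longrightarrow> p dvd order G"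
    and nt: "\<not> ([f g = 0] (mod int p) \<and> [chi g = 1] (mod int p))"
  proof (cases "g \<in> derived_subgroup")
    case True
    obtain p f chi where "affine_group G p f chi" "p dvd order G" "\<not> [f g = 0] (mod int p)"
      using derived_separated_by_affine_rep[OF True g(2)] .
    then show ?thesis
      using that by blast
  next
    case False
    obtain p f chi where "affine_group G p f chi" "\<not> [chi g = 1] (mod int p)"
      using nonderived_separated_by_affine_rep[OF g(1) False] .
    then show ?thesis
      using that False by blast
  qed
  have p: "Factorial_Ring.prime p"
    by (rule affine_group.prime[OF A(1)])
  interpret M: metacyclic_presentation p "q p"
    by standard (use p q in auto)
  obtain h where "h \<in> hom G (metacyclic p (q p))" "h g \<noteq> \<one>\<^bsub>metacyclic p (q p)\<^esub>"
    using M.affine_rep_separates[OF A(1) g(1) nt] .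
  with p A(2) show ?thesis by blast
qed

lemma obeys_laws_in_\<U>:
  fixes H :: "nat monoid"
  assumes H: "group H" "finite (carrier H)" "obeys_laws H"
  shows "H \<in> \<U>"
  unfolding \<U>_def pv_join_def
proof (intro InterI, clarify)
  fix V assume V: "pseudovariety V"
    and gen: "\<forall>W\<in>{Ab_exp p \<star> Ab_exp (p - 1) | p. Factorial_Ring.prime p}. W \<subseteq> V"
  interpret law_group H
    using H by (simp add: law_group_def law_group_axioms_def)
  have "\<exists>q. \<forall>p. Factorial_Ring.prime p \<longrightarrow> residue_primroot p (q p)"
    using prime_has_primroot by (intro choice) blast
  then obtain q where q: "\<And>p. Factorial_Ring.prime p \<Longrightarrow> residue_primroot p (q p)"
    by blast
  show "H \<in> V"
  proof (rule pseudovariety_separated[OF V H(1,2)])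
    fix g assume g: "g \<in> carrier H" "g \<noteq> \<one>\<^bsub>H\<^esub>"
    obtain p h where p: "Factorial_Ring.prime p" and h: "h \<in> hom H (metacyclic p (q p))"
      "h g \<noteq> \<one>\<^bsub>metacyclic p (q p)\<^esub>"
      using separated_by_metacyclic[of q, OF q g] by blast
    interpret M: metacyclic_presentation p "q p"
      by standard (use p q in auto)
    obtain D :: "nat monoid" where D: "group D" "finite (carrier D)" "metacyclic p (q p) \<cong> D"
      using nat_copy[OF M.is_group M.finite_metacyclic] .
    obtain k where k: "k \<in> iso D (metacyclic p (q p))"
      using iso_sym_group[OF M.is_group D(3)] by (auto simp: is_iso_def)
    obtain k' where k': "k' \<in> iso (metacyclic p (q p)) D"
      using D(3) by (auto simp: is_iso_def)
    have "D \<in> V"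
      using M.in_pv_prod[OF D(1,2) k] gen p by blast
    moreover have "k' \<in> hom (metacyclic p (q p)) D"
      using k' by (simp add: iso_def)
    then have "k' \<circ> h \<in> hom H D"
      by (rule Group.hom_compose[OF h(1)])
    moreover have "(k' \<circ> h) g \<noteq> \<one>\<^bsub>D\<^esub>"
    proof
      interpret k': group_hom "metacyclic p (q p)" D k'
        using k' D(1) M.is_group by (simp add: group_hom_def group_hom_axioms_def iso_def)
      assume "(k' \<circ> h) g = \<one>\<^bsub>D\<^esub>"
      then have "k' (h g) = k' \<one>\<^bsub>metacyclic p (q p)\<^esub>"
        by simp
      moreover have "inj_on k' (carrier (metacyclic p (q p)))"
        using k' by (simp add: iso_iff)
      ultimately show False
        using h g(1) hom_in_carrier[OF h(1) g(1)] inj_onD[of k' "carrier (metacyclic p (q p))" "h g"]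
        by simp
    qed
    ultimately show "\<exists>F\<in>V. \<exists>h\<in>hom H F. h g \<noteq> \<one>\<^bsub>F\<^esub>"
      by blast
  qed
qed

lemma in_class_\<U>_iff:
  assumes G: "group G" "finite (carrier G)"
  shows "in_class G \<U> \<longleftrightarrow> obeys_laws G"
proof
  assume "in_class G \<U>"
  then obtain H where "H \<in> \<U>" "G \<cong> H"
    by (auto simp: in_class_def)
  then show "obeys_laws G"
    using \<U>_obeys_laws[of H] obeys_laws_iso[OF G(1), of H] by (simp add: finite_group_def)
next
  assume L: "obeys_laws G"
  obtain H :: "nat monoid" where H: "group H" "finite (carrier H)" "G \<cong> H"
    using nat_copy[OF G] .
  then have "H \<in> \<U>"
    using L obeys_laws_iso[OF G(1) H(1,3)] obeys_laws_in_\<U> by blast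
  with G H show "in_class G \<U>"
    by (auto simp: in_class_def)
qed

section \<open>Chief factors, Sylow subgroups and the derived subgroup under the laws\<close>

context group
begin

lemma pow_cong_exponent:
  assumes x: "x \<in> carrier G" "x [^] (n::nat) = \<one>" and ab: "[a = b] (mod n)"
  shows "x [^] (a::nat) = x [^] b"
proof -
  have *: "x [^] c = x [^] (c mod n)" for c :: nat
  proof -
    have "x [^] c = x [^] (n * (c div n)) \<otimes> x [^] (c mod n)"
      using x(1) by (simp add: nat_pow_mult)
    also have "x [^] (n * (c div n)) = \<one>"
      using x by (simp flip: nat_pow_pow)
    finally show ?thesis
      using x(1) by simp
  qed
  show ?thesis
    using ab unfolding cong_def by (subst (1 2) *) simp
qed

lemma int_pow_as_nat_pow:
  assumes x: "x \<in> carrier G" "x [^] (n::nat) = \<one>" and n: "n > 0"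
  shows "x [^] (i::int) = x [^] nat (i mod int n)"
proof -
  have "x [^] i = x [^] (int n * (i div int n)) \<otimes> x [^] (i mod int n)"
    using x(1) by (simp flip: int_pow_mult)
  also have "x [^] (int n * (i div int n)) = (x [^] int n) [^] (i div int n)"
    using x(1) by (simp add: int_pow_pow)
  also have "x [^] int n = \<one>"
    using x(2) by (simp add: int_pow_int)
  finally show ?thesis
    using x(1) n by (simp flip: int_pow_int)
qed

lemma normal_in_subgroup:
  assumes "K \<lhd> G" "subgroup H G" "K \<subseteq> H" shows "K \<lhd> G\<lparr>carrier := H\<rparr>"
proof -
  interpret H: group "G\<lparr>carrier := H\<rparr>"
    by (rule subgroup.subgroup_is_group[OF assms(2) is_group])
  show ?thesis
    unfolding H.normal_inv_iff
    using assms subgroup_incl[OF normal_imp_subgroup[OF assms(1)] assms(2,3)]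
      subgroup.mem_carrier[OF assms(2)] by (simp add: normal_inv_iff)
qed

text \<open>
  The hypothesis says that \<open>a\<close> generates a normal subgroup modulo \<open>K\<close>. By minimality of the chief factor
  that subgroup is all of \<open>H\<close>.
\<close>

lemma cyclic_chief_factorI:
  assumes fin: "finite (carrier G)" and chief: "chief_factor G H K" and a: "a \<in> H" "a \<notin> K"
    and conj: "\<forall>u\<in>carrier G. \<exists>i::nat. \<exists>k\<in>K. conj u a = a [^] i \<otimes> k"
  shows "cyclic_group ((G\<lparr>carrier := H\<rparr>) Mod K)"
proof -
  have H: "H \<lhd> G" and K: "K \<lhd> G" and KH: "K \<subset> H"
    and min: "\<forall>L. L \<lhd> G \<and> K \<subseteq> L \<and> L \<subseteq> H \<longrightarrow> L = K \<or> L = H"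
    using chief unfolding chief_factor_def by auto
  interpret K: normal K G by fact
  note Hs = normal_imp_subgroup[OF H]
  have ac: "a \<in> carrier G"
    using a(1) subgroup.mem_carrier[OF Hs] by simp
  define L where "L = {a [^] i \<otimes> k | (i::nat) k. k \<in> K}"
  have LI: "a [^] i \<otimes> k \<in> L" if "k \<in> K" for i :: nat and k
    using that unfolding L_def by blast
  have Lsub: "subgroup L G"
  proof (rule finite_subgroupI[OF fin])
    show "L \<subseteq> carrier G"
      unfolding L_def using ac by auto
    show "\<one> \<in> L"
      using LI[OF K.one_closed, of 0] by simp
    fix x y assume "x \<in> L" "y \<in> L"
    then obtain i j :: nat and k l where xy: "x = a [^] i \<otimes> k" "y = a [^] j \<otimes> l" "k \<in> K" "l \<in> K"
      unfolding L_def by blast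
    have aj: "a [^] j \<in> carrier G"
      using ac by simp
    have "x \<otimes> y = a [^] (i + j) \<otimes> ((inv (a [^] j) \<otimes> k \<otimes> a [^] j) \<otimes> l)"
      unfolding xy(1,2) using xy(3,4) ac by (simp add: group_word flip: nat_pow_mult)
    moreover have "(inv (a [^] j) \<otimes> k \<otimes> a [^] j) \<otimes> l \<in> K"
      by (rule K.m_closed[OF K.inv_op_closed1[OF aj xy(3)] xy(4)])
    ultimately show "x \<otimes> y \<in> L"
      using LI by simp
  qed
  have KL: "K \<subseteq> L"
  proof
    fix k assume "k \<in> K"
    then show "k \<in> L"
      using LI[of k 0] by simp
  qed
  have "L \<lhd> G"
    unfolding normal_inv_iff
  proof (intro conjI ballI Lsub)
    fix u x assume u: "u \<in> carrier G" and "x \<in> L"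
    then obtain i :: nat and k where x: "x = a [^] i \<otimes> k" "k \<in> K"
      unfolding L_def by blast
    have "conj u x = conj u (a [^] i) \<otimes> conj u k"
      unfolding x(1) using u ac x(2) by (intro conj_mult) auto
    also have "conj u (a [^] i) = conj u a [^] i"
      by (rule conj_pow[OF u ac])
    finally have eq: "conj u x = conj u a [^] i \<otimes> conj u k" .
    have "conj u a \<in> L"
      using conj u unfolding L_def by blast
    then have "conj u a [^] i \<in> L"
      by (rule subgroup_pow_closed[OF Lsub])
    moreover have "conj u k \<in> L"
      using KL K.inv_op_closed2[OF u x(2)] by blast
    ultimately show "conj u x \<in> L"
      unfolding eq by (rule subgroup.m_closed[OF Lsub])
  qed
  moreover have "L \<subseteq> H"
    unfolding L_def using subgroup_pow_closed[OF Hs a(1)] KH subgroup.m_closed[OF Hs] by blast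
  moreover have "a \<in> L"
    using LI[OF K.one_closed, of 1] ac by simp
  ultimately have LH: "L = H"
    using min KL a(2) by blast
  let ?H = "G\<lparr>carrier := H\<rparr>"
  interpret N: normal K ?H
    by (rule normal_in_subgroup[OF K Hs]) (use KH in auto)
  interpret Q: group "?H Mod K"
    by (rule N.factorgroup_is_group)
  have powH: "x [^]\<^bsub>?H\<^esub> (i::nat) = x [^] i" for x i
    by (simp flip: nat_pow_consistent)
  have aQ: "K #> a \<in> carrier (?H Mod K)"
    using a(1) by (auto simp: carrier_FactGroup)
  have pw: "(K #> a) [^]\<^bsub>?H Mod K\<^esub> (int i) = K #> a [^] i" for i
    using N.FactGroup_pow[of a i] a(1) by (simp add: int_pow_int powH)
  have "carrier (?H Mod K) \<subseteq> range (\<lambda>i::int. (K #> a) [^]\<^bsub>?H Mod K\<^esub> i)"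
  proof
    fix C assume "C \<in> carrier (?H Mod K)"
    then obtain h where h: "h \<in> L" "C = K #> h"
      by (auto simp: carrier_FactGroup LH)
    then obtain i :: nat and k where ik: "h = a [^] i \<otimes> k" "k \<in> K"
      unfolding L_def by blast
    have ai: "a [^] i \<in> carrier G"
      using ac by simp
    have "h = conj (a [^] i) k \<otimes> a [^] i"
      unfolding ik(1) using ai ik(2) by (simp add: group_word)
    then have "C = (K #> conj (a [^] i) k) #> a [^] i"
      unfolding h(2) using ai ik(2) K.subset by (subst coset_mult_assoc) auto
    also have "K #> conj (a [^] i) k = K"
      by (rule K.rcos_const[OF is_group K.inv_op_closed2[OF ai ik(2)]])
    finally have "C = (K #> a) [^]\<^bsub>?H Mod K\<^esub> (int i)"
      by (simp only: pw)
    then show "C \<in> range (\<lambda>i::int. (K #> a) [^]\<^bsub>?H Mod K\<^esub> i)"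
      by (rule range_eqI)
  qed
  moreover have "range (\<lambda>i::int. (K #> a) [^]\<^bsub>?H Mod K\<^esub> i) \<subseteq> carrier (?H Mod K)"
    using Q.int_pow_closed[OF aQ] by blast
  ultimately show ?thesis
    unfolding Q.cyclic_group using aQ by blast
qed

end

context law_group
begin

text \<open>
  Either \<open>H / K\<close> is central, and any element of \<open>H\<close> outside \<open>K\<close> generates it; or \<open>H\<close> contains a commutator \<open>c\<close> outside
  \<open>K\<close>. In that case take an equivariant character of the derived subgroup that vanishes on its
  intersection with \<open>K\<close> but not at \<open>c\<close>. The
  part of \<open>H\<close> in its kernel lies in \<open>K\<close> by minimality, so modulo \<open>K\<close> every conjugate of \<open>c\<close> is a power of \<open>c\<close>.
\<close>

lemma chief_factors_cyclic:
  assumes chief: "chief_factor G H K"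
  shows "cyclic_group ((G\<lparr>carrier := H\<rparr>) Mod K)"
proof -
  have H: "H \<lhd> G" and K: "K \<lhd> G" and KH: "K \<subset> H"
    and min: "\<forall>L. L \<lhd> G \<and> K \<subseteq> L \<and> L \<subseteq> H \<longrightarrow> L = K \<or> L = H"
    using chief unfolding chief_factor_def by auto
  interpret K: normal K G by fact
  interpret H: normal H G by fact
  show ?thesis
  proof (cases "\<forall>h\<in>H. \<forall>u\<in>carrier G. gcomm G u h \<in> K")
    case True
    obtain a where a: "a \<in> H" "a \<notin> K"
      using KH by blast
    have "conj u a = a [^] (1::nat) \<otimes> (inv a \<otimes> gcomm G u a \<otimes> a)" if "u \<in> carrier G" for u
      using that a(1) by (simp add: gcomm_def group_word)
    moreover have "inv a \<otimes> gcomm G u a \<otimes> a \<in> K" if "u \<in> carrier G" for u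
      by (rule K.inv_op_closed1) (use True a(1) that in auto)
    ultimately show ?thesis
      by (intro cyclic_chief_factorI[OF fin chief a]) blast
  next
    case False
    then obtain h w where hw: "h \<in> H" "w \<in> carrier G" "gcomm G w h \<notin> K"
      by blast
    define c where "c = gcomm G w h"
    have hc: "h \<in> carrier G"
      using hw(1) by simp
    have cA: "c \<in> derived_subgroup"
      unfolding c_def by (rule gcomm_in_derived[OF hw(2) hc])
    have cH: "c \<in> H"
      unfolding c_def gcomm_def
      by (rule H.m_closed[OF H.inv_op_closed2[OF hw(2,1)] H.m_inv_closed[OF hw(1)]])
    have cK: "c \<notin> K"
      using hw(3) by (simp add: c_def)
    have cc: "c \<in> carrier G"
      by (rule derived_carrier[OF cA])
    note D = derived_subgroup_subgroup
    have N: "K \<inter> derived_subgroup \<lhd> G"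
      unfolding normal_inv_iff
      using subgroups_Inter_pair[OF K.subgroup_axioms D] K.inv_op_closed2 derived_conj_closed by blast
    have NA: "K \<inter> derived_subgroup \<subseteq> derived_subgroup"
      by blast
    have cN: "c \<notin> K \<inter> derived_subgroup"
      using cK by blast
    obtain p lam chi where p: "Factorial_Ring.prime p" and lam: "additive_mod (int p) G derived_subgroup lam"
      and kills: "\<forall>x\<in>K \<inter> derived_subgroup. [lam x = 0] (mod int p)" and nz: "\<not> [lam c = 0] (mod int p)"
      and eq: "\<forall>u\<in>carrier G. \<forall>a\<in>derived_subgroup. [lam (conj u a) = chi u * lam a] (mod int p)"
      using equivariant_character[OF N NA cA cN] .
    define S where "S = H \<inter> {a \<in> derived_subgroup. [lam a = 0] (mod int p)}"
    have S: "subgroup S G"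
      unfolding S_def by (rule subgroups_Inter_pair[OF H.subgroup_axioms character_kernel_subgroup[OF lam D]])
    have Sconj: "conj u x \<in> S" if u: "u \<in> carrier G" and x: "x \<in> S" for u x
    proof -
      have xA: "x \<in> derived_subgroup" and x0: "[lam x = 0] (mod int p)" and xH: "x \<in> H"
        using x by (auto simp: S_def)
      have "[lam (conj u x) = chi u * lam x] (mod int p)"
        using eq u xA by blast
      also have "[chi u * lam x = chi u * 0] (mod int p)"
        by (intro cong_mult x0) simp
      finally show ?thesis
        using H.inv_op_closed2[OF u xH] derived_conj_closed[OF u xA] by (simp add: S_def)
    qed
    interpret second_isomorphism_grp K G S
      by (simp add: second_isomorphism_grp_def second_isomorphism_grp_axioms_def K S)
    let ?L = "K <#> S"
    have Lsub: "subgroup ?L G"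
      by (rule normal_set_mult_subgroup)
    have "?L \<lhd> G"
      unfolding normal_inv_iff
    proof (intro conjI ballI Lsub)
      fix u x assume u: "u \<in> carrier G" and "x \<in> ?L"
      then obtain k m where km: "k \<in> K" "m \<in> S" "x = k \<otimes> m"
        by (auto simp: set_mult_def)
      have "conj u x = conj u k \<otimes> conj u m"
        unfolding km(3) using u km(1) subgroup.mem_carrier[OF S km(2)] by (intro conj_mult) auto
      then show "conj u x \<in> ?L"
        using K.inv_op_closed2[OF u km(1)] Sconj[OF u km(2)] by (auto simp: set_mult_def)
    qed
    moreover have "?L \<subseteq> H"
      using KH H.m_closed by (auto simp: set_mult_def S_def)
    moreover have "c \<notin> ?L"
    proof
      assume "c \<in> ?L"
      then obtain k m where km: "k \<in> K" "m \<in> S" "c = k \<otimes> m"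
        by (auto simp: set_mult_def)
      have mA: "m \<in> derived_subgroup"
        using km(2) by (simp add: S_def)
      have "k = c \<otimes> inv m"
        unfolding km(3) using km(1) derived_carrier[OF mA] by (simp add: group_word)
      then have kA: "k \<in> derived_subgroup"
        using subgroup.m_closed[OF D cA subgroup.m_inv_closed[OF D mA]] by simp
      have "[lam c = lam k + lam m] (mod int p)"
        unfolding km(3) by (rule additive_modD[OF lam kA mA])
      also have "[lam k + lam m = 0 + 0] (mod int p)"
        using kills km(1,2) kA by (intro cong_add) (auto simp: S_def)
      finally show False
        using nz by simp
    qed
    ultimately have "?L = K"
      using min H_contained_in_set_mult cH by blast
    then have SK: "S \<subseteq> K"
      using S_contained_in_set_mult by simp
    have "\<exists>i::nat. \<exists>k\<in>K. conj u c = c [^] i \<otimes> k" if u: "u \<in> carrier G" for u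
    proof -
      define i where "i = nat (chi u mod int p)"
      have i: "[int i = chi u] (mod int p)"
        using prime_gt_0_nat[OF p] by (simp add: i_def)
      let ?k = "inv (c [^] i) \<otimes> conj u c"
      have ciA: "c [^] i \<in> derived_subgroup" and cuA: "conj u c \<in> derived_subgroup"
        by (rule subgroup_pow_closed[OF D cA], rule derived_conj_closed[OF u cA])
      have "[lam ?k = lam (inv (c [^] i)) + lam (conj u c)] (mod int p)"
        by (rule additive_modD[OF lam subgroup.m_inv_closed[OF D ciA] cuA])
      also have "[lam (inv (c [^] i)) + lam (conj u c) = - lam (c [^] i) + chi u * lam c] (mod int p)"
        using eq u cA by (intro cong_add additive_mod_inv[OF lam D ciA]) auto
      also have "[- lam (c [^] i) + chi u * lam c = - (int i * lam c) + int i * lam c] (mod int p)"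
        by (intro cong_add cong_mult cong_sym[OF i] cong_refl)
          (simp only: cong_minus_minus_iff additive_mod_pow[OF lam D cA])
      finally have "[lam ?k = 0] (mod int p)"
        by simp
      moreover have "?k \<in> H"
        by (rule H.m_closed[OF H.m_inv_closed[OF subgroup_pow_closed[OF H.subgroup_axioms cH]] H.inv_op_closed2[OF u cH]])
      moreover have "?k \<in> derived_subgroup"
        by (rule subgroup.m_closed[OF D subgroup.m_inv_closed[OF D ciA] cuA])
      ultimately have "?k \<in> K"
        using SK by (auto simp: S_def)
      moreover have "conj u c = c [^] i \<otimes> ?k"
        using cc u by (simp add: cancel_left_inv)
      ultimately show ?thesis
        by blast
    qed
    then show ?thesis
      by (intro cyclic_chief_factorI[OF fin chief cH cK]) blast
  qed
qed

text \<open>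
  In a \<open>p\<close>-group every element is an \<open>s\<close>-th power, and only the identity has a trivial \<open>s\<close>-th power.
  So the last law makes commutators trivial.
\<close>

lemma sylow_commute:
  assumes p: "Factorial_Ring.prime p" and P: "subgroup P G" "card P = p ^ k" and xy: "x \<in> P" "y \<in> P"
  shows "x \<otimes> y = y \<otimes> x"
proof -
  interpret P: group "G\<lparr>carrier := P\<rparr>"
    by (rule subgroup.subgroup_is_group[OF P(1) is_group])
  have pw: "z [^] (p ^ k) = \<one>" if "z \<in> P" for z
    using P.pow_order_eq_1[of z] that P(2) by (simp add: order_def flip: nat_pow_consistent)
  have Pc: "z \<in> carrier G" if "z \<in> P" for z
    by (rule subgroup.mem_carrier[OF P(1) that])
  obtain s where s: "coprime s p" "\<forall>x\<in>carrier G. \<forall>y\<in>carrier G. gcomm G (x [^] s) (y [^] s) [^] s = \<one>"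
    by (rule law_exponent[OF p])
  have "coprime s (p ^ k)"
    using s(1) by simp
  then obtain t where t: "[s * t = 1] (mod p ^ k)"
    using cong_solve_coprime_nat unfolding One_nat_def by blast
  have st: "z [^] (s * t) = z" if "z \<in> P" for z
    using pow_cong_exponent[OF Pc[OF that] pw[OF that] t] Pc[OF that] by simp
  have root: "(z [^] t) [^] s = z" if "z \<in> P" for z
    using st[OF that] Pc[OF that] by (simp add: nat_pow_pow mult.commute)
  have gP: "gcomm G x y \<in> P"
    unfolding gcomm_def by (intro subgroup.m_closed[OF P(1)] subgroup.m_inv_closed[OF P(1)] xy)
  have "gcomm G ((x [^] t) [^] s) ((y [^] t) [^] s) [^] s = \<one>"
    using s(2) Pc xy by simp
  then have "gcomm G x y [^] s = \<one>"
    by (simp only: root[OF xy(1)] root[OF xy(2)])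
  then have "gcomm G x y = \<one>"
    using st[OF gP] Pc[OF gP] by (simp flip: nat_pow_pow)
  then show ?thesis
    using gcomm_eq_one_iff Pc xy by blast
qed

end

text \<open>
  The characters modulo primes of the derived subgroup separate its elements, which puts it into the
  pseudovariety generated by the groups of prime order.
\<close>

lemma law_group_structure:
  fixes G :: "nat monoid"
  assumes "law_group G"
  shows "G \<in> Su \<inter> Der E \<inter> Syl Ab"
proof -
  interpret law_group G by fact
  have fg: "finite_group G"
    using fin by (simp add: finite_group_def)
  have "G \<in> Su"
    using fg chief_factors_cyclic by (simp add: Su_def)
  moreover have "G \<in> Syl Ab"
  proof -
    have "G\<lparr>carrier := P\<rparr> \<in> Ab" if p: "Factorial_Ring.prime p" and P: "sylow_subgroup p P G" for p P
    proof -
      have Ps: "subgroup P G" "card P = p ^ multiplicity p (order G)"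
        using P by (auto simp: sylow_subgroup_def)
      have gP: "group (G\<lparr>carrier := P\<rparr>)"
        by (rule subgroup.subgroup_is_group[OF Ps(1) is_group])
      have "comm_group (G\<lparr>carrier := P\<rparr>)"
        by (rule group.group_comm_groupI[OF gP]) (use sylow_commute[OF p Ps] in simp)
      moreover have "finite P"
        using finite_subset[OF subgroup.subset[OF Ps(1)] fin] .
      ultimately show ?thesis
        using gP by (simp add: Ab_def finite_group_def)
    qed
    then show ?thesis
      unfolding Syl_def using fg by (intro CollectI conjI allI impI) auto
  qed
  moreover have "G\<lparr>carrier := derived_subgroup\<rparr> \<in> E"
    unfolding E_def pv_generated_def
  proof (intro InterI, clarify)
    fix V :: "nat monoid set"
    assume V: "pseudovariety V" and gen: "{G. group G \<and> Factorial_Ring.prime (order G)} \<subseteq> V"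
    let ?A = "G\<lparr>carrier := derived_subgroup\<rparr>"
    have gA: "group ?A"
      by (rule subgroup.subgroup_is_group[OF derived_subgroup_subgroup is_group])
    show "?A \<in> V"
    proof (rule pseudovariety_separated[OF V gA])
      show "finite (carrier ?A)"
        using finite_subset[OF subgroup.subset[OF derived_subgroup_subgroup] fin] by simp
      fix g assume g: "g \<in> carrier ?A" "g \<noteq> \<one>\<^bsub>?A\<^esub>"
      have g': "g \<in> derived_subgroup" "g \<notin> {\<one>\<^bsub>G\<^esub>}"
        using g by auto
      have one: "{\<one>\<^bsub>G\<^esub>} \<subseteq> derived_subgroup"
        using subgroup.one_closed[OF derived_subgroup_subgroup] by simp
      obtain p lam where p: "Factorial_Ring.prime p" and lam: "additive_mod (int p) G derived_subgroup lam"
        and "\<forall>x\<in>{\<one>\<^bsub>G\<^esub>}. [lam x = 0] (mod int p)" and nz: "\<not> [lam g = 0] (mod int p)"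
        using derived_character[OF triv_subgroup one g'] .
      let ?Z = "integer_mod_group p"
      have p0: "p > 0"
        by (rule prime_gt_0_nat[OF p])
      have "finite (carrier ?Z)"
        using p0 by (simp add: carrier_integer_mod_group)
      then obtain F :: "nat monoid" where F: "group F" "finite (carrier F)" "?Z \<cong> F"
        by (rule nat_copy[OF group_integer_mod_group])
      have "card (carrier F) = p"
        using iso_same_card[OF F(3)] p0 by (simp add: carrier_integer_mod_group)
      then have "F \<in> V"
        using gen F(1) p by (auto simp: order_def)
      moreover obtain k where k: "k \<in> iso ?Z F"
        using F(3) by (auto simp: is_iso_def)
      have h: "(\<lambda>x. lam x mod int p) \<in> hom ?A ?Z"
      proof (rule homI)
        show "lam x mod int p \<in> carrier ?Z" for x
          using p0 by (simp add: carrier_integer_mod_group)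
        show "lam (x \<otimes>\<^bsub>?A\<^esub> y) mod int p = (lam x mod int p) \<otimes>\<^bsub>?Z\<^esub> (lam y mod int p)"
          if "x \<in> carrier ?A" "y \<in> carrier ?A" for x y
          using additive_modD[OF lam, of x y] that by (simp add: cong_def mod_simps)
      qed
      have kh: "k \<in> hom ?Z F"
        using k by (simp add: iso_def)
      have "k \<circ> (\<lambda>x. lam x mod int p) \<in> hom ?A F"
        by (rule Group.hom_compose[OF h kh])
      moreover have "(k \<circ> (\<lambda>x. lam x mod int p)) g \<noteq> \<one>\<^bsub>F\<^esub>"
      proof
        interpret k: group_hom ?Z F k
          using kh F(1) by (simp add: group_hom_def group_hom_axioms_def)
        assume "(k \<circ> (\<lambda>x. lam x mod int p)) g = \<one>\<^bsub>F\<^esub>"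
        then have "k (lam g mod int p) = k \<one>\<^bsub>?Z\<^esub>"
          by (simp only: k.hom_one o_apply)
        moreover have "inj_on k (carrier ?Z)"
          using k by (simp add: iso_iff)
        moreover have "lam g mod int p \<in> carrier ?Z"
          using p0 by (simp add: carrier_integer_mod_group)
        ultimately have "lam g mod int p = \<one>\<^bsub>?Z\<^esub>"
          using inj_onD[of k "carrier ?Z"] k.G.one_closed by blast
        with nz show False
          by (simp add: cong_def)
      qed
      ultimately show "\<exists>F\<in>V. \<exists>h\<in>hom ?A F. h g \<noteq> \<one>\<^bsub>F\<^esub>"
        by blast
    qed
  qed
  ultimately show ?thesis
    using fg by (simp add: Der_def)
qed

section \<open>Sylow subgroups and coprime action\<close>

context group
begin

lemma conj_power_mem:
  assumes N: "N \<lhd> G" and a: "a \<in> N" and x: "x \<in> carrier G"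
  shows "(a \<otimes> x) [^] (j::nat) \<in> N #> x [^] j"
proof (induction j)
  case 0
  then show ?case
    using subgroup.one_closed[OF normal_imp_subgroup[OF N]]
    by (auto simp: r_coset_def intro!: bexI[of _ \<one>])
next
  case (Suc j)
  interpret N: normal N G by fact
  obtain b where b: "b \<in> N" "(a \<otimes> x) [^] j = b \<otimes> x [^] j"
    using Suc by (auto simp: r_coset_def)
  have xj: "x [^] j \<in> carrier G"
    using x by simp
  have "(a \<otimes> x) [^] Suc j = (b \<otimes> conj (x [^] j) a) \<otimes> x [^] Suc j"
    using b a x by (simp add: group_word)
  moreover have "b \<otimes> conj (x [^] j) a \<in> N"
    by (rule N.m_closed[OF b(1) N.inv_op_closed2[OF xj a]])
  ultimately show ?case
    by (auto simp: r_coset_def)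
qed

text \<open>
  All elements of \<open>N P\<close> have \<open>p\<close>-power order, so by Cauchy's theorem \<open>N P\<close> is a \<open>p\<close>-group; comparing
  orders gives \<open>N P = P\<close>.
\<close>

lemma normal_subgroup_exponent_le_sylow:
  assumes p: "Factorial_Ring.prime p" and ord: "order G = p ^ k * m" "coprime m p" "finite (carrier G)"
    and P: "subgroup P G" "card P = p ^ k"
    and N: "N \<lhd> G" and Nexp: "\<forall>a\<in>N. a [^] p = \<one>"
  shows "N \<subseteq> P"
proof -
  interpret N: normal N G by fact
  interpret second_isomorphism_grp N G P
    by (simp add: second_isomorphism_grp_def second_isomorphism_grp_axioms_def N P(1))
  let ?S = "N <#> P"
  have S: "subgroup ?S G"
    by (rule normal_set_mult_subgroup)
  interpret P: group "G\<lparr>carrier := P\<rparr>"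
    by (rule subgroup.subgroup_is_group[OF P(1) is_group])
  interpret S: group "G\<lparr>carrier := ?S\<rparr>"
    by (rule subgroup.subgroup_is_group[OF S is_group])
  have Pc: "z \<in> carrier G" if "z \<in> P" for z
    by (rule subgroup.mem_carrier[OF P(1) that])
  have finS: "finite ?S"
    using finite_subset[OF subgroup.subset[OF S] ord(3)] .
  have pS: "z [^] (p ^ Suc k) = \<one>" if z: "z \<in> ?S" for z
  proof -
    obtain a x where ax: "a \<in> N" "x \<in> P" "z = a \<otimes> x"
      using z by (auto simp: set_mult_def)
    have x1: "x [^] (p ^ k) = \<one>"
      using P.pow_order_eq_1[of x] ax(2) P(2) by (simp add: order_def flip: nat_pow_consistent)
    have "z [^] (p ^ k) \<in> N"
      using conj_power_mem[OF N ax(1) Pc[OF ax(2)], of "p ^ k"] by (auto simp: x1 ax(3) r_coset_def)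
    then have "(z [^] (p ^ k)) [^] p = \<one>"
      using Nexp by blast
    then show ?thesis
      using ax Pc by (simp add: nat_pow_pow mult.commute)
  qed
  have only_p: "r = p" if r: "Factorial_Ring.prime r" "r dvd card ?S" for r
  proof (rule ccontr)
    assume "r \<noteq> p"
    obtain t where t: "card ?S = r ^ 1 * t"
      using r(2) by auto
    obtain Z where Z: "subgroup Z (G\<lparr>carrier := ?S\<rparr>)" "card Z = r ^ 1"
      using sylow_thm[OF r(1) S.is_group, of 1 t] t finS by (auto simp: order_def)
    interpret Z: group "G\<lparr>carrier := Z\<rparr>"
      using subgroup.subgroup_is_group[OF Z(1) S.is_group] by simp
    have "Z \<noteq> {\<one>}"
      using Z(2) prime_gt_1_nat[OF r(1)] by auto
    moreover have "\<one> \<in> Z"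
      using Z.one_closed by simp
    ultimately obtain z where z: "z \<in> Z" "z \<noteq> \<one>"
      by blast
    have zS: "z \<in> ?S"
      using subgroup.subset[OF Z(1)] z(1) by auto
    have zc: "z \<in> carrier G"
      by (rule subgroup.mem_carrier[OF S zS])
    have "z [^] r = \<one>"
      using Z.pow_order_eq_1[of z] z(1) Z(2) by (simp add: order_def flip: nat_pow_consistent)
    then have "ord z dvd r"
      using zc by (simp add: pow_eq_id)
    moreover have "ord z dvd p ^ Suc k"
      using pS[OF zS] zc by (simp only: pow_eq_id)
    moreover have "coprime r (p ^ Suc k)"
      using primes_coprime[OF r(1) p \<open>r \<noteq> p\<close>] by simp
    ultimately have "ord z dvd 1"
      using coprime_common_divisor[of r "p ^ Suc k" "ord z"] by blast
    with ord_eq_1[OF zc] z(2) show False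
      by (simp only: nat_dvd_1_iff_1)
  qed
  obtain j t where jt: "card ?S = p ^ j * t" "\<not> p dvd t"
  proof (rule multiplicity_decompose'[of "card ?S" p])
    show "card ?S \<noteq> 0"
      using subgroup.finite_imp_card_positive[OF S ord(3)] by simp
    show "\<not> is_unit p"
      using p by auto
  qed (use that in auto)
  have "t = 1"
  proof (rule ccontr)
    assume "t \<noteq> 1"
    then obtain r where r: "Factorial_Ring.prime r" "r dvd t"
      using prime_factor_nat by blast
    then show False
      using only_p[of r] jt by auto
  qed
  then have cS: "card ?S = p ^ j"
    using jt by simp
  have "card ?S dvd p ^ k * m"
    unfolding ord(1)[symmetric] lagrange[OF S, symmetric] by (rule dvd_triv_right)
  then have "p ^ j dvd p ^ k"
    unfolding cS using ord(2) by (subst (asm) coprime_dvd_mult_left_iff) (auto simp: coprime_commute)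
  then have "card ?S \<le> card P"
    unfolding cS P(2) by (rule dvd_imp_le) (use prime_gt_0_nat[OF p] in simp)
  then have "P = ?S"
    using S_contained_in_set_mult finS card_seteq by blast
  then show ?thesis
    using H_contained_in_set_mult by simp
qed

text \<open>
  The quotient by \<open>S\<close> is a group whose order divides the index \<open>m\<close> of \<open>P\<close>.
\<close>

lemma index_power_mem:
  assumes fin: "finite (carrier G)" and ord: "order G = n * m" "n > 0"
    and S: "subgroup S G" "derived_subgroup \<subseteq> S" and P: "subgroup P G" "card P = n" "P \<subseteq> S"
    and x: "x \<in> carrier G"
  shows "x [^] m \<in> S"
proof -
  have N: "S \<lhd> G"
    unfolding normal_inv_iff
  proof (intro conjI ballI S(1))
    fix u a assume ua: "u \<in> carrier G" "a \<in> S"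
    then have ac: "a \<in> carrier G"
      using subgroup.mem_carrier[OF S(1)] by blast
    have "conj u a = gcomm G u a \<otimes> a"
      using ua ac by (simp add: gcomm_def group_word)
    then show "conj u a \<in> S"
      using subgroup.m_closed[OF S(1) subsetD[OF S(2) gcomm_in_derived[OF ua(1) ac]] ua(2)] by simp
  qed
  interpret S: normal S G by fact
  interpret GS: group "G\<lparr>carrier := S\<rparr>"
    by (rule subgroup.subgroup_is_group[OF S(1) is_group])
  interpret Q: group "G Mod S"
    by (rule S.factorgroup_is_group)
  define c where "c = order (G Mod S)"
  have "c * card S = n * m"
    using lagrange[OF S(1)] ord(1) by (simp add: c_def order_def FactGroup_def)
  moreover have "n dvd card S"
  proof -
    have "card P dvd order (G\<lparr>carrier := S\<rparr>)"
      unfolding GS.lagrange[OF subgroup_incl[OF P(1) S(1) P(3)], symmetric] by (rule dvd_triv_right)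
    then show ?thesis
      by (simp add: order_def P(2))
  qed
  then obtain d where "card S = n * d" by blast
  ultimately have m: "m = c * d"
    using ord(2) by (simp add: mult.left_commute)
  have C: "S #> x \<in> carrier (G Mod S)"
    using x by (simp add: carrier_FactGroup)
  have "S #> (x [^] c) = S"
    using Q.pow_order_eq_1[OF C] S.FactGroup_pow[OF x] by (simp add: c_def)
  then have "x [^] c \<in> S"
    by (rule coset_join1) (use x S(1) in auto)
  then have "(x [^] c) [^] d \<in> S"
    by (rule subgroup_pow_closed[OF S(1)])
  then show ?thesis
    using x by (simp add: nat_pow_pow m)
qed

lemma exists_minimal_normal:
  assumes fin: "finite (carrier G)" and D: "D \<lhd> G" "D \<noteq> {\<one>}"
  obtains M where "M \<subseteq> D" "chief_factor G M {\<one>}"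
proof -
  let ?P = "\<lambda>L. L \<lhd> G \<and> L \<subseteq> D \<and> L \<noteq> {\<one>}"
  obtain M where M: "?P M" and min: "\<forall>L. ?P L \<longrightarrow> card M \<le> card L"
    using ex_has_least_nat[of ?P D card] D by auto
  have finM: "finite M"
    using M finite_subset[OF subgroup.subset[OF normal_imp_subgroup] fin] by blast
  have "chief_factor G M {\<one>}"
    unfolding chief_factor_def
  proof (intro conjI allI impI)
    show "{\<one>} \<subset> M"
      using M subgroup.one_closed[OF normal_imp_subgroup, of M G] by blast
    fix L assume L: "L \<lhd> G \<and> {\<one>} \<subseteq> L \<and> L \<subseteq> M"
    show "L = {\<one>} \<or> L = M"
    proof (rule disjCI)
      assume "L \<noteq> M"
      then have "card L < card M"
        using L finM psubset_card_mono by blast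
      then have "\<not> ?P L"
        using min by (meson not_le)
      then show "L = {\<one>}"
        using L M by blast
    qed
  qed (use M one_is_normal in auto)
  then show ?thesis
    using M that by blast
qed

lemma cyclic_Mod_one:
  assumes M: "M \<lhd> G" and cyc: "cyclic_group ((G\<lparr>carrier := M\<rparr>) Mod {\<one>})"
  obtains g where "g \<in> M" "\<forall>x\<in>M. \<exists>i::int. x = g [^] i"
proof -
  note Ms = normal_imp_subgroup[OF M]
  let ?M = "G\<lparr>carrier := M\<rparr>"
  have "{\<one>} \<lhd> ?M"
    by (rule normal_in_subgroup[OF one_is_normal Ms]) (simp add: subgroup.one_closed[OF Ms])
  then interpret N: normal "{\<one>}" ?M .
  interpret Q: group "?M Mod {\<one>}"
    by (rule N.factorgroup_is_group)
  have one: "{\<one>} #> x = {x}" if "x \<in> M" for x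
    using subgroup.mem_carrier[OF Ms that] by (simp add: r_coset_def)
  obtain C where C: "C \<in> carrier (?M Mod {\<one>})"
    "carrier (?M Mod {\<one>}) = range (\<lambda>n::int. C [^]\<^bsub>?M Mod {\<one>}\<^esub> n)"
    using cyc unfolding Q.cyclic_group by blast
  obtain g where g: "g \<in> M" "C = {\<one>} #> g"
    using C(1) by (auto simp: carrier_FactGroup)
  have "\<exists>i::int. x = g [^] i" if x: "x \<in> M" for x
  proof -
    have "{\<one>} #> x \<in> carrier (?M Mod {\<one>})"
      using x by (auto simp: carrier_FactGroup)
    then obtain i :: int where "{\<one>} #> x = C [^]\<^bsub>?M Mod {\<one>}\<^esub> i"
      unfolding C(2) by blast
    also have "\<dots> = {\<one>} #> (g [^]\<^bsub>?M\<^esub> i)"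
      using N.FactGroup_int_pow[of g i] g by simp
    also have "g [^]\<^bsub>?M\<^esub> i = g [^] i"
      using int_pow_consistent[OF Ms g(1)] by simp
    finally have "{x} = {g [^] i}"
      using one x subgroup_int_pow_closed[OF Ms g(1)] by simp
    then show ?thesis by blast
  qed
  with g(1) show ?thesis
    using that by blast
qed

text \<open>
  The map \<open>d a = v a v^(-1) a^(-1)\<close> with \<open>v = u^(p - 1)\<close> is a homomorphism, and its image is normal in the
  whole group. If the image is nontrivial, it contains a minimal normal subgroup, which is cyclic of order \<open>p\<close>
  with a generator \<open>g = d a\<close>. As \<open>u\<close> maps \<open>g\<close> to some power \<open>g^c\<close>, Fermat's theorem shows that
  \<open>v\<close> fixes \<open>g\<close>. Therefore \<open>v^j a v^(-j) = g^j a\<close>, and \<open>j = n\<close> gives \<open>g^n = 1\<close>, although \<open>g\<close> has order \<open>p\<close>,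
  which is prime to \<open>n\<close>.
\<close>

lemma power_centralizes_elementary_abelian:
  assumes fin: "finite (carrier G)" and p: "Factorial_Ring.prime p"
    and chief: "\<forall>M. chief_factor G M {\<one>} \<longrightarrow> cyclic_group ((G\<lparr>carrier := M\<rparr>) Mod {\<one>})"
    and A: "A \<lhd> G" "\<forall>a\<in>A. \<forall>b\<in>A. a \<otimes> b = b \<otimes> a" "\<forall>a\<in>A. a [^] p = \<one>"
    and cc: "\<forall>u\<in>carrier G. \<forall>v\<in>carrier G. \<forall>a\<in>A. conj u (conj v a) = conj v (conj u a)"
    and u: "u \<in> carrier G" and n: "coprime n p" "\<forall>a\<in>A. \<forall>v\<in>carrier G. conj (v [^] (n::nat)) a = a"
    and b: "b \<in> A"
  shows "conj (u [^] (p - 1)) b = b"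
proof -
  define v where "v = u [^] (p - 1)"
  have vc: "v \<in> carrier G"
    using u by (simp add: v_def)
  interpret A: normal A G by fact
  have Ac: "a \<in> carrier G" if "a \<in> A" for a
    using that by simp
  have conjA: "conj w a \<in> A" if "w \<in> carrier G" "a \<in> A" for w a
    by (rule A.inv_op_closed2[OF that])
  define d where "d a = conj v a \<otimes> inv a" for a
  have dA: "d a \<in> A" if "a \<in> A" for a
    unfolding d_def by (intro A.m_closed conjA A.m_inv_closed vc that)
  have d_mult: "d (a \<otimes> c) = d a \<otimes> d c" if ac: "a \<in> A" "c \<in> A" for a c
  proof -
    have comm: "inv a \<otimes> d c = d c \<otimes> inv a"
      using A(2) A.m_inv_closed[OF ac(1)] dA[OF ac(2)] by blast
    have "d (a \<otimes> c) = conj v a \<otimes> (d c \<otimes> inv a)"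
      unfolding d_def using ac vc by (simp add: group_word)
    also have "\<dots> = d a \<otimes> d c"
      unfolding comm[symmetric] unfolding d_def using ac vc by (simp add: group_word)
    finally show ?thesis .
  qed
  have dD: "d ` A \<lhd> G"
    unfolding normal_inv_iff
  proof (intro conjI ballI)
    show "subgroup (d ` A) G"
    proof (rule finite_subgroupI[OF fin])
      show "d ` A \<subseteq> carrier G"
        using dA Ac by blast
      have "d \<one> = \<one>"
        unfolding d_def using vc by simp
      then show "\<one> \<in> d ` A"
        using A.one_closed by (intro image_eqI[of _ _ \<one>]) simp_all
      fix x y assume "x \<in> d ` A" "y \<in> d ` A"
      then obtain a c where ac: "a \<in> A" "c \<in> A" "x = d a" "y = d c"
        by blast
      have "x \<otimes> y = d (a \<otimes> c)"
        using d_mult[OF ac(1,2)] ac by simp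
      then show "x \<otimes> y \<in> d ` A"
        using A.m_closed[OF ac(1,2)] by blast
    qed
    fix w x assume w: "w \<in> carrier G" and "x \<in> d ` A"
    then obtain a where a: "a \<in> A" "x = d a"
      by blast
    have "conj w x = conj w (conj v a) \<otimes> inv (conj w a)"
      unfolding a(2) d_def using a(1) w vc by (simp add: group_word)
    also have "conj w (conj v a) = conj v (conj w a)"
      using cc w vc a(1) by blast
    finally have "conj w x = d (conj w a)"
      by (simp only: d_def)
    then show "conj w x \<in> d ` A"
      using conjA[OF w a(1)] by blast
  qed
  have "d ` A = {\<one>}"
  proof (rule ccontr)
    assume "d ` A \<noteq> {\<one>}"
    then obtain M where M: "M \<subseteq> d ` A" "chief_factor G M {\<one>}"
      by (rule exists_minimal_normal[OF fin dD])
    have MN: "M \<lhd> G" and M1: "{\<one>} \<subset> M"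
      using M(2) by (auto simp: chief_factor_def)
    have "cyclic_group ((G\<lparr>carrier := M\<rparr>) Mod {\<one>})"
      using chief M(2) by blast
    then obtain g where g: "g \<in> M" "\<forall>x\<in>M. \<exists>i::int. x = g [^] i"
      by (rule cyclic_Mod_one[OF MN])
    obtain a where a: "a \<in> A" "g = d a"
      using g(1) M(1) by blast
    have gA: "g \<in> A"
      using dA a by simp
    note gc = Ac[OF gA]
    have gp: "g [^] p = \<one>"
      using A(3) gA by blast
    have g1: "g \<noteq> \<one>"
    proof
      assume "g = \<one>"
      then have "M \<subseteq> {\<one>}"
        using g(2) by auto
      with M1 show False by blast
    qed
    have "conj u g \<in> M"
      using MN u g(1) by (simp add: normal_inv_iff)
    then obtain i :: int where i: "conj u g = g [^] i"
      using g(2) by blast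
    define c where "c = nat (i mod int p)"
    have ug: "conj u g = g [^] c"
      unfolding i c_def by (rule int_pow_as_nat_pow[OF gc gp prime_gt_0_nat[OF p]])
    have ugn: "conj (u [^] j) g = g [^] (c ^ j)" for j :: nat
    proof (induction j)
      case (Suc j)
      have "conj (u [^] Suc j) g = conj (u [^] j) (conj u g)"
        using u gc by (simp add: group_word)
      also have "\<dots> = conj (u [^] j) g [^] c"
        unfolding ug using u gc by (intro conj_pow) auto
      also have "\<dots> = g [^] (c ^ Suc j)"
        unfolding Suc using gc by (simp add: nat_pow_pow mult.commute)
      finally show ?case .
    qed (use gc in simp)
    have "coprime c p"
    proof (rule ccontr)
      assume "\<not> coprime c p"
      then have "p dvd c"
        using prime_imp_coprime[OF p] by (auto simp: coprime_commute)
      then have "g [^] c = \<one>"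
        using pow_cong_exponent[OF gc gp, of c 0] by (simp add: cong_0_iff)
      then have "conj u g = \<one>"
        using ug by simp
      then have "inv u \<otimes> (conj u g) \<otimes> u = \<one>"
        using u by simp
      then show False
        using g1 u gc by (simp add: group_word)
    qed
    then have "[c ^ (p - 1) = 1] (mod p)"
    proof -
      assume "coprime c p"
      then have "[int c ^ (p - 1) = 1] (mod int p)"
        by (intro fermat_int[OF p]) simp
      then have "[int (c ^ (p - 1)) = int 1] (mod int p)"
        by simp
      then show ?thesis
        by (simp only: cong_int_iff)
    qed
    then have vg: "conj v g = g"
      unfolding v_def ugn using pow_cong_exponent[OF gc gp, of "c ^ (p - 1)" 1] gc by simp
    note ac = Ac[OF a(1)]
    have "conj v a = g \<otimes> a"
      unfolding a(2) d_def using ac vc by (simp add: group_word)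
    then have va: "conj (v [^] j) a = g [^] j \<otimes> a" for j :: nat
    proof (induction j)
      case (Suc j)
      have "conj (v [^] Suc j) a = conj v (conj (v [^] j) a)"
        using vc ac unfolding nat_pow_Suc2[OF vc] by (intro conj_conj) auto
      also have "\<dots> = conj v (g [^] j) \<otimes> conj v a"
        unfolding Suc.IH[OF Suc.prems] using vc gc ac by (intro conj_mult) auto
      also have "conj v (g [^] j) = g [^] j"
        using conj_pow[OF vc gc, of j] vg by simp
      finally show ?case
        using Suc.prems gc ac by (simp add: m_assoc)
    qed (use ac in simp)
    have "g [^] n \<otimes> a = \<one> \<otimes> a"
      using va[of n] n(2) a(1) vc ac by simp
    then have "g [^] n = \<one>"
      using gc ac by (simp only: right_cancel nat_pow_closed one_closed)
    then have "ord g dvd n" "ord g dvd p"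
      using gc gp by (simp_all add: pow_eq_id)
    then have "ord g dvd 1"
      using coprime_common_divisor[OF n(1)] by blast
    with ord_eq_1[OF gc] g1 show False
      by (simp only: nat_dvd_1_iff_1)
  qed
  then have "d b = \<one>"
    using b by blast
  then show ?thesis
    unfolding v_def[symmetric]
  proof -
    assume "d b = \<one>"
    then have "d b \<otimes> b = b"
      using Ac[OF b] by simp
    then show "conj v b = b"
      unfolding d_def using vc Ac[OF b] by (simp add: group_word)
  qed
qed

end

section \<open>Laws of elementary abelian groups\<close>

definition E_laws :: "nat \<Rightarrow> nat \<Rightarrow> ('a, 'b) monoid_scheme \<Rightarrow> 'a set" where
  "E_laws p s G = (\<Union>x\<in>carrier G. \<Union>y\<in>carrier G. {gcomm G x y, x [^]\<^bsub>G\<^esub> (s * p)})"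

lemma (in group) E_laws_trivial_iff:
  "E_laws p s G \<subseteq> {\<one>} \<longleftrightarrow>
     (\<forall>x\<in>carrier G. \<forall>y\<in>carrier G. x \<otimes> y = y \<otimes> x \<and> x [^] (s * p) = \<one>)"
proof -
  have "E_laws p s G \<subseteq> {\<one>} \<longleftrightarrow>
     (\<forall>x\<in>carrier G. \<forall>y\<in>carrier G. {gcomm G x y, x [^] (s * p)} \<subseteq> {\<one>})"
    by (simp only: E_laws_def UN_subset_iff)
  also have "\<dots> \<longleftrightarrow> (\<forall>x\<in>carrier G. \<forall>y\<in>carrier G. x \<otimes> y = y \<otimes> x \<and> x [^] (s * p) = \<one>)"
    by (intro ball_cong) (simp_all add: gcomm_eq_one_iff)
  finally show ?thesis .
qed

lemma (in group_hom) hom_E_laws_eq: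
  "h ` E_laws p s G = (\<Union>x\<in>carrier G. \<Union>y\<in>carrier G. {gcomm H (h x) (h y), h x [^]\<^bsub>H\<^esub> (s * p)})"
  unfolding E_laws_def image_UN by (simp add: hom_gcomm hom_nat_pow)

lemma pseudovariety_E_laws:
  "pseudovariety {G. finite_group G \<and>
     (\<forall>p. Factorial_Ring.prime p \<longrightarrow> (\<exists>s. coprime s p \<and> E_laws p s G \<subseteq> {\<one>\<^bsub>G\<^esub>}))}"
proof (rule pseudovariety_of_laws)
  fix p s :: nat and G :: "nat monoid" assume "group G"
  then interpret group G .
  show "E_laws p s G \<subseteq> carrier G"
    unfolding E_laws_def by (intro UN_least) simp
next
  fix p s :: nat and G H :: "nat monoid" and h assume "group_hom G H h"
  then interpret group_hom G H h .
  have vals: "{gcomm H x y, x [^]\<^bsub>H\<^esub> (s * p)} \<subseteq> E_laws p s H" if "x \<in> carrier H" "y \<in> carrier H" for x y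
    unfolding E_laws_def by (intro subsetI UN_I[OF that(1)] UN_I[OF that(2)])
  show "h ` E_laws p s G \<subseteq> E_laws p s H"
    unfolding hom_E_laws_eq by (intro UN_least vals hom_closed)
next
  fix p s :: nat and G H :: "nat monoid" and h assume "group_hom G H h" and im: "h ` carrier G = carrier H"
  then interpret group_hom G H h by simp
  show "E_laws p s H \<subseteq> h ` E_laws p s G"
    unfolding hom_E_laws_eq unfolding E_laws_def im[symmetric] by simp
next
  fix p s s' :: nat and G :: "nat monoid"
  assume "group G" and triv: "E_laws p s G \<subseteq> {\<one>\<^bsub>G\<^esub>}" and "s dvd s'"
  then obtain k where k: "s' = s * k" by blast
  interpret group G by fact
  have "x [^]\<^bsub>G\<^esub> (s' * p) = \<one>\<^bsub>G\<^esub>" if x: "x \<in> carrier G" for x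
  proof -
    have "x [^]\<^bsub>G\<^esub> (s' * p) = (x [^]\<^bsub>G\<^esub> (s * p)) [^]\<^bsub>G\<^esub> k"
      using x by (simp add: nat_pow_pow k ac_simps)
    also have "x [^]\<^bsub>G\<^esub> (s * p) = \<one>\<^bsub>G\<^esub>"
      using triv x unfolding E_laws_trivial_iff by blast
    finally show ?thesis by simp
  qed
  then show "E_laws p s' G \<subseteq> {\<one>\<^bsub>G\<^esub>}"
    using triv unfolding E_laws_trivial_iff by simp
qed

lemma (in group) prime_order_commute:
  assumes r: "Factorial_Ring.prime (order G)" and x: "x \<in> carrier G" and y: "y \<in> carrier G"
  shows "x \<otimes> y = y \<otimes> x"
proof (cases "x = \<one>")
  case False
  have fin: "finite (carrier G)"
    using prime_gt_0_nat[OF r] order_gt_0_iff_finite by simp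
  have "ord x dvd order G"
    using pow_order_eq_1[OF x] x by (simp add: pow_eq_id)
  moreover have "ord x \<noteq> 1"
    using ord_eq_1[OF x] False by blast
  ultimately have "ord x = order G"
    using r by (auto simp: prime_nat_iff)
  then have "card (generate G {x}) = card (carrier G)"
    using generate_pow_card[OF x] by (simp add: order_def)
  moreover have "generate G {x} \<subseteq> carrier G"
    using x by (intro generate_incl) simp
  ultimately have "y \<in> generate G {x}"
    using y fin card_subset_eq by blast
  then obtain k :: int where "y = x [^] k"
    using generate_pow[OF x] by blast
  then show ?thesis
    using int_pow_mult[OF x, of 1 k] int_pow_mult[OF x, of k 1] x by (simp add: add.commute)
qed (use y in simp)

lemma E_obeys_E_laws:
  assumes "K \<in> E" and p: "Factorial_Ring.prime p"
  shows "\<exists>s. coprime s p \<and> E_laws p s K \<subseteq> {\<one>\<^bsub>K\<^esub>}"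
proof -
  let ?V = "{G :: nat monoid. finite_group G \<and>
     (\<forall>p. Factorial_Ring.prime p \<longrightarrow> (\<exists>s. coprime s p \<and> E_laws p s G \<subseteq> {\<one>\<^bsub>G\<^esub>}))}"
  have "{G. group G \<and> Factorial_Ring.prime (order G)} \<subseteq> ?V"
  proof clarify
    fix G :: "nat monoid" assume "group G" and r: "Factorial_Ring.prime (order G)"
    interpret group G by fact
    have "\<exists>s. coprime s p \<and> E_laws p s G \<subseteq> {\<one>\<^bsub>G\<^esub>}" if p: "Factorial_Ring.prime p" for p :: nat
    proof (cases "p = order G")
      case True
      then show ?thesis
        using prime_order_commute[OF r] pow_order_eq_1
        by (intro exI[of _ 1]) (simp add: E_laws_trivial_iff)
    next
      case False
      have "x [^]\<^bsub>G\<^esub> (order G * p) = \<one>\<^bsub>G\<^esub>" if "x \<in> carrier G" for x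
        using that pow_order_eq_1 by (simp flip: nat_pow_pow)
      then have "E_laws p (order G) G \<subseteq> {\<one>\<^bsub>G\<^esub>}"
        using prime_order_commute[OF r] by (simp add: E_laws_trivial_iff)
      then show ?thesis
        using primes_coprime[OF r p] False by blast
    qed
    then show "finite_group G \<and>
      (\<forall>p. Factorial_Ring.prime p \<longrightarrow> (\<exists>s. coprime s p \<and> E_laws p s G \<subseteq> {\<one>\<^bsub>G\<^esub>}))"
      using prime_gt_0_nat[OF r] order_gt_0_iff_finite is_group by (simp add: finite_group_def)
  qed
  then have "K \<in> ?V"
    using assms(1) pseudovariety_E_laws unfolding E_def pv_generated_def by blast
  with p show "\<exists>s. coprime s p \<and> E_laws p s K \<subseteq> {\<one>\<^bsub>K\<^esub>}"
    by simp
qed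

section \<open>The equivalence\<close>

text \<open>
  The exponent is \<open>s = s0 m\<close>, where \<open>s0\<close> comes from the laws of the derived subgroup and \<open>m\<close> is the index of a
  Sylow \<open>p\<close>-subgroup: \<open>s0\<close> brings the derived subgroup into its \<open>p\<close>-part \<open>B\<close>, and \<open>m\<close> brings the whole group into
  the product of the derived subgroup and \<open>P\<close>, which centralizes \<open>B\<close>.
\<close>

lemma structure_obeys_laws:
  fixes G :: "nat monoid" (structure)
  assumes "G \<in> Su \<inter> Der E \<inter> Syl Ab"
  shows "finite_group G \<and> obeys_laws G"
proof -
  have su: "\<forall>H K. chief_factor G H K \<longrightarrow> cyclic_group ((G\<lparr>carrier := H\<rparr>) Mod K)"
    and der: "G\<lparr>carrier := derived G (carrier G)\<rparr> \<in> E"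
    and syl: "\<forall>p P. Factorial_Ring.prime p \<and> sylow_subgroup p P G \<longrightarrow> G\<lparr>carrier := P\<rparr> \<in> Ab"
    and fg: "finite_group G"
    using assms by (auto simp: Su_def Der_def Syl_def)
  interpret group G
    using fg by (simp add: finite_group_def)
  have fin: "finite (carrier G)"
    using fg by (simp add: finite_group_def)
  note D = derived_is_subgroup[of "carrier G", simplified]
  let ?A = "G\<lparr>carrier := derived_subgroup\<rparr>"
  have gA: "group ?A"
    by (rule subgroup.subgroup_is_group[OF D is_group])
  have "\<exists>s. coprime s p \<and> laws p s G \<subseteq> {\<one>}" if p: "Factorial_Ring.prime p" for p :: nat
  proof -
    obtain s0 where s0: "coprime s0 p" "E_laws p s0 ?A \<subseteq> {\<one>\<^bsub>?A\<^esub>}"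
      using E_obeys_E_laws[OF der p] by blast
    have ab: "\<forall>a\<in>derived_subgroup. \<forall>b\<in>derived_subgroup. a \<otimes> b = b \<otimes> a"
      and ex0: "\<forall>a\<in>derived_subgroup. a [^] (s0 * p) = \<one>"
      using s0(2) unfolding group.E_laws_trivial_iff[OF gA] by (auto simp flip: nat_pow_consistent)
    define k where "k = multiplicity p (order G)"
    have n0: "order G \<noteq> 0"
      using fin order_gt_0_iff_finite by simp
    have "\<not> is_unit p"
      using p by auto
    then obtain m where m: "order G = p ^ k * m" "\<not> p dvd m"
      unfolding k_def by (rule multiplicity_decompose'[OF n0])
    have mp: "coprime m p"
      using prime_imp_coprime[OF p m(2)] by (simp add: coprime_commute)
    obtain P where P: "subgroup P G" "card P = p ^ k"
      using sylow_thm[OF p is_group m(1) fin] by blast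
    have "G\<lparr>carrier := P\<rparr> \<in> Ab"
      using syl p P by (auto simp: sylow_subgroup_def k_def)
    then have cP: "comm_group (G\<lparr>carrier := P\<rparr>)"
      by (simp add: Ab_def)
    have Pab: "x \<otimes> y = y \<otimes> x" if "x \<in> P" "y \<in> P" for x y
      using comm_groupE(4)[OF cP, of x y] that by simp
    define s where "s = s0 * m"
    have sp: "coprime s p"
      using s0(1) mp by (simp add: s_def)
    have Dpow: "(a \<otimes> b) [^] (j::nat) = a [^] j \<otimes> b [^] j"
      if "a \<in> derived_subgroup" "b \<in> derived_subgroup" for a b j
      using that ab by (intro pow_mult_distrib derived_carrier) auto
    have exs: "\<forall>a\<in>derived_subgroup. a [^] (s * p) = \<one>"
    proof
      fix a assume a: "a \<in> derived_subgroup"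
      have "a [^] (s * p) = (a [^] (s0 * p)) [^] m"
        using derived_carrier[OF a] by (simp add: nat_pow_pow s_def ac_simps)
      then show "a [^] (s * p) = \<one>"
        using ex0 a by simp
    qed
    define B where "B = {a \<in> derived_subgroup. a [^] p = \<one>}"
    have BD: "a \<in> derived_subgroup" if "a \<in> B" for a
      using that by (simp add: B_def)
    have Bc: "a \<in> carrier G" if "a \<in> B" for a
      by (rule derived_carrier[OF BD[OF that]])
    have BN: "B \<lhd> G"
      unfolding normal_inv_iff
    proof (intro conjI ballI)
      show "subgroup B G"
      proof (rule finite_subgroupI[OF fin])
        show "B \<subseteq> carrier G"
          using Bc by blast
        show "\<one> \<in> B"
          using subgroup.one_closed[OF D] by (simp add: B_def)
        fix x y assume "x \<in> B" "y \<in> B"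
        then show "x \<otimes> y \<in> B"
          using Dpow[of x y p] subgroup.m_closed[OF D, of x y] by (simp add: B_def)
      qed
      fix u a assume u: "u \<in> carrier G" and a: "a \<in> B"
      have "conj u a [^] p = conj u (a [^] p)"
        by (rule conj_pow[OF u Bc[OF a], symmetric])
      then show "conj u a \<in> B"
        using a u derived_conj_closed[OF u BD[OF a]] by (simp add: B_def)
    qed
    have BP: "B \<subseteq> P"
      by (rule normal_subgroup_exponent_le_sylow[OF p m(1) mp fin P BN]) (simp add: B_def)
    have sB: "a [^] s \<in> B" if a: "a \<in> derived_subgroup" for a
      using exs a subgroup_pow_closed[OF D a] derived_carrier[OF a] by (simp add: B_def nat_pow_pow)
    interpret S: second_isomorphism_grp derived_subgroup G P
      by (simp add: second_isomorphism_grp_def second_isomorphism_grp_axioms_def derived_normal P(1))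
    let ?S = "derived_subgroup <#> P"
    have Ss: "subgroup ?S G"
      by (rule S.normal_set_mult_subgroup)
    have pk: "p ^ k > 0"
      using prime_gt_0_nat[OF p] by simp
    have powS: "x [^] m \<in> ?S" if "x \<in> carrier G" for x
      by (rule index_power_mem[OF fin m(1) pk Ss S.H_contained_in_set_mult P S.S_contained_in_set_mult that])
    have fix1: "conj w b = b" if w: "w \<in> ?S" and b: "b \<in> B" for w b
    proof -
      obtain a x where ax: "a \<in> derived_subgroup" "x \<in> P" "w = a \<otimes> x"
        using w by (auto simp: set_mult_def)
      have c: "a \<in> carrier G" "x \<in> carrier G" "b \<in> carrier G"
        using derived_carrier[OF ax(1)] subgroup.mem_carrier[OF P(1) ax(2)] Bc[OF b] by auto
      have "conj x b = b"
        using conj_eq_self_iff[OF c(2,3)] Pab[OF ax(2)] BP b by blast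
      moreover have "conj a b = b"
        using conj_eq_self_iff[OF c(1,3)] ab ax(1) BD[OF b] by blast
      ultimately show ?thesis
        unfolding ax(3) using conj_conj[OF c] by simp
    qed
    have key: "(gcomm G w a) [^] s = \<one>" if w: "w \<in> ?S" and a: "a \<in> derived_subgroup" for w a
    proof -
      have wc: "w \<in> carrier G"
        by (rule subgroup.mem_carrier[OF Ss w])
      note ac = derived_carrier[OF a]
      have "gcomm G w a [^] s = conj w a [^] s \<otimes> (inv a) [^] s"
        unfolding gcomm_def by (rule Dpow[OF derived_conj_closed[OF wc a] subgroup.m_inv_closed[OF D a]])
      also have "conj w a [^] s = conj w (a [^] s)"
        by (rule conj_pow[OF wc ac, symmetric])
      also have "\<dots> = a [^] s"
        by (rule fix1[OF w sB[OF a]])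
      also have "(inv a) [^] s = inv (a [^] s)"
        by (rule nat_pow_inv[OF ac])
      finally show ?thesis
        using ac by simp
    qed
    have key': "(gcomm G a w) [^] s = \<one>" if w: "w \<in> ?S" and a: "a \<in> derived_subgroup" for w a
    proof -
      have c: "w \<in> carrier G" "a \<in> carrier G"
        using subgroup.mem_carrier[OF Ss w] derived_carrier[OF a] by auto
      have "gcomm G a w = inv (gcomm G w a)"
        using c by (simp add: gcomm_def group_word)
      then show ?thesis
        using key[OF w a] nat_pow_inv[of "gcomm G w a" s] c by simp
    qed
    have law4: "gcomm G w z [^] s = \<one>" if w: "w \<in> ?S" and z: "z \<in> ?S" for w z
    proof -
      obtain a x where ax: "a \<in> derived_subgroup" "x \<in> P" "w = a \<otimes> x"
        using w by (auto simp: set_mult_def)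
      obtain b y where bY: "b \<in> derived_subgroup" "y \<in> P" "z = b \<otimes> y"
        using z by (auto simp: set_mult_def)
      have c: "a \<in> carrier G" "x \<in> carrier G" "b \<in> carrier G" "y \<in> carrier G" "z \<in> carrier G"
        using derived_carrier[OF ax(1)] derived_carrier[OF bY(1)] subgroup.mem_carrier[OF P(1)] ax(2) bY(2)
          subgroup.mem_carrier[OF Ss z] by auto
      have xS: "x \<in> ?S"
        using S.S_contained_in_set_mult ax(2) by blast
      have "gcomm G x y = \<one>"
        using gcomm_eq_one_iff[OF c(2,4)] Pab[OF ax(2) bY(2)] by simp
      then have xz: "gcomm G x z = gcomm G x b"
        unfolding bY(3) using gcomm_mult_right[OF c(2,3,4)] c by simp
      have "gcomm G w z = conj a (gcomm G x z) \<otimes> gcomm G a z"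
        unfolding ax(3) by (rule gcomm_mult_left[OF c(5,1,2)])
      also have "\<dots> [^] s = conj a (gcomm G x z) [^] s \<otimes> gcomm G a z [^] s"
        using c by (intro Dpow derived_conj_closed gcomm_in_derived) auto
      also have "conj a (gcomm G x z) [^] s = conj a (gcomm G x z [^] s)"
        using c by (intro conj_pow[symmetric]) auto
      also have "gcomm G x z [^] s = \<one>"
        unfolding xz by (rule key[OF xS bY(1)])
      also have "gcomm G a z [^] s = \<one>"
        by (rule key'[OF z ax(1)])
      finally show ?thesis
        using c by simp
    qed
    have law3: "conj (u [^] (p - 1)) b = b" if u: "u \<in> carrier G" and b: "b \<in> B" for u b
    proof (rule power_centralizes_elementary_abelian[OF fin p _ BN _ _ _ u mp _ b])
      show "\<forall>M. chief_factor G M {\<one>} \<longrightarrow> cyclic_group ((G\<lparr>carrier := M\<rparr>) Mod {\<one>})"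
        using su by blast
      show "\<forall>a\<in>B. \<forall>b\<in>B. a \<otimes> b = b \<otimes> a"
        using ab BD by blast
      show "\<forall>a\<in>B. a [^] p = \<one>"
        by (simp add: B_def)
      show "\<forall>u\<in>carrier G. \<forall>v\<in>carrier G. \<forall>a\<in>B. conj u (conj v a) = conj v (conj u a)"
        using conj_commute_derived[OF ab] BD by blast
      show "\<forall>a\<in>B. \<forall>v\<in>carrier G. conj (v [^] m) a = a"
        using fix1 powS by blast
    qed
    have "laws p s G \<subseteq> {\<one>}"
      unfolding laws_trivial_iff_derived
    proof (intro conjI)
      show "\<forall>a\<in>derived_subgroup. \<forall>u\<in>carrier G.
          u [^] (p - 1) \<otimes> a [^] s = a [^] s \<otimes> u [^] (p - 1)"
      proof (intro ballI)
        fix a u assume a: "a \<in> derived_subgroup" and u: "u \<in> carrier G"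
        show "u [^] (p - 1) \<otimes> a [^] s = a [^] s \<otimes> u [^] (p - 1)"
          by (rule iffD1[OF conj_eq_self_iff law3[OF u sB[OF a]]]) (use u derived_carrier[OF a] in auto)
      qed
      show "\<forall>x\<in>carrier G. \<forall>y\<in>carrier G. gcomm G (x [^] s) (y [^] s) [^] s = \<one>"
      proof (intro ballI)
        fix x y assume xy: "x \<in> carrier G" "y \<in> carrier G"
        have "z [^] s \<in> ?S" if z: "z \<in> carrier G" for z
          using subgroup_pow_closed[OF Ss powS[OF z], of s0] z by (simp add: nat_pow_pow s_def mult.commute)
        then show "gcomm G (x [^] s) (y [^] s) [^] s = \<one>"
          using law4 xy by blast
      qed
    qed (use ab exs in auto)
    with sp show ?thesis
      by blast
  qed
  with fg show ?thesis
    by (simp add: obeys_laws_def)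
qed

lemma in_class_structure_iff:
  assumes G: "group G" "finite (carrier G)"
  shows "in_class G (Su \<inter> Der E \<inter> Syl Ab) \<longleftrightarrow> obeys_laws G"
proof
  assume "in_class G (Su \<inter> Der E \<inter> Syl Ab)"
  then obtain H where H: "H \<in> Su \<inter> Der E \<inter> Syl Ab" "G \<cong> H"
    unfolding in_class_def by blast
  then have "group H" "obeys_laws H"
    using structure_obeys_laws[OF H(1)] by (simp_all add: finite_group_def)
  then show "obeys_laws G"
    using obeys_laws_iso[OF G(1) _ H(2)] by simp
next
  assume L: "obeys_laws G"
  obtain H :: "nat monoid" where H: "group H" "finite (carrier H)" "G \<cong> H"
    using nat_copy[OF G] .
  have "obeys_laws H"
    using L obeys_laws_iso[OF G(1) H(1,3)] by simp
  then have "law_group H"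
    using H by (simp add: law_group_def law_group_axioms_def)
  then have "H \<in> Su \<inter> Der E \<inter> Syl Ab"
    by (rule law_group_structure)
  with G H show "in_class G (Su \<inter> Der E \<inter> Syl Ab)"
    unfolding in_class_def by blast
qed

lemma finite_choice_list:
  assumes "finite S" and "\<And>g. g \<in> S \<Longrightarrow> \<exists>p h. Q g p h"
  obtains ps hs where "length hs = length ps" "\<forall>i<length ps. \<exists>g\<in>S. Q g (ps ! i) (hs ! i)"
    "\<forall>g\<in>S. \<exists>i<length ps. Q g (ps ! i) (hs ! i)"
proof -
  obtain gs where gs: "set gs = S"
    using finite_list[OF assms(1)] by blast
  have "\<forall>g\<in>S. \<exists>ph. Q g (fst ph) (snd ph)"
    using assms(2) by simp
  from bchoice[OF this] obtain c where c: "\<forall>g\<in>S. Q g (fst (c g)) (snd (c g))" ..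
  show ?thesis
  proof (rule that[of "map (snd \<circ> c) gs" "map (fst \<circ> c) gs"])
    show "\<forall>i<length (map (fst \<circ> c) gs). \<exists>g\<in>S. Q g (map (fst \<circ> c) gs ! i) (map (snd \<circ> c) gs ! i)"
    proof (intro allI impI)
      fix i assume i: "i < length (map (fst \<circ> c) gs)"
      then have "gs ! i \<in> S"
        using nth_mem[of i gs] gs by simp
      then show "\<exists>g\<in>S. Q g (map (fst \<circ> c) gs ! i) (map (snd \<circ> c) gs ! i)"
        using c i by (intro bexI[of _ "gs ! i"]) simp_all
    qed
    show "\<forall>g\<in>S. \<exists>i<length (map (fst \<circ> c) gs). Q g (map (fst \<circ> c) gs ! i) (map (snd \<circ> c) gs ! i)"
    proof
      fix g assume g: "g \<in> S"
      then obtain i where "i < length gs" "gs ! i = g"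
        using gs unfolding in_set_conv_nth[symmetric] by (auto simp: in_set_conv_nth)
      then show "\<exists>i<length (map (fst \<circ> c) gs). Q g (map (fst \<circ> c) gs ! i) (map (snd \<circ> c) gs ! i)"
        using c g by (intro exI[of _ i]) simp
    qed
  qed simp
qed

lemma metacyclic_group_obeys_laws:
  assumes "Factorial_Ring.prime p" "residue_primroot p q"
  shows "group (metacyclic p q) \<and> obeys_laws (metacyclic p q)"
proof -
  interpret metacyclic_presentation p q
    using assms by unfold_locales
  show ?thesis
    using is_group obeys_laws by blast
qed

theorem theorem5p2:
  fixes G :: "('a, 'b) monoid_scheme" and q :: "nat \<Rightarrow> nat"
  assumes "group G" and "finite (carrier G)"
    and "\<And>p. Factorial_Ring.prime p \<Longrightarrow> residue_primroot p (q p)"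
  shows
    "(in_class G \<U> \<longleftrightarrow> in_class G (Su \<inter> Der E \<inter> Syl Ab)) \<and>
     (in_class G (Su \<inter> Der E \<inter> Syl Ab) \<longleftrightarrow>
        (\<exists>ps :: nat list. (\<forall>p\<in>set ps. Factorial_Ring.prime p) \<and>
           mon G (product_group {..<length ps} (\<lambda>i. metacyclic (ps ! i) (q (ps ! i)))) \<noteq> {})) \<and>
     ((\<exists>ps :: nat list. (\<forall>p\<in>set ps. Factorial_Ring.prime p) \<and>
           mon G (product_group {..<length ps} (\<lambda>i. metacyclic (ps ! i) (q (ps ! i)))) \<noteq> {}) \<longleftrightarrow>
        (\<exists>(ps :: nat list) (m :: nat). (\<forall>p\<in>set ps. Factorial_Ring.prime p \<and> p dvd order G) \<and>
           mon G (product_group {..<length ps} (\<lambda>i. metacyclic (ps ! i) (q (ps ! i)))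
                  \<times>\<times> product_group {..<m} (\<lambda>_. integer_mod_group (order G))) \<noteq> {}))"
    (is "(?i \<longleftrightarrow> ?ii) \<and> (?ii \<longleftrightarrow> ?iii) \<and> (?iii \<longleftrightarrow> ?iv)")
proof -
  interpret group G by fact
  let ?M = "\<lambda>ps i. metacyclic (ps ! i) (q (ps ! i))"
  let ?Z = "integer_mod_group (order G)"
  have M: "group (?M ps i)" "obeys_laws (?M ps i)"
    if "\<forall>p\<in>set ps. Factorial_Ring.prime p" "i \<in> {..<length ps}" for ps :: "nat list" and i
    using metacyclic_group_obeys_laws[of "ps ! i" "q (ps ! i)"] assms(3)[of "ps ! i"] that by simp_all
  have prod: "group (product_group {..<length ps} (?M ps))" "obeys_laws (product_group {..<length ps} (?M ps))"
    if "\<forall>p\<in>set ps. Factorial_Ring.prime p" for ps :: "nat list"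
    by (rule product_group[OF M(1)[OF that]], assumption)
      (rule obeys_laws_product[OF finite_lessThan M[OF that]], assumption+)
  have iii_laws: "obeys_laws G" if iii: ?iii
  proof -
    obtain ps h where ps: "\<forall>p\<in>set ps. Factorial_Ring.prime p"
      and h: "h \<in> mon G (product_group {..<length ps} (?M ps))"
      using iii by blast
    show ?thesis
      by (rule obeys_laws_embedding[OF assms(1) prod(1)[OF ps] h prod(2)[OF ps]])
  qed
  have iv_laws: "obeys_laws G" if iv: ?iv
  proof -
    obtain ps m h where ps: "\<forall>p\<in>set ps. Factorial_Ring.prime p \<and> p dvd order G"
      and h: "h \<in> mon G (product_group {..<length ps} (?M ps) \<times>\<times> product_group {..<m::nat} (\<lambda>_. ?Z))"
      using iv by blast
    have ps': "\<forall>p\<in>set ps. Factorial_Ring.prime p"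
      using ps by blast
    have Z: "group (product_group {..<m} (\<lambda>_. ?Z))" "obeys_laws (product_group {..<m} (\<lambda>_. ?Z))"
      by (simp_all add: obeys_laws_product obeys_laws_comm_group)
    show ?thesis
      by (rule obeys_laws_embedding[OF assms(1) DirProd_group[OF prod(1)[OF ps'] Z(1)] h
            obeys_laws_DirProd[OF prod(1)[OF ps'] Z(1) prod(2)[OF ps'] Z(2)]])
  qed
  have laws_iii: ?iii if L: "obeys_laws G"
  proof -
    interpret law_group G
      using assms L by (simp add: law_group_def law_group_axioms_def)
    have sep: "\<exists>p h. Factorial_Ring.prime p \<and> (g \<in> derived_subgroup \<longrightarrow> p dvd order G) \<and>
        h \<in> hom G (metacyclic p (q p)) \<and> h g \<noteq> \<one>\<^bsub>metacyclic p (q p)\<^esub>"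
      if "g \<in> carrier G" "g \<noteq> \<one>\<^bsub>G\<^esub>" for g
      by (rule separated_by_metacyclic[OF _ that]) (rule assms(3))
    let ?Q = "\<lambda>g p h. Factorial_Ring.prime p \<and> h \<in> hom G (metacyclic p (q p)) \<and> h g \<noteq> \<one>\<^bsub>metacyclic p (q p)\<^esub>"
    have ex: "\<exists>p h. ?Q g p h" if g: "g \<in> carrier G - {\<one>\<^bsub>G\<^esub>}" for g
    proof -
      have "g \<in> carrier G" "g \<noteq> \<one>\<^bsub>G\<^esub>"
        using g by simp_all
      from sep[OF this] show ?thesis
        by auto
    qed
    have finS: "finite (carrier G - {\<one>\<^bsub>G\<^esub>})"
      using fin by simp
    obtain ps hs where hs: "length hs = length ps"
      "\<forall>i<length ps. \<exists>g\<in>carrier G - {\<one>\<^bsub>G\<^esub>}. ?Q g (ps ! i) (hs ! i)"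
      "\<forall>g\<in>carrier G - {\<one>\<^bsub>G\<^esub>}. \<exists>i<length ps. ?Q g (ps ! i) (hs ! i)"
      using finite_choice_list[of _ ?Q, OF finS ex] .
    have ps: "\<forall>p\<in>set ps. Factorial_Ring.prime p"
      using hs(2) by (auto simp: in_set_conv_nth)
    have "(\<lambda>x. \<lambda>i\<in>{..<length ps}. (hs ! i) x) \<in> mon G (product_group {..<length ps} (?M ps))"
    proof (rule separating_family_mon[OF assms(1) M(1)[OF ps]])
      show "hs ! i \<in> hom G (?M ps i)" if "i \<in> {..<length ps}" for i
        using hs(2) that by blast
      show "\<exists>i\<in>{..<length ps}. (hs ! i) g \<noteq> \<one>\<^bsub>?M ps i\<^esub>" if "g \<in> carrier G" "g \<noteq> \<one>\<^bsub>G\<^esub>" for g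
        using hs(3) that by blast
    qed
    with ps show ?thesis
      by blast
  qed
  have laws_iv: ?iv if L: "obeys_laws G"
  proof -
    interpret law_group G
      using assms L by (simp add: law_group_def law_group_axioms_def)
    have sep: "\<exists>p h. Factorial_Ring.prime p \<and> (g \<in> derived_subgroup \<longrightarrow> p dvd order G) \<and>
        h \<in> hom G (metacyclic p (q p)) \<and> h g \<noteq> \<one>\<^bsub>metacyclic p (q p)\<^esub>"
      if "g \<in> carrier G" "g \<noteq> \<one>\<^bsub>G\<^esub>" for g
      by (rule separated_by_metacyclic[OF _ that]) (rule assms(3))
    let ?Q = "\<lambda>g p h. Factorial_Ring.prime p \<and> p dvd order G \<and> h \<in> hom G (metacyclic p (q p)) \<and>
      h g \<noteq> \<one>\<^bsub>metacyclic p (q p)\<^esub>"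
    let ?D = "derived_subgroup - {\<one>\<^bsub>G\<^esub>}" and ?D' = "carrier G - derived_subgroup"
    have ex: "\<exists>p h. ?Q g p h" if g: "g \<in> ?D" for g
    proof -
      have gD: "g \<in> derived_subgroup" and g1: "g \<noteq> \<one>\<^bsub>G\<^esub>"
        using g by simp_all
      from sep[OF derived_carrier[OF gD] g1] gD show ?thesis
        by auto
    qed
    have finD: "finite ?D"
      using finite_subset[OF subgroup.subset[OF derived_subgroup_subgroup] fin] by simp
    obtain ps hs where hs: "length hs = length ps"
      "\<forall>i<length ps. \<exists>g\<in>?D. ?Q g (ps ! i) (hs ! i)" "\<forall>g\<in>?D. \<exists>i<length ps. ?Q g (ps ! i) (hs ! i)"
      using finite_choice_list[of _ ?Q, OF finD ex] .
    have ps: "\<forall>p\<in>set ps. Factorial_Ring.prime p \<and> p dvd order G"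
      using hs(2) by (auto simp: in_set_conv_nth)
    then have ps': "\<forall>p\<in>set ps. Factorial_Ring.prime p"
      by blast
    have n: "order G > 0"
      using fin order_gt_0_iff_finite by simp
    let ?R = "\<lambda>g (_::unit) h. h \<in> hom G ?Z \<and> h g \<noteq> \<one>\<^bsub>?Z\<^esub>"
    have ex': "\<exists>p h. ?R g p h" if g: "g \<in> ?D'" for g
    proof -
      have "g \<in> carrier G" "g \<notin> derived_subgroup"
        using g by simp_all
      then obtain lam where lam: "additive_mod (int (order G)) G (carrier G) lam"
        "\<not> [lam g = 0] (mod int (order G))"
        by (rule nonderived_separated_by_character)
      have "(\<lambda>x. lam x mod int (order G)) \<in> hom G ?Z"
      proof (rule homI)
        show "lam x mod int (order G) \<in> carrier ?Z" for x
          using n by (simp add: carrier_integer_mod_group)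
        show "lam (x \<otimes>\<^bsub>G\<^esub> y) mod int (order G) = (lam x mod int (order G)) \<otimes>\<^bsub>?Z\<^esub> (lam y mod int (order G))"
          if "x \<in> carrier G" "y \<in> carrier G" for x y
          using additive_modD[OF lam(1) that] by (simp add: cong_def mod_simps)
      qed
      moreover have "lam g mod int (order G) \<noteq> \<one>\<^bsub>?Z\<^esub>"
        using lam(2) by (simp add: cong_def)
      ultimately show ?thesis
        by blast
    qed
    have finD': "finite ?D'"
      using fin by simp
    obtain us :: "unit list" and ks where ks: "length ks = length us"
      "\<forall>i<length us. \<exists>g\<in>?D'. ?R g (us ! i) (ks ! i)" "\<forall>g\<in>?D'. \<exists>i<length us. ?R g (us ! i) (ks ! i)"
      using finite_choice_list[of _ ?R, OF finD' ex'] .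
    define h where "h x = (\<lambda>i\<in>{..<length ps}. (hs ! i) x)" for x
    define k where "k x = (\<lambda>i\<in>{..<length us}. (ks ! i) x)" for x
    let ?P = "product_group {..<length ps} (?M ps)" and ?C = "product_group {..<length us} (\<lambda>_. ?Z)"
    have h: "h \<in> hom G ?P"
      unfolding h_def by (rule family_hom) (use hs(2) in blast)
    have k: "k \<in> hom G ?C"
      unfolding k_def by (rule family_hom) (use ks(2) in blast)
    have gC: "group ?C"
      by simp
    have hk: "(\<lambda>x. (h x, k x)) \<in> hom G (?P \<times>\<times> ?C)"
      using h k by (simp add: hom_paired)
    interpret hk: group_hom G "?P \<times>\<times> ?C" "\<lambda>x. (h x, k x)"
      using assms(1) DirProd_group[OF prod(1)[OF ps'] gC] hk by (simp add: group_hom_def group_hom_axioms_def)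
    have "inj_on (\<lambda>x. (h x, k x)) (carrier G)"
      unfolding hk.inj_iff_trivial_ker kernel_def
    proof (intro equalityI subsetI)
      fix g assume g: "g \<in> {x \<in> carrier G. (h x, k x) = \<one>\<^bsub>?P \<times>\<times> ?C\<^esub>}"
      have hg: "(hs ! i) g = \<one>\<^bsub>?M ps i\<^esub>" if i: "i < length ps" for i
      proof -
        have "h g i = \<one>\<^bsub>?P\<^esub> i"
          using g by simp
        with i show ?thesis by (simp add: h_def)
      qed
      have kg: "(ks ! i) g = \<one>\<^bsub>?Z\<^esub>" if i: "i < length us" for i
      proof -
        have "k g i = \<one>\<^bsub>?C\<^esub> i"
          using g by simp
        with i show ?thesis by (simp add: k_def)
      qed
      have "g \<notin> ?D'"
        using ks(3) kg by blast
      moreover have "g \<notin> ?D"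
        using hs(3) hg by blast
      ultimately show "g \<in> {\<one>\<^bsub>G\<^esub>}"
        using g by blast
    next
      fix g assume "g \<in> {\<one>\<^bsub>G\<^esub>}"
      then have g: "g = \<one>\<^bsub>G\<^esub>" by simp
      show "g \<in> {x \<in> carrier G. (h x, k x) = \<one>\<^bsub>?P \<times>\<times> ?C\<^esub>}"
        unfolding g by (intro CollectI conjI one_closed hk.hom_one)
    qed
    with hk have "(\<lambda>x. (h x, k x)) \<in> mon G (?P \<times>\<times> ?C)"
      by (simp add: mon_def)
    with ps show ?thesis
      by blast
  qed
  have iii: "?iii \<longleftrightarrow> obeys_laws G"
    using iii_laws laws_iii by (rule iffI)
  have iv: "?iv \<longleftrightarrow> obeys_laws G"
    using iv_laws laws_iv by (rule iffI)
  show ?thesis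
    unfolding iii iv in_class_\<U>_iff[OF assms(1,2)] in_class_structure_iff[OF assms(1,2)] by simp
qed

end
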